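(* Let $h\ge1$ be a fixed integer. (i) If $\mathcal V_h=\varnothing$, then, as $x\to\infty$, $$B_h(x)\le x\exp\!\left(-\left(\frac1{\sqrt6}+o_h(1)\right)\sqrt{\log x\,\log\log x}\right).$$ (ii) If $\mathcal V_h\ne\varnothing$, then, assuming the Bateman--Horn conjecture, $$B_h(x)\asymp_h\frac{x}{(\log x)^2}.$$
   Context: $\mathbb N=\{1,2,\ldots\}$; $\sigma(n)=\sum_{d\mid n}d$; $I(n)=\sigma(n)/n$. Put $$B_h(x)=\#\{n\in\mathbb N:n\le x,\ \sigma(n)\mid\sigma(n+h)\},\qquad \mathcal V_h=\left\{v\in\mathbb N:v\ge2,\ \frac{I(v)}{I(v+h)}\in\mathbb N\right\}.$$ $o_h(1)$ denotes a function of $x$ (depending on $h$) tending to $0$ as $x\to\infty$; $f(x)\asymp_h g(x)$ means $c_h g(x)\le f(x)\le C_h g(x)$ for all sufficiently large $x$ (in terms of $h$), with constants $c_h,C_h>0$ depending only on $h$. Bateman--Horn conjecture: let $g_1,\ldots,g_k\in\mathbb Z[t]$ be distinct irreducible polynomials with positive leading coefficients, and for each prime $p$ let $\omega(p)$ be the number of residue classes modulo $p$ on which $g_1\cdots g_k$ vanishes; if $\omega(p)<p$ for every prime $p$, then, as $T\to\infty$, $$\#\{1\le t\le T:g_1(t),\ldots,g_k(t)\text{ all prime}\}\sim\frac{\mathfrak S}{\prod_i\deg g_i}\int_2^T\frac{du}{(\log u)^k},\quad \mathfrak S=\prod_p\left(1-\frac1p\right)^{-k}\left(1-\frac{\omega(p)}p\right)>0.$$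 *)

theory Defs
  imports
    "HOL-Analysis.Analysis"
    "HOL-Computational_Algebra.Computational_Algebra"
    "HOL-Library.Landau_Symbols"
begin

definition sigma :: "nat \<Rightarrow> nat" where
  "sigma n = (\<Sum>d | d dvd n. d)"

definition abundancy :: "nat \<Rightarrow> real" where
  "abundancy n = real (sigma n) / real n"

definition B :: "nat \<Rightarrow> real \<Rightarrow> nat" where
  "B h x = card {n::nat. 1 \<le> n \<and> real n \<le> x \<and> sigma n dvd sigma (n + h)}"

definition V :: "nat \<Rightarrow> nat set" where
  "V h = {v. 2 \<le> v \<and> abundancy v / abundancy (v + h) \<in> \<nat> - {0}}"

definition root_count_mod :: "int poly set \<Rightarrow> nat \<Rightarrow> nat" where
  "root_count_mod G p = card {a \<in> {0..<int p}. int p dvd poly (\<Prod>g\<in>G. g) a}"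

definition bh_factor :: "int poly set \<Rightarrow> nat \<Rightarrow> real" where
  "bh_factor G p =
     (if prime p
      then (1 - real (root_count_mod G p) / real p) / (1 - 1 / real p) ^ card G
      else 1)"

text \<open>
  The distinct polynomials $g_1, \ldots, g_k$ are given as the set \<open>G\<close>, so $k$ is \<open>card G\<close>.
  The Euler product defining the singular series converges only conditionally in general;
  \<open>has_prod\<close> takes its factors in increasing order of $p$.  Reading irreducibility in
  $\mathbb{Z}[t]$ rather than $\mathbb{Q}[t]$ makes no difference: constants other than $1$ and
  polynomials with nontrivial content vanish identically modulo some prime, so the local
  condition excludes them.
\<close>

definition Bateman_Horn_conjecture :: bool where
  "Bateman_Horn_conjecture \<longleftrightarrow>
     (\<forall>G :: int poly set.
        finite G \<and> G \<noteq> {} \<and> (\<forall>g\<in>G. irreducible g \<and> lead_coeff g > 0) \<and>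
        (\<forall>p. prime p \<longrightarrow> root_count_mod G p < p) \<longrightarrow>
        (\<exists>S>0. bh_factor G has_prod S \<and>
           (\<lambda>T::real. real (card {t::nat. 1 \<le> t \<and> real t \<le> T \<and> (\<forall>g\<in>G. prime (poly g (int t)))}))
             \<sim>[at_top]
           (\<lambda>T. S / real (\<Prod>g\<in>G. degree g) * integral {2..T} (\<lambda>u. 1 / ln u ^ card G))))"

end

theory Submission
  imports Defs "HOL-Number_Theory.Number_Theory" "HOL-Real_Asymp.Real_Asymp"
begin

text \<open>
  Discarding a negligible set of \<open>n\<close>, write \<open>n = a p\<close> and \<open>n + h = b q\<close> with primes \<open>p\<close>, \<open>q\<close>
  exceeding \<open>y = exp (sqrt (log x log log x))\<close> and coprime to their cofactors.  The condition becomes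
  \<open>(q + 1) \<sigma>(b) = m (p + 1) \<sigma>(a)\<close>.  Together with \<open>b q - a p = h\<close> this is a linear system for
  \<open>(p, q)\<close>; it is singular exactly when \<open>a = b + h\<close>, and then \<open>I(b) / I(b + h) = m\<close>, so that
  \<open>b\<close> lies in \<open>V h\<close>.

  In the nonsingular case put \<open>d = gcd (p + 1) (q + 1)\<close>.  Then \<open>(p + 1) / d\<close> divides \<open>\<sigma>(b)\<close> and
  \<open>(q + 1) / d\<close> divides \<open>m \<sigma>(a)\<close>.  If \<open>d\<close> is small, one counts \<open>q\<close> in residue classes modulo \<open>p d\<close>
  for given \<open>b\<close> and given divisor \<open>D = (p + 1) / d\<close> of \<open>\<sigma>(b)\<close>; the sum over \<open>D\<close> with weights \<open>D\<close> to the
  power \<open>-\<kappa>\<close> costs only \<open>exp (O (sqrt (log x)))\<close>.  If \<open>d\<close> is large, there are few pairs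
  \<open>p \<equiv> q \<equiv> -1 (mod d)\<close>, and if \<open>p q\<close> is much larger than \<open>x\<close>, then there are few triples \<open>(a, b, m)\<close>.
  This saves nearly \<open>sqrt y\<close>, more than is needed.

  In the singular case \<open>n = (v + h) p\<close>, \<open>n + h = v q\<close>, and \<open>p\<close>, \<open>q\<close> are values of two linear forms in
  one parameter.  Selberg's sieve bounds their number from above with a convergent sum over \<open>v\<close>, and
  for one fixed \<open>v\<close> in \<open>V h\<close> the Bateman--Horn conjecture gives the lower bound.
\<close>

section \<open>Sums over integers with prescribed prime factors\<close>

text \<open>Put l = log y. Rankin's bound saves exp (-c l) for smooth n at a cost of about exp ((log
  x)^c), so any c < 1/2 is possible; c = 9/20 is taken. With small and large d separated at W = sqrt
  y, small d costs W / y^(1 - \<kappa>) and large d gains 1 / W. For \<kappa> = 1/20 every term is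
  at most exp (-9/20 l) up to smaller factors, and 9/20 > 21/50 > 41/100 > 1 / sqrt 6 leaves room
  for these.

  The recurring obstacle is the +1 in counting a residue class in an interval. Modulo p d it is
  harmless if p d <= q and costs a factor W if p < q and d <= W; modulo p q it is harmless only if p
  q is at most about x. Hence large d is split again at V = x^(1/10): if p q > x and d <= V, both
  primes are so large that the first count works with a power of x in place of y; if d > V, then p q
  may reach Z = x^(21/20), since Z / x is much smaller than V.

  The divisors D must be counted on average over b, as pointwise bounds for the divisor function
  exceed y. This is the reason for the weights \<open>neg_sigma\<close>, which are the functions
  \<sigma>_{-\<kappa>}.\<close>

definition neg_sigma :: "real \<Rightarrow> nat \<Rightarrow> real" where
  "neg_sigma \<kappa> n = (\<Sum>d | d dvd n. real d powr - \<kappa>)"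

lemma neg_sigma_nonneg: "neg_sigma \<kappa> n \<ge> 0"
  unfolding neg_sigma_def by (intro sum_nonneg) auto

lemma neg_sigma_1 [simp]: "neg_sigma \<kappa> (Suc 0) = 1"
  unfolding neg_sigma_def by simp

text \<open>Each divisor of m n is a product of a divisor of m and one of n, possibly in several
  ways. It is applied to factors with common divisors, such as \<open>k * sigma b\<close> and
  \<open>sigma m * sigma n\<close>.\<close>

lemma neg_sigma_mult_le:
  assumes "m > 0" "n > 0"
  shows "neg_sigma \<kappa> (m * n) \<le> neg_sigma \<kappa> m * neg_sigma \<kappa> n"
proof -
  let ?D = "{d. d dvd m} \<times> {d. d dvd n}"
  have fin: "finite ?D" using assms by auto
  have sub: "{d. d dvd m * n} \<subseteq> (\<lambda>(a, b). a * b) ` ?D"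
  proof
    fix d assume "d \<in> {d. d dvd m * n}"
    then obtain a b where "d = a * b" "a dvd m" "b dvd n"
      using division_decomp[of d m n] by auto
    then show "d \<in> (\<lambda>(a, b). a * b) ` ?D" by force
  qed
  have "neg_sigma \<kappa> (m * n) \<le> (\<Sum>d\<in>(\<lambda>(a, b). a * b) ` ?D. real d powr - \<kappa>)"
    unfolding neg_sigma_def by (rule sum_mono2) (use sub fin in auto)
  also have "\<dots> \<le> (\<Sum>x\<in>?D. real ((\<lambda>(a, b). a * b) x) powr - \<kappa>)"
    by (rule sum_image_le[OF fin, unfolded o_def]) auto
  also have "\<dots> = (\<Sum>(a,b)\<in>?D. real a powr - \<kappa> * real b powr - \<kappa>)"
    by (intro sum.cong) (auto simp: powr_mult)
  also have "\<dots> = neg_sigma \<kappa> m * neg_sigma \<kappa> n"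
    unfolding neg_sigma_def by (simp add: sum_product sum.cartesian_product)
  finally show ?thesis .
qed

text \<open>Induction on \<open>A\<close>: writing n = p^j m with p not dividing m splits off one
  Euler factor. The form with an exact set of prime factors is also what Selberg's denominator
  needs, where each \<open>A\<close> is bounded on its own.\<close>

lemma sum_exact_prime_factors_le:
  fixes f :: "nat \<Rightarrow> real"
  assumes nonneg: "\<And>n. f n \<ge> 0" and one: "f 1 \<le> 1"
    and sub: "\<And>m n. m > 0 \<Longrightarrow> n > 0 \<Longrightarrow> coprime m n \<Longrightarrow> f (m * n) \<le> f m * f n"
    and "finite A" "\<And>p. p \<in> A \<Longrightarrow> prime p"
  shows "(\<Sum>n | n \<in> {1..N} \<and> prime_factors n = A. f n) \<le> (\<Prod>p\<in>A. \<Sum>j=1..N. f (p ^ j))"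
  using \<open>finite A\<close> assms(5)
proof (induction A)
  case empty
  have "{n. n \<in> {1..N} \<and> prime_factors n = {}} \<subseteq> {1}"
    by (auto simp: prime_factorization_empty_iff)
  then have "(\<Sum>n | n \<in> {1..N} \<and> prime_factors n = {}. f n) \<le> (\<Sum>n\<in>{1}. f n)"
    by (intro sum_mono2) (use nonneg in auto)
  with one show ?case by simp
next
  case (insert p A)
  let ?S = "\<lambda>A. {n. n \<in> {1..N} \<and> prime_factors n = A}"
  let ?g = "\<lambda>(j, m). p ^ j * m"
  have p: "prime p" using insert.prems by auto
  have sub1: "?S (insert p A) \<subseteq> ?g ` ({1..N} \<times> ?S A)"
  proof
    fix n assume n: "n \<in> ?S (insert p A)"
    then have n0: "n > 0" and nN: "n \<le> N" and pf: "prime_factors n = insert p A" by auto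
    define j where "j = multiplicity p n"
    obtain m where m: "n = p ^ j * m" "\<not> p dvd m"
      using multiplicity_decompose'[of n p] p n0 unfolding j_def by (metis not_prime_unit gr_implies_not0)
    have pd: "p dvd n" using pf by (metis in_prime_factors_imp_dvd insertI1)
    have j1: "j \<ge> 1" using pd n0 p unfolding j_def
      by (simp add: Suc_leI prime_multiplicity_gt_zero_iff)
    have m0: "m > 0" using m n0 by (auto intro: Nat.gr0I)
    \<comment> \<open>The exponent stays in {1..N} because j < 2^j <= p^j <= n <= N.\<close>
    have "j < 2 ^ j" by simp
    also have "\<dots> \<le> p ^ j" using prime_ge_2_nat[OF p] by (simp add: power_mono)
    also have "\<dots> \<le> n" using m m0 by simp
    finally have jN: "j \<le> N" using nN by simp
    have "prime_factors n = insert p (prime_factors m)"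
      using m m0 p j1 prime_gt_0_nat[OF p]
      by (simp add: prime_factors_product prime_factorization_prime_power prime_factors_power)
    moreover have "p \<notin> prime_factors m" using m by auto
    ultimately have "prime_factors m = A" using pf insert.hyps(2) by (metis Diff_insert_absorb)
    moreover have "m \<le> n" using m prime_gt_0_nat[OF p] by simp
    ultimately have "(j, m) \<in> {1..N} \<times> ?S A" using j1 jN nN m0 by auto
    then show "n \<in> ?g ` ({1..N} \<times> ?S A)" using m by force
  qed
  have fin: "finite ({1..N} \<times> ?S A)" by auto
  have "(\<Sum>n\<in>?S (insert p A). f n) \<le> (\<Sum>n\<in>?g ` ({1..N} \<times> ?S A). f n)"
    by (rule sum_mono2) (use sub1 nonneg in auto)
  also have "\<dots> \<le> (\<Sum>x\<in>{1..N} \<times> ?S A. f (?g x))"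
    by (rule sum_image_le[OF fin, unfolded o_def]) (use nonneg in auto)
  also have "\<dots> \<le> (\<Sum>(j,m)\<in>{1..N} \<times> ?S A. f (p ^ j) * f m)"
  proof (rule sum_mono, clarsimp)
    fix j m assume h: "Suc 0 \<le> j" "Suc 0 \<le> m" "A = prime_factors m"
    have "\<not> p dvd m" using insert.hyps h p by (auto simp: in_prime_factors_iff)
    then have "coprime (p ^ j) m" using p by (simp add: prime_imp_coprime)
    then show "f (p ^ j * m) \<le> f (p ^ j) * f m"
      using sub[of "p ^ j" m] h prime_gt_0_nat[OF p] by simp
  qed
  also have "\<dots> = (\<Sum>j=1..N. f (p ^ j)) * (\<Sum>m\<in>?S A. f m)"
    by (simp add: sum_product sum.cartesian_product)
  also have "\<dots> \<le> (\<Sum>j=1..N. f (p ^ j)) * (\<Prod>p\<in>A. \<Sum>j=1..N. f (p ^ j))"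
    by (intro mult_left_mono insert.IH sum_nonneg) (use insert.prems nonneg in auto)
  finally show ?case using insert.hyps by simp
qed

text \<open>Sorting by the exact set of prime factors gives the terms of the product expanded over
  the subsets of \<open>P\<close>.\<close>

lemma sum_prime_factors_subset_le:
  fixes f :: "nat \<Rightarrow> real"
  assumes nonneg: "\<And>n. f n \<ge> 0" and one: "f 1 \<le> 1"
    and sub: "\<And>m n. m > 0 \<Longrightarrow> n > 0 \<Longrightarrow> coprime m n \<Longrightarrow> f (m * n) \<le> f m * f n"
    and "finite P" "\<And>p. p \<in> P \<Longrightarrow> prime p"
  shows "(\<Sum>n | n \<in> {1..N} \<and> prime_factors n \<subseteq> P. f n) \<le> (\<Prod>p\<in>P. 1 + (\<Sum>j=1..N. f (p ^ j)))"
proof -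
  let ?S = "{n. n \<in> {1..N} \<and> prime_factors n \<subseteq> P}"
  have "sum f ?S = (\<Sum>A\<in>Pow P. \<Sum>n\<in>{n\<in>?S. prime_factors n = A}. f n)"
    by (rule sum.group[symmetric]) (use assms in auto)
  also have "\<dots> \<le> (\<Sum>A\<in>Pow P. \<Prod>p\<in>A. \<Sum>j=1..N. f (p ^ j))"
  proof (rule sum_mono)
    fix A assume A: "A \<in> Pow P"
    have "{n\<in>?S. prime_factors n = A} = {n. n \<in> {1..N} \<and> prime_factors n = A}" using A by auto
    moreover have "finite A" "\<And>p. p \<in> A \<Longrightarrow> prime p" using A assms finite_subset[of A P] by auto
    ultimately show "(\<Sum>n\<in>{n\<in>?S. prime_factors n = A}. f n) \<le> (\<Prod>p\<in>A. \<Sum>j=1..N. f (p ^ j))"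
      using sum_exact_prime_factors_le[OF nonneg one sub, of A N] by presburger
  qed
  also have "\<dots> = (\<Prod>p\<in>P. (\<Sum>j=1..N. f (p ^ j)) + 1)"
    by (subst prod_add[OF \<open>finite P\<close>]) simp
  finally show ?thesis by (simp add: add.commute)
qed

lemma sum_prime_factors_subset_le_exp:
  fixes f :: "nat \<Rightarrow> real"
  assumes nonneg: "\<And>n. f n \<ge> 0" and one: "f 1 \<le> 1"
    and sub: "\<And>m n. m > 0 \<Longrightarrow> n > 0 \<Longrightarrow> coprime m n \<Longrightarrow> f (m * n) \<le> f m * f n"
    and "finite P" "\<And>p. p \<in> P \<Longrightarrow> prime p"
  shows "(\<Sum>n | n \<in> {1..N} \<and> prime_factors n \<subseteq> P. f n) \<le> exp (\<Sum>p\<in>P. \<Sum>j=1..N. f (p ^ j))"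
proof -
  have "(\<Prod>p\<in>P. 1 + (\<Sum>j=1..N. f (p ^ j))) \<le> (\<Prod>p\<in>P. exp (\<Sum>j=1..N. f (p ^ j)))"
    by (intro prod_mono conjI exp_ge_add_one_self add_nonneg_nonneg sum_nonneg nonneg) auto
  also have "\<dots> = exp (\<Sum>p\<in>P. \<Sum>j=1..N. f (p ^ j))" using \<open>finite P\<close> by (simp add: exp_sum)
  finally show ?thesis using sum_prime_factors_subset_le[of f P N] assms by fastforce
qed

text \<open>Of two complementary divisors one is at most sqrt n.\<close>

lemma neg_sigma_0_le:
  assumes "n > 0"
  shows "neg_sigma 0 n \<le> 2 * sqrt (real n)"
proof -
  let ?D = "{d. d dvd n \<and> real d \<le> sqrt (real n)}"
  have sub: "?D \<subseteq> {1..nat \<lfloor>sqrt (real n)\<rfloor>}"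
    using assms by (auto simp: le_nat_floor Suc_le_eq intro: Nat.gr0I)
  have "card ?D \<le> nat \<lfloor>sqrt (real n)\<rfloor>"
    using card_mono[OF _ sub] by simp
  then have c: "real (card ?D) \<le> sqrt (real n)"
    by (meson le_trans of_nat_floor of_nat_mono order.trans real_sqrt_ge_zero of_nat_0_le_iff)
  have fin: "finite ?D" using assms by auto
  have "{d. d dvd n} \<subseteq> ?D \<union> (\<lambda>d. n div d) ` ?D"
  proof
    fix d assume "d \<in> {d. d dvd n}"
    then obtain e where e: "n = d * e" by auto
    show "d \<in> ?D \<union> (\<lambda>d. n div d) ` ?D"
    proof (cases "real d \<le> sqrt (real n)")
      case False
      have "real e \<le> sqrt (real n)"
      proof (rule ccontr)
        assume "\<not> ?thesis"
        then have "sqrt (real n) * sqrt (real n) < real d * real e"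
          using False by (intro mult_strict_mono') auto
        then show False using e by simp
      qed
      moreover have "n div e = d" using e assms by auto
      moreover have "e dvd n" using e by simp
      ultimately show ?thesis by force
    qed (use e in auto)
  qed
  then have "card {d. d dvd n} \<le> card (?D \<union> (\<lambda>d. n div d) ` ?D)"
    by (intro card_mono) (use fin in auto)
  also have "\<dots> \<le> card ?D + card ?D"
    using card_Un_le[of ?D "(\<lambda>d. n div d) ` ?D"] card_image_le[OF fin, of "\<lambda>d. n div d"] by linarith
  finally have "real (card {d. d dvd n}) \<le> 2 * sqrt (real n)" using c by linarith
  moreover have "neg_sigma 0 n = real (card {d. d dvd n})"
  proof -
    have "neg_sigma 0 n = (\<Sum>d | d dvd n. 1)" unfolding neg_sigma_def
      by (intro sum.cong) (use assms in auto)
    then show ?thesis by simp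
  qed
  ultimately show ?thesis by simp
qed

lemma neg_sigma_le:
  assumes "n > 0" "\<kappa> \<ge> 0"
  shows "neg_sigma \<kappa> n \<le> 2 * sqrt (real n)"
proof -
  have "neg_sigma \<kappa> n \<le> neg_sigma 0 n" unfolding neg_sigma_def
    by (intro sum_mono powr_mono) (use assms in \<open>auto simp: Suc_le_eq intro: Nat.gr0I\<close>)
  then show ?thesis using neg_sigma_0_le[OF assms(1)] by linarith
qed

section \<open>Harmonic and zeta sums\<close>

lemma harmonic_le:
  assumes "N \<ge> 1"
  shows "(\<Sum>k=1..N. 1 / real k) \<le> 1 + ln (real N)"
  using euler_mascheroni_sequence_decreasing[of 1 N] assms by (simp add: harm_def divide_inverse)

lemma harmonic_ge: "ln (real N + 1) \<le> (\<Sum>k=1..N. 1 / real k)"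
  using harm_ge_ln[of N] by (simp add: harm_def divide_inverse)

text \<open>A discrete comparison with the integral of u^(-1-\<delta>). The induction step is
  m^(-1-\<delta>) <= ((m-1)^(-\<delta>) - m^(-\<delta>)) / \<delta>, which follows from 1 +
  \<delta>/m <= exp (\<delta>/m) <= (1 - 1/m)^(-\<delta>).\<close>

lemma zeta_le:
  assumes "0 < \<delta>"
  shows "(\<Sum>k=1..N. real k powr (-1 - \<delta>)) \<le> 1 + 1 / \<delta>"
proof -
  have "(\<Sum>k=1..Suc n. real k powr (-1 - \<delta>)) \<le> 1 + (1 - real (Suc n) powr (-\<delta>)) / \<delta>" for n
  proof (induction n)
    case (Suc n)
    define m where "m = real (Suc (Suc n))"
    have m: "m > 1" "real (Suc n) = m * (1 - 1 / m)" by (auto simp: m_def field_simps)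
    have "1 + \<delta> / m \<le> exp (\<delta> / m)" by simp
    also have "\<dots> \<le> exp (-\<delta> * ln (1 - 1 / m))"
    proof -
      have "ln (1 - 1 / m) \<le> - (1 / m)" using m ln_le_minus_one[of "1 - 1 / m"] by simp
      then have "\<delta> * ln (1 - 1 / m) \<le> \<delta> * - (1 / m)" using assms by (intro mult_left_mono) auto
      then show ?thesis by simp
    qed
    also have "\<dots> = (1 - 1 / m) powr (-\<delta>)" using m by (simp add: powr_def)
    finally have "m powr (-\<delta>) * (1 + \<delta> / m) \<le> m powr (-\<delta>) * (1 - 1 / m) powr (-\<delta>)"
      by (intro mult_left_mono) auto
    also have "\<dots> = real (Suc n) powr (-\<delta>)" using m by (simp add: powr_mult)
    finally have "m powr (-\<delta>) + \<delta> * (m powr (-\<delta>) / m) \<le> real (Suc n) powr (-\<delta>)"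
      by (simp add: algebra_simps)
    moreover have "m powr (-1 - \<delta>) = m powr (-\<delta>) / m"
      using m powr_add[of m "-1" "-\<delta>"] by (simp add: powr_minus field_simps)
    ultimately have "m powr (-1 - \<delta>) \<le> (real (Suc n) powr (-\<delta>) - m powr (-\<delta>)) / \<delta>"
      using assms by (simp add: field_simps)
    with Suc show ?case by (simp add: m_def diff_divide_distrib)
  qed simp
  note * = this
  show ?thesis
  proof (cases N)
    case (Suc n)
    have "(1 - real (Suc n) powr (-\<delta>)) / \<delta> \<le> 1 / \<delta>" using assms by (intro divide_right_mono) auto
    then show ?thesis using *[of n] Suc by simp
  qed (use assms in simp)
qed

section \<open>Smooth numbers and divisor sums\<close>

lemma prod_primes_dvd:
  fixes n :: nat
  assumes "finite A" "\<And>p. p \<in> A \<Longrightarrow> prime p" "\<And>p. p \<in> A \<Longrightarrow> p dvd n"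
  shows "\<Prod>A dvd n"
  using assms
proof (induction A)
  case (insert p A)
  have "coprime p (\<Prod>A)"
    using insert by (intro prod_coprime_right) (metis insertCI primes_coprime)
  then show ?case using insert by (simp add: divides_mult)
qed simp

text \<open>Chebyshev's argument: the product of these primes divides the central binomial
  coefficient, which is at most 4^n.\<close>

lemma card_primes_dyadic_le:
  assumes "n \<ge> 1"
  shows "real (card {p. prime p \<and> n < p \<and> p \<le> 2 * n}) * ln (real n) \<le> 2 * real n * ln 2"
proof -
  let ?A = "{p. prime p \<and> n < p \<and> p \<le> 2 * n}"
  have fin: "finite ?A" by (rule finite_subset[of _ "{..2 * n}"]) auto
  have "\<Prod>?A dvd (2 * n choose n)"
  proof (rule prod_primes_dvd[OF fin])
    fix p assume p: "p \<in> ?A"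
    have "p dvd fact (2 * n)" using p by (simp add: prime_dvd_fact_iff)
    moreover have "fact (2 * n) = fact n * fact n * (2 * n choose n)"
      using binomial_fact_lemma[of n "2 * n"] by (simp add: mult.assoc)
    moreover have "\<not> p dvd fact n" using p by (simp add: prime_dvd_fact_iff)
    ultimately show "p dvd (2 * n choose n)" using p by (simp add: prime_dvd_mult_iff)
  qed simp
  then have "\<Prod>?A \<le> (2 * n choose n)" by (rule dvd_imp_le) simp
  also have "\<dots> \<le> 2 ^ (2 * n)" by (rule binomial_le_pow2)
  finally have "\<Prod>?A \<le> 2 ^ (2 * n)" .
  moreover have "n ^ card ?A \<le> \<Prod>?A"
    using prod_mono[of ?A "\<lambda>_. n" "\<lambda>p. p"] by (simp add: less_imp_le)
  ultimately have "n ^ card ?A \<le> 2 ^ (2 * n)" by linarith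
  then have "real (n ^ card ?A) \<le> real (2 ^ (2 * n))" by (rule of_nat_mono)
  then have "real n ^ card ?A \<le> 2 ^ (2 * n)" by (simp only: of_nat_power of_nat_numeral)
  then have "ln (real n ^ card ?A) \<le> ln (2 ^ (2 * n))"
    using assms by (subst ln_le_cancel_iff) auto
  then show ?thesis using assms by (simp add: ln_realpow)
qed

text \<open>The block (2^k, 2^(k+1)] holds at most 2 * 2^k / k primes and so contributes at most 2 /
  k; the 1/2 comes from p = 2.\<close>

lemma sum_inverse_primes_pow2_le:
  assumes "k \<ge> 1"
  shows "(\<Sum>p | prime p \<and> p \<le> 2 ^ k. 1 / real p) \<le> 1 / 2 + 2 * (\<Sum>i=1..k - 1. 1 / real i)"
  using assms
proof (induction k rule: nat_induct_at_least)
  case base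
  have "{p::nat. prime p \<and> p \<le> 2 ^ 1} = {2}" by (auto dest: prime_ge_2_nat intro: le_antisym)
  then show ?case by simp
next
  case (Suc k)
  let ?A = "{p::nat. prime p \<and> 2 ^ k < p \<and> p \<le> 2 * 2 ^ k}"
  let ?B = "{p::nat. prime p \<and> p \<le> 2 ^ k}"
  have fin: "finite ?A" by (rule finite_subset[of _ "{..2 * 2 ^ k}"]) auto
  have finB: "finite ?B" by (rule finite_subset[of _ "{..2 ^ k}"]) auto
  have eq: "{p::nat. prime p \<and> p \<le> 2 ^ Suc k} = ?B \<union> ?A" by auto
  have "(\<Sum>p\<in>?A. 1 / real p) \<le> (\<Sum>p\<in>?A. 1 / 2 ^ k)"
  proof (rule sum_mono)
    fix p assume "p \<in> ?A"
    then have "real (2 ^ k) \<le> real p" by (intro of_nat_mono) simp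
    then show "1 / real p \<le> 1 / 2 ^ k" by (intro frac_le) auto
  qed
  also have "\<dots> = real (card ?A) / 2 ^ k" by simp
  also have "\<dots> \<le> 2 / real k"
  proof -
    have "real (card ?A) * (real k * ln 2) \<le> 2 * 2 ^ k * ln 2"
      using card_primes_dyadic_le[of "2 ^ k"] by (simp add: ln_realpow)
    then have "real (card ?A) * real k \<le> 2 * 2 ^ k" by simp
    then show ?thesis using Suc by (simp add: field_simps)
  qed
  finally have A: "(\<Sum>p\<in>?A. 1 / real p) \<le> 2 / real k" .
  have "(\<Sum>p | prime p \<and> p \<le> 2 ^ Suc k. 1 / real p) = (\<Sum>p\<in>?B. 1 / real p) + (\<Sum>p\<in>?A. 1 / real p)"
    unfolding eq using fin finB by (intro sum.union_disjoint) auto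
  also have "\<dots> \<le> 1 / 2 + 2 * (\<Sum>i=1..k - 1. 1 / real i) + 2 / real k"
    using A Suc by linarith
  also have "\<dots> = 1 / 2 + 2 * (\<Sum>i=1..k. 1 / real i)"
    using Suc by (cases k) (auto simp: sum.cl_ivl_Suc)
  finally show ?case by simp
qed

text \<open>Mertens' sum with leading constant 2 instead of 1. Only the order loglog y matters: in
  the application the sum multiplies (log x)^(9/20), which is small against (log x)^(1/2).\<close>

lemma sum_inverse_primes_le:
  assumes "y \<ge> exp 1"
  shows "(\<Sum>p | prime p \<and> real p \<le> y. 1 / real p) \<le> 5 + 2 * ln (ln y)"
proof -
  have y: "y > 0" "ln y \<ge> 1" using assms by (smt (verit) exp_gt_zero, smt (verit) exp_gt_zero ln_ge_iff)
  define k where "k = nat \<lceil>log 2 y\<rceil>"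
  have e52: "5 / 2 \<le> exp (1::real)" using exp_lower_Taylor_quadratic[of 1] by simp
  have lg: "log 2 y > 0"
  proof -
    have "(1::real) < exp 1" by simp
    then have "y > 1" using assms by linarith
    then show ?thesis by simp
  qed
  have k1: "k \<ge> 1" unfolding k_def using lg by linarith
  have k2: "log 2 y \<le> real k" unfolding k_def using lg by linarith
  have k3: "real k \<le> log 2 y + 1" unfolding k_def using lg by linarith
  have l2: "ln (2::real) \<ge> 2 / 3" by (rule ln2_ge_two_thirds)
  have "y \<ge> 1" using assms one_le_exp_iff[of 1] by linarith
  then have "log 2 y \<le> 3 / 2 * ln y"
    using mult_right_mono[OF l2, of "ln y"] y by (simp add: log_def pos_divide_le_eq mult_ac)
  then have "real k \<le> 5 / 2 * ln y" using k3 y by linarith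
  \<comment> \<open>5/2 is enlarged to e so that taking logarithms adds exactly 1.\<close>
  also have "\<dots> \<le> exp 1 * ln y"
    using mult_right_mono[OF e52, of "ln y"] y by linarith
  finally have "real k \<le> exp 1 * ln y" .
  then have "ln (real k) \<le> ln (exp 1 * ln y)" using k1 by (subst ln_le_cancel_iff) (use y in auto)
  also have "\<dots> = 1 + ln (ln y)"
  proof -
    have "0 < ln y" using y by linarith
    from ln_mult_pos[OF exp_gt_zero[of 1] this] show ?thesis by (simp only: ln_exp)
  qed
  finally have lk: "ln (real k) \<le> 1 + ln (ln y)" .
  have yk: "y \<le> 2 ^ k"
    using k2 y by (simp add: log_le_iff powr_realpow)
  have "(\<Sum>p | prime p \<and> real p \<le> y. 1 / real p) \<le> (\<Sum>p | prime p \<and> p \<le> 2 ^ k. 1 / real p)"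
  proof (rule sum_mono2)
    show "finite {p::nat. prime p \<and> p \<le> 2 ^ k}" by (rule finite_subset[of _ "{..2 ^ k}"]) auto
    show "{p. prime p \<and> real p \<le> y} \<subseteq> {p::nat. prime p \<and> p \<le> 2 ^ k}"
    proof clarify
      fix p assume "prime p" "real p \<le> y"
      then have "real p \<le> real (2 ^ k)" unfolding of_nat_power of_nat_numeral using yk by linarith
      then show "p \<le> 2 ^ k" by (simp only: of_nat_le_iff)
    qed
  qed auto
  also have "\<dots> \<le> 1 / 2 + 2 * (\<Sum>i=1..k - 1. 1 / real i)" using sum_inverse_primes_pow2_le k1 .
  also have "(\<Sum>i=1..k - 1. 1 / real i) \<le> (\<Sum>i=1..k. 1 / real i)" by (rule sum_mono2) auto
  also have "\<dots> \<le> 1 + ln (real k)" using harmonic_le k1 .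
  also have "\<dots> \<le> 2 + ln (ln y)" using lk by simp
  finally show ?thesis by simp
qed

section \<open>Rankin's bound for smooth numbers\<close>

lemma sum_geometric_le:
  fixes r :: real
  assumes "0 \<le> r" "r \<le> 3 / 4"
  shows "(\<Sum>j<n. r ^ j) \<le> 4"
proof -
  have "(\<Sum>j<n. r ^ j) = (1 - r ^ n) / (1 - r)" using assms by (simp add: sum_gp_strict)
  also have "\<dots> \<le> 1 / (1 - r)" using assms by (intro divide_right_mono) auto
  also have "\<dots> \<le> 4" using assms by (simp add: field_simps)
  finally show ?thesis .
qed

lemma powr_neg_half_le:
  assumes "p \<ge> 2" "s \<ge> 1 / 2"
  shows "real p powr - s \<le> 3 / 4"
proof -
  have "real p powr - s \<le> real p powr - (1 / 2)" using assms by (intro powr_mono) auto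
  also have "\<dots> \<le> 2 powr - (1 / 2)" using assms by (intro powr_mono2') auto
  also have "\<dots> = 1 / sqrt 2" by (simp only: powr_minus_divide powr_half_sqrt)
  also have "\<dots> \<le> 3 / 4"
  proof -
    have "4 / 3 \<le> sqrt 2" by (rule real_le_rsqrt) (simp add: power2_eq_square)
    then show ?thesis by (simp add: field_simps)
  qed
  finally show ?thesis .
qed

lemma powr_power_swap: "real (p ^ j) powr s = (real p powr s) ^ j"
  by (induction j) (auto simp: powr_mult)

text \<open>Rankin's trick: 1 <= (X / n)^s for n <= X, and the sum of n^(-s) over smooth n is
  bounded by an Euler product. A prime contributes at most 4 p^(-s), where 4 bounds a geometric
  series of ratio at most 3/4, and p^(-s) = p^(1-s) / p <= y^(1-s) / p leads to Mertens'
  sum.\<close>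

lemma card_smooth_le:
  assumes y: "y \<ge> exp 1" and s: "1 / 2 \<le> s" "s \<le> 1"
  shows "real (card {n \<in> {1..X}. \<forall>p\<in>prime_factors n. real p \<le> y})
    \<le> real X powr s * exp (4 * y powr (1 - s) * (5 + 2 * ln (ln y)))"
proof -
  define P where "P = {p. prime p \<and> real p \<le> y}"
  have finP: "finite P" unfolding P_def
    by (rule finite_subset[of _ "{..nat \<lfloor>y\<rfloor>}"]) (auto simp: le_nat_floor)
  let ?S = "{n \<in> {1..X}. \<forall>p\<in>prime_factors n. real p \<le> y}"
  have S: "?S = {n. n \<in> {1..X} \<and> prime_factors n \<subseteq> P}" by (auto simp: P_def)
  have "real (card ?S) = (\<Sum>n\<in>?S. 1)" by simp
  also have "\<dots> \<le> (\<Sum>n\<in>?S. real X powr s * real n powr - s)"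
  proof (rule sum_mono)
    fix n assume "n \<in> ?S"
    then have "real n powr s \<le> real X powr s" "n > 0" using s by (auto intro!: powr_mono2)
    then show "1 \<le> real X powr s * real n powr - s" by (simp add: powr_minus field_simps)
  qed
  also have "\<dots> = real X powr s * (\<Sum>n\<in>?S. real n powr - s)" by (simp add: sum_distrib_left)
  also have "\<dots> \<le> real X powr s * exp (\<Sum>p\<in>P. \<Sum>j=1..X. real (p ^ j) powr - s)"
    unfolding S by (intro mult_left_mono sum_prime_factors_subset_le_exp)
      (use finP in \<open>auto simp: powr_mult P_def\<close>)
  also have "\<dots> \<le> real X powr s * exp (\<Sum>p\<in>P. 4 * (y powr (1 - s) * (1 / real p)))"
  proof (intro mult_left_mono exp_le_cancel_iff[THEN iffD2] sum_mono)
    fix p assume p: "p \<in> P"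
    then have p2: "p \<ge> 2" by (simp add: P_def prime_ge_2_nat)
    define r where "r = real p powr - s"
    have r: "0 \<le> r" "r \<le> 3 / 4" using powr_neg_half_le[OF p2 s(1)] by (auto simp: r_def)
    have "(\<Sum>j=1..X. real (p ^ j) powr - s) = (\<Sum>j=1..X. r ^ j)"
      unfolding r_def by (simp only: powr_power_swap)
    also have "\<dots> = r * (\<Sum>j<X. r ^ j)"
      by (simp add: sum_distrib_left sum.atLeast1_atMost_eq)
    also have "\<dots> \<le> r * 4" using r by (intro mult_left_mono sum_geometric_le)
    also have "r = real p powr (1 - s) * (1 / real p)"
      using p2 by (simp add: r_def powr_diff powr_minus field_simps)
    also have "\<dots> \<le> y powr (1 - s) * (1 / real p)"
      using p s by (intro mult_right_mono powr_mono2) (auto simp: P_def)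
    finally show "(\<Sum>j=1..X. real (p ^ j) powr - s) \<le> 4 * (y powr (1 - s) * (1 / real p))"
      by (simp add: mult.commute)
  qed auto
  also have "(\<Sum>p\<in>P. 4 * (y powr (1 - s) * (1 / real p))) = 4 * y powr (1 - s) * (\<Sum>p\<in>P. 1 / real p)"
    by (simp add: sum_distrib_left mult.assoc)
  also have "real X powr s * exp \<dots> \<le> real X powr s * exp (4 * y powr (1 - s) * (5 + 2 * ln (ln y)))"
    using sum_inverse_primes_le[OF y]
    by (intro mult_left_mono exp_le_cancel_iff[THEN iffD2]) (auto simp: P_def)
  finally show ?thesis .
qed

section \<open>The sum-of-divisors function\<close>

lemma sigma_ge:
  assumes "n > 0"
  shows "sigma n \<ge> n"
  unfolding sigma_def
  using member_le_sum[of n "{d. d dvd n}" "\<lambda>d. d"] assms by simp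

lemma sigma_pos: "n > 0 \<Longrightarrow> sigma n > 0"
  using sigma_ge[of n] by simp

lemma sigma_ge_Suc:
  assumes "n > 1"
  shows "sigma n \<ge> n + 1"
proof -
  have "(\<Sum>d\<in>{1, n}. d) \<le> sigma n" unfolding sigma_def
    by (rule sum_mono2) (use assms in auto)
  then show ?thesis using assms by simp
qed

lemma sigma_mult_coprime:
  assumes "coprime m n" "m > 0" "n > 0"
  shows "sigma (m * n) = sigma m * sigma n"
proof -
  let ?D = "{d. d dvd m} \<times> {d. d dvd n}"
  have inj: "inj_on (\<lambda>(a, b). a * b) ?D"
  proof (rule inj_onI, clarify)
    fix a b a' b' assume "a dvd m" "a' dvd m" "b dvd n" "b' dvd n" "a * b = a' * b'"
    moreover have "coprime a b'" "coprime a' b"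
      using calculation assms(1) by (meson coprime_divisors)+
    ultimately show "a = a' \<and> b = b'" using coprime_crossproduct_nat[of a b' a' b] by simp
  qed
  have img: "(\<lambda>(a, b). a * b) ` ?D = {d. d dvd m * n}"
  proof (intro equalityI subsetI)
    fix d assume "d \<in> {d. d dvd m * n}"
    then obtain a b where "d = a * b" "a dvd m" "b dvd n"
      using division_decomp[of d m n] by auto
    then show "d \<in> (\<lambda>(a, b). a * b) ` ?D" by force
  qed (auto intro: mult_dvd_mono)
  have "sigma (m * n) = (\<Sum>x\<in>?D. case x of (a, b) \<Rightarrow> a * b)"
    unfolding sigma_def img[symmetric] using inj by (subst sum.reindex) auto
  also have "\<dots> = sigma m * sigma n"
    by (simp add: sigma_def sum_product sum.cartesian_product)
  finally show ?thesis .
qed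

lemma sigma_prime: "prime p \<Longrightarrow> sigma p = p + 1"
proof -
  assume p: "prime p"
  then have "d dvd p \<longleftrightarrow> d = 1 \<or> d = p" for d unfolding prime_nat_iff by (metis dvd_refl one_dvd)
  then have "{d. d dvd p} = {1, p}" by blast
  then show ?thesis unfolding sigma_def using prime_gt_1_nat[OF p] by simp
qed

lemma sigma_prime_power_le:
  assumes "prime p"
  shows "sigma (p ^ j) \<le> 2 * p ^ j"
proof -
  have p: "p \<ge> 2" using assms by (rule prime_ge_2_nat)
  have "{d. d dvd p ^ j} = (\<lambda>i. p ^ i) ` {..j}"
    using divides_primepow_nat[OF assms] by (auto simp: image_iff)
  then have "sigma (p ^ j) = (\<Sum>i\<le>j. p ^ i)" unfolding sigma_def
    using p by (simp add: sum.reindex inj_on_def)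
  also have "(\<Sum>i\<le>j. p ^ i) \<le> 2 * p ^ j"
  proof (induction j)
    case (Suc j)
    have "2 * p ^ j \<le> p * p ^ j" using p by (intro mult_right_mono) auto
    with Suc show ?case unfolding sum.atMost_Suc power_Suc by linarith
  qed simp
  finally show ?thesis .
qed

text \<open>The involution d -> n / d turns \<sigma>(n) / n into the sum of 1 / d over the divisors,
  a part of the harmonic sum.\<close>

lemma sigma_le:
  assumes "n > 0"
  shows "real (sigma n) \<le> real n * (1 + ln (real n))"
proof -
  have "real (sigma n) = (\<Sum>d | d dvd n. real d)" by (simp add: sigma_def)
  also have "\<dots> = (\<Sum>d | d dvd n. real n / real d)"
  proof (rule sum.reindex_bij_witness[of _ "\<lambda>d. n div d" "\<lambda>d. n div d"])
    fix d assume "d \<in> {d. d dvd n}"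
    then obtain e where e: "n = d * e" by auto
    have de: "d > 0" "e > 0" using e assms by auto
    show "n div (n div d) = d" "n div (n div d) = d" "n div d \<in> {d. d dvd n}" "n div d \<in> {d. d dvd n}"
      "real n / real (n div d) = real d"
      using e de by auto
  qed
  also have "\<dots> = real n * (\<Sum>d | d dvd n. 1 / real d)" by (simp add: sum_distrib_left)
  also have "\<dots> \<le> real n * (\<Sum>d=1..n. 1 / real d)"
    by (intro mult_left_mono sum_mono2)
      (use assms in \<open>auto dest: dvd_imp_le simp: Suc_le_eq intro: Nat.gr0I\<close>)
  also have "\<dots> \<le> real n * (1 + ln (real n))"
    using assms by (intro mult_left_mono harmonic_le) auto
  finally show ?thesis .
qed

text \<open>The Dirichlet series of \<sigma>_{-\<kappa>} at 1 + \<delta> is \<zeta>(1 + \<delta>)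
  \<zeta>(1 + \<kappa> + \<delta>). Opening the divisor sum by k = d e produces both factors, and
  the second is relaxed to \<zeta>(1 + \<kappa>).\<close>

lemma sum_neg_sigma_le:
  assumes "\<kappa> > 0" "\<delta> > 0"
  shows "(\<Sum>k=1..M. neg_sigma \<kappa> k * real k powr (-1 - \<delta>)) \<le> (1 + 1 / \<kappa>) * (1 + 1 / \<delta>)"
proof -
  let ?I = "SIGMA k:{1..M}. {d. d dvd k}"
  let ?f = "\<lambda>(d, e). (real d powr (-1 - \<kappa>)) * (real e powr (-1 - \<delta>))"
  have "(\<Sum>k=1..M. neg_sigma \<kappa> k * real k powr (-1 - \<delta>))
      = (\<Sum>(k,d)\<in>?I. real d powr -\<kappa> * real k powr (-1 - \<delta>))"
    unfolding neg_sigma_def by (subst sum.Sigma[symmetric]) (auto simp: sum_distrib_right)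
  also have "\<dots> \<le> (\<Sum>x\<in>?I. ?f ((\<lambda>(k, d). (d, k div d)) x))"
  proof (rule sum_mono, clarsimp)
    fix k d :: nat assume k: "Suc 0 \<le> k" "k \<le> M" "d dvd k"
    then obtain e where e: "k = d * e" by auto
    have de: "d > 0" "e > 0" using e k by (auto intro: Nat.gr0I)
    have "real d powr -\<kappa> * real k powr (-1 - \<delta>) = real d powr (-\<kappa> + (-1 - \<delta>)) * real e powr (-1 - \<delta>)"
      by (simp only: e of_nat_mult powr_mult powr_add mult.assoc of_nat_0_le_iff)
    also have "\<dots> \<le> real d powr (-1 - \<kappa>) * real e powr (-1 - \<delta>)"
      using de assms by (intro mult_right_mono powr_mono) auto
    finally show "real d powr -\<kappa> * real k powr (-1 - \<delta>)
        \<le> real d powr (-1 - \<kappa>) * real (k div d) powr (-1 - \<delta>)" using e de by simp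
  qed
  also have "\<dots> = (\<Sum>x\<in>(\<lambda>(k, d). (d, k div d)) ` ?I. ?f x)"
    by (rule sum.reindex[symmetric, unfolded o_def]) (auto simp: inj_on_def elim!: dvdE)
  also have "\<dots> \<le> (\<Sum>x\<in>{1..M} \<times> {1..M}. ?f x)"
  proof (rule sum_mono2)
    show "(\<lambda>(k, d). (d, k div d)) ` ?I \<subseteq> {1..M} \<times> {1..M}"
    proof clarsimp
      fix k d :: nat assume k: "Suc 0 \<le> k" "k \<le> M" "d dvd k"
      then have "d \<le> k" "k div d \<le> k" "d > 0" "k div d > 0"
        by (auto dest: dvd_imp_le intro: Nat.gr0I simp: div_greater_zero_iff)
      then show "Suc 0 \<le> d \<and> d \<le> M \<and> Suc 0 \<le> k div d \<and> k div d \<le> M" using k by linarith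
    qed
  qed auto
  also have "\<dots> = (\<Sum>d=1..M. real d powr (-1 - \<kappa>)) * (\<Sum>e=1..M. real e powr (-1 - \<delta>))"
    by (simp add: sum_product sum.cartesian_product)
  also have "\<dots> \<le> (1 + 1 / \<kappa>) * (1 + 1 / \<delta>)"
    using assms by (intro mult_mono zeta_le sum_nonneg) auto
  finally show ?thesis .
qed

lemma sum_split_first:
  fixes g :: "nat \<Rightarrow> real"
  shows "(\<Sum>j=1..n+1. g j) = g 1 + (\<Sum>j<n. g (j + 2))"
  by (induction n) auto

text \<open>The average over b of the divisors D of \<sigma>(b) with weight D^(-\<kappa>), again by
  Rankin's trick and an Euler product. At a prime, \<sigma>(p) = p + 1, and p + 1 is then replaced
  by an arbitrary integer k. Giving up primality puts 1 / \<delta> in the exponent where log (1 /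
  \<delta>) would be expected; this is affordable because \<delta> will be 1 / sqrt (log X).\<close>

lemma sum_neg_sigma_sigma_le:
  assumes \<kappa>: "\<kappa> > 0" and \<delta>: "\<delta> > 0" "\<delta> \<le> 1"
  shows "(\<Sum>b=1..X. neg_sigma \<kappa> (sigma b) / real b)
    \<le> real X powr \<delta> * exp ((16 + 4 / \<kappa>) * (1 + 1 / \<delta>))"
proof -
  define f where "f = (\<lambda>b. neg_sigma \<kappa> (sigma b) * real b powr (-1 - \<delta>))"
  define P where "P = {p::nat. prime p \<and> p \<le> X}"
  have finP: "finite P" "P \<subseteq> {1..X}" unfolding P_def by (auto simp: Suc_le_eq prime_gt_0_nat)
  have f0: "f n \<ge> 0" for n by (simp add: f_def neg_sigma_nonneg)
  have "(\<Sum>b=1..X. neg_sigma \<kappa> (sigma b) / real b) \<le> (\<Sum>b=1..X. real X powr \<delta> * f b)"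
  proof (rule sum_mono)
    fix b assume b: "b \<in> {1..X}"
    then have "real b powr \<delta> \<le> real X powr \<delta>" using \<delta> by (intro powr_mono2) auto
    then have "1 / real b \<le> real X powr \<delta> * real b powr (-1 - \<delta>)"
      using b by (simp add: powr_diff powr_minus field_simps)
    then have "neg_sigma \<kappa> (sigma b) * (1 / real b)
        \<le> neg_sigma \<kappa> (sigma b) * (real X powr \<delta> * real b powr (-1 - \<delta>))"
      by (intro mult_left_mono neg_sigma_nonneg)
    then show "neg_sigma \<kappa> (sigma b) / real b \<le> real X powr \<delta> * f b"
      by (simp add: f_def mult_ac)
  qed
  also have "\<dots> = real X powr \<delta> * (\<Sum>b | b \<in> {1..X} \<and> prime_factors b \<subseteq> P. f b)"
  proof -
    have "{b. b \<in> {1..X} \<and> prime_factors b \<subseteq> P} = {1..X}"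
      by (auto simp: P_def in_prime_factors_iff) (meson dvd_imp_le le_trans Suc_le_eq)
    then show ?thesis by (simp add: sum_distrib_left)
  qed
  also have "\<dots> \<le> real X powr \<delta> * exp (\<Sum>p\<in>P. \<Sum>j=1..X. f (p ^ j))"
  proof (intro mult_left_mono sum_prime_factors_subset_le_exp)
    fix m n :: nat assume mn: "m > 0" "n > 0" "coprime m n"
    have "f (m * n) = neg_sigma \<kappa> (sigma m * sigma n) * (real m powr (-1 - \<delta>) * real n powr (-1 - \<delta>))"
      using mn by (simp add: f_def sigma_mult_coprime powr_mult)
    also have "\<dots> \<le> (neg_sigma \<kappa> (sigma m) * neg_sigma \<kappa> (sigma n)) * (real m powr (-1 - \<delta>) * real n powr (-1 - \<delta>))"
      using mn by (intro mult_right_mono neg_sigma_mult_le sigma_pos) auto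
    finally show "f (m * n) \<le> f m * f n" by (simp add: f_def mult_ac)
  qed (use finP f0 in \<open>auto simp: P_def f_def sigma_def\<close>)
  also have "(\<Sum>p\<in>P. \<Sum>j=1..X. f (p ^ j))
      \<le> (\<Sum>p\<in>P. 4 * (neg_sigma \<kappa> (p + 1) * real (p + 1) powr (-1 - \<delta>)) + 12 * real p powr (-1 - \<delta>))"
  proof (rule sum_mono)
    fix p assume p: "p \<in> P"
    then have "prime p" "p \<le> X" by (auto simp: P_def)
    with prime_ge_2_nat[of p] have pp: "prime p" "p \<ge> 2" "X \<ge> 1" by simp_all
    define r where "r = real p powr - (1/2)"
    have r: "0 \<le> r" "r \<le> 3 / 4" using powr_neg_half_le[OF pp(2), of "1/2"] by (auto simp: r_def)
    \<comment> \<open>p >= (p + 1) / 2, and 2^(1 + \<delta>) <= 4.\<close>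
    have f1: "f p \<le> 4 * (neg_sigma \<kappa> (p + 1) * real (p + 1) powr (-1 - \<delta>))"
    proof -
      have "real p powr (-1 - \<delta>) \<le> (real (p + 1) / 2) powr (-1 - \<delta>)"
        using pp \<delta> by (intro powr_mono2') auto
      also have "\<dots> = real (p + 1) powr (-1 - \<delta>) * 2 powr (1 + \<delta>)"
        using powr_minus_divide[of 2 "1 + \<delta>"] by (simp add: powr_divide)
      also have "\<dots> \<le> real (p + 1) powr (-1 - \<delta>) * 2 powr 2"
        using \<delta> by (intro mult_left_mono powr_mono) auto
      finally have "real p powr (-1 - \<delta>) \<le> 4 * real (p + 1) powr (-1 - \<delta>)" by simp
      then have "neg_sigma \<kappa> (p + 1) * real p powr (-1 - \<delta>)
         \<le> neg_sigma \<kappa> (p + 1) * (4 * real (p + 1) powr (-1 - \<delta>))"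
        by (intro mult_left_mono neg_sigma_nonneg)
      then show ?thesis using pp by (simp add: f_def sigma_prime mult_ac)
    qed
    \<comment> \<open>From the second power on, the square root bound for \<open>neg_sigma\<close>
      suffices: p^((j+2)/2) against p^(-(j+2)(1+\<delta>)) leaves at most p^(-1-\<delta>)
      p^(-j/2).\<close>
    have fj: "f (p ^ (j + 2)) \<le> 3 * real p powr (-1 - \<delta>) * r ^ j" for j
    proof -
      let ?q = "p ^ (j + 2)"
      have q1: "?q \<ge> 1" using pp by simp
      have "neg_sigma \<kappa> (sigma ?q) \<le> 2 * sqrt (real (sigma ?q))"
        using \<kappa> sigma_pos[of ?q] q1 by (intro neg_sigma_le) auto
      also have "\<dots> \<le> 2 * sqrt (real (2 * ?q))"
        using sigma_prime_power_le[OF pp(1), of "j + 2"] by (simp del: of_nat_mult of_nat_power power_Suc)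
      also have "\<dots> = 2 * sqrt 2 * real ?q powr (1/2)"
        by (simp add: real_sqrt_mult powr_half_sqrt)
      also have "\<dots> \<le> 3 * real ?q powr (1/2)"
        by (intro mult_right_mono) (auto intro!: real_le_lsqrt simp: power2_eq_square
            intro: order.trans[OF mult_left_mono[of "sqrt 2" "3/2" 2]])
      finally have "f ?q \<le> 3 * real ?q powr (1/2) * real ?q powr (-1 - \<delta>)"
        unfolding f_def by (intro mult_right_mono) auto
      also have "\<dots> = 3 * real ?q powr (- (1/2) - \<delta>)"
        by (simp flip: powr_add)
      also have "real ?q powr (- (1/2) - \<delta>) = real p powr (real (j + 2) * (- (1/2) - \<delta>))"
      proof -
        have "real ?q = real p powr real (j + 2)" using pp by (subst powr_realpow) simp_all
        then show ?thesis by (simp only: powr_powr)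
      qed
      also have "\<dots> \<le> real p powr ((-1 - \<delta>) + real j * (- (1/2)))"
        using pp \<delta> by (intro powr_mono) (auto simp: algebra_simps)
      also have "\<dots> = real p powr (-1 - \<delta>) * r ^ j"
      proof -
        have "r > 0" using pp by (simp add: r_def)
        then have "r ^ j = r powr real j" by (simp add: powr_realpow)
        also have "\<dots> = real p powr (real j * (- (1/2)))"
          unfolding r_def powr_powr by (simp only: mult.commute)
        finally show ?thesis by (simp only: powr_add)
      qed
      finally show ?thesis by simp
    qed
    have "(\<Sum>j=1..X. f (p ^ j)) \<le> (\<Sum>j=1..X+1. f (p ^ j))" by (rule sum_mono2) (auto simp: f0)
    also have "\<dots> = f p + (\<Sum>j<X. f (p ^ (j + 2)))"
      using sum_split_first[of "\<lambda>j. f (p ^ j)" X] by (simp only: power_one_right)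
    also have "\<dots> \<le> f p + (\<Sum>j<X. 3 * real p powr (-1 - \<delta>) * r ^ j)"
      by (intro add_left_mono sum_mono fj)
    also have "\<dots> = f p + 3 * real p powr (-1 - \<delta>) * (\<Sum>j<X. r ^ j)" by (simp add: sum_distrib_left)
    also have "\<dots> \<le> f p + 3 * real p powr (-1 - \<delta>) * 4"
      using r by (intro add_left_mono mult_left_mono sum_geometric_le) auto
    finally show "(\<Sum>j=1..X. f (p ^ j))
      \<le> 4 * (neg_sigma \<kappa> (p + 1) * real (p + 1) powr (-1 - \<delta>)) + 12 * real p powr (-1 - \<delta>)"
      using f1 by simp
  qed
  also have "\<dots> = 4 * (\<Sum>p\<in>P. neg_sigma \<kappa> (p + 1) * real (p + 1) powr (-1 - \<delta>)) + 12 * (\<Sum>p\<in>P. real p powr (-1 - \<delta>))"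
    by (simp add: sum.distrib sum_distrib_left)
  also have "(\<Sum>p\<in>P. neg_sigma \<kappa> (p + 1) * real (p + 1) powr (-1 - \<delta>))
      = (\<Sum>k\<in>Suc ` P. neg_sigma \<kappa> k * real k powr (-1 - \<delta>))"
    by (subst sum.reindex) auto
  also have "\<dots> \<le> (\<Sum>k=1..X + 1. neg_sigma \<kappa> k * real k powr (-1 - \<delta>))"
    by (rule sum_mono2) (use finP in \<open>auto simp: neg_sigma_nonneg\<close>)
  also have "\<dots> \<le> (1 + 1 / \<kappa>) * (1 + 1 / \<delta>)" using sum_neg_sigma_le \<kappa> \<delta>(1) .
  also have "(\<Sum>p\<in>P. real p powr (-1 - \<delta>)) \<le> (\<Sum>p=1..X. real p powr (-1 - \<delta>))"
    by (rule sum_mono2) (use finP in auto)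
  also have "\<dots> \<le> 1 + 1 / \<delta>" using zeta_le \<delta>(1) .
  also have "4 * ((1 + 1 / \<kappa>) * (1 + 1 / \<delta>)) + 12 * (1 + 1 / \<delta>) = (16 + 4 / \<kappa>) * (1 + 1 / \<delta>)"
    using \<kappa> \<delta> by (simp add: field_simps)
  finally show ?thesis by (simp add: mult_left_mono)
qed

section \<open>Counting nondegenerate solutions\<close>

lemma card_pairwise_cong_le:
  fixes A :: "nat set"
  assumes "A \<subseteq> {1..Q}" "M > 0" "\<And>s t. s \<in> A \<Longrightarrow> t \<in> A \<Longrightarrow> [s = t] (mod M)"
  shows "real (card A) \<le> real Q / real M + 1"
proof -
  have "inj_on (\<lambda>t. t div M) A"
  proof (rule inj_onI)
    fix s t assume st: "s \<in> A" "t \<in> A" "s div M = t div M"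
    then have "s mod M = t mod M" using assms(3)[of s t] by (simp add: cong_def)
    with st show "s = t" by (metis div_mult_mod_eq)
  qed
  then have "card A = card ((\<lambda>t. t div M) ` A)" by (simp add: card_image)
  also have "\<dots> \<le> card {0..Q div M}"
  proof (intro card_mono image_subsetI)
    fix t assume "t \<in> A"
    then have "t \<le> Q" using assms(1) by auto
    then show "t div M \<in> {0..Q div M}" by (simp add: div_le_mono)
  qed simp
  finally have "card A \<le> Q div M + 1" by simp
  then have "real (card A) \<le> real (Q div M) + 1" by linarith
  also have "real (Q div M) \<le> real Q / real M" by (rule of_nat_div_le_of_nat)
  finally show ?thesis by simp
qed

text \<open>A prime and its cofactor on one side of the equation, with the prime p of the other side
  hidden in the existential. The parameters (k, r, s) = (1, 0, h) describe n + h = b q, where b q =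
  h modulo p; (m, h, 0) describe n = a p, with the roles of the two primes exchanged. The final
  disjunction lists the two situations in which the +1 of a class count can be absorbed.\<close>

definition linked_pairs :: "nat \<Rightarrow> nat \<Rightarrow> nat \<Rightarrow> nat \<Rightarrow> real \<Rightarrow> real \<Rightarrow> (nat \<times> nat) set" where
  "linked_pairs X k r s y W = {(b, q). b \<ge> 1 \<and> q \<ge> 1 \<and> b * q \<le> X \<and>
     (\<exists>p d D. real p > y \<and> coprime b p \<and> d * D = p + 1 \<and> d dvd q + 1 \<and> D dvd k * sigma b \<and>
        [b * q + r = s] (mod p) \<and> (real d \<le> W \<and> p < q \<or> p * d \<le> q))}"

text \<open>For given b, d and D the prime p = d D - 1 is known, and q lies in a single class modulo
  p (as b is invertible there) and modulo d, hence modulo p d. It remains to sum X / (b p d) + 1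
  over all b, d and D.\<close>

lemma card_linked_pairs_le:
  assumes y: "y \<ge> 1" and \<kappa>: "0 < \<kappa>" "\<kappa> < 1" and W: "W \<ge> 0" and k: "k \<ge> 1"
  shows "real (card (linked_pairs X k r s y W)) \<le>
    real X * y powr (\<kappa> - 1) * (4 * (1 + ln (real X + 1)) + W) * neg_sigma \<kappa> k
      * (\<Sum>b=1..X. neg_sigma \<kappa> (sigma b) / real b)"
proof -
  define Qs where "Qs = (\<lambda>b D d. {q \<in> {1..X div b}. \<exists>p. real p > y \<and> coprime b p \<and> d * D = p + 1 \<and> d dvd q + 1 \<and>
        [b * q + r = s] (mod p) \<and> (real d \<le> W \<and> p < q \<or> p * d \<le> q)})"
  \<comment> \<open>2 / d for the main term of the class count, and 2 / d or 1 for its +1, according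
    as p d <= q or d <= W.\<close>
  define c where "c = (\<lambda>d::nat. 4 / real d + (if real d \<le> W then 1 else 0))"
  have cnn: "c d \<ge> 0" for d by (simp add: c_def)
  have cardQ: "real (card (Qs b D d)) \<le> real X / real b / max (real D) y * c d"
    if b: "b \<ge> 1" and d: "d \<ge> 1" for b D d
  proof (cases "Qs b D d = {}")
    case False
    then obtain p where p: "real p > y" "coprime b p" "d * D = p + 1" by (auto simp: Qs_def)
    define mx where "mx = max (real D) y"
    have mx: "mx > 0" "mx \<ge> y" "mx \<ge> real D" using y by (auto simp: mx_def)
    have p1: "p \<ge> 2" using p y by linarith
    have cdp: "coprime p d"
    proof (rule coprimeI)
      fix c assume "c dvd p" "c dvd d"
      then have "c dvd p + 1" using p(3) by (metis dvd_mult2)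
      with \<open>c dvd p\<close> show "is_unit c" by (metis coprime_common_divisor coprime_add_one_right)
    qed
    have Qalt: "Qs b D d = {q \<in> {1..X div b}. d dvd q + 1 \<and> [b * q + r = s] (mod p) \<and> (real d \<le> W \<and> p < q \<or> p * d \<le> q)}"
      unfolding Qs_def using p by auto
    have "real (card (Qs b D d)) \<le> real (X div b) / real (p * d) + 1"
    proof (rule card_pairwise_cong_le)
      fix q q' assume q: "q \<in> Qs b D d" "q' \<in> Qs b D d"
      have "[b * q + r = b * q' + r] (mod p)" using q unfolding Qalt by (auto intro: cong_trans cong_sym)
      then have "[b * q = b * q'] (mod p)" by (simp add: cong_add_rcancel_nat)
      then have 1: "[q = q'] (mod p)" using p(2) by (simp add: cong_mult_lcancel_nat)
      have "d dvd q + 1" "d dvd q' + 1" using q unfolding Qalt by auto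
      then have "[q + 1 = q' + 1] (mod d)" by (simp add: cong_def mod_eq_0_iff_dvd)
      then have "[q = q'] (mod d)" by (simp only: cong_add_rcancel_nat)
      with 1 cdp show "[q = q'] (mod (p * d))" by (simp add: coprime_cong_mult_nat)
    qed (use p1 d in \<open>auto simp: Qs_def\<close>)
    also have "real (X div b) \<le> real X / real b" by (rule of_nat_div_le_of_nat)
    finally have cnt: "real (card (Qs b D d)) \<le> real X / real b / real (p * d) + 1"
      by (simp add: divide_right_mono)
    \<comment> \<open>p is at least half of D, since D <= d D = p + 1 <= 2 p, and p > y; so p can be
      replaced by the maximum of D and y.\<close>
    have half: "mx * real d \<le> 2 * real (p * d)"
    proof (cases "real D \<ge> y")
      case True
      have "real D \<le> real (d * D)" using mult_right_mono[of 1 "real d" "real D"] d by simp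
      also have "\<dots> \<le> 2 * real p" using p p1 by simp
      finally have "real D * real d \<le> 2 * real p * real d" by (intro mult_right_mono) auto
      then show ?thesis using True by (simp add: mx_def)
    next
      case False
      then have "mx \<le> 2 * real p" using p y by (simp add: mx_def)
      then have "mx * real d \<le> 2 * real p * real d" by (intro mult_right_mono) auto
      then show ?thesis by simp
    qed
    have Xb: "real X / real b \<ge> 0" by simp
    have inv: "1 / real (p * d) \<le> 2 / (mx * real d)"
      using half mx d p1 by (simp add: field_simps)
    then have main: "real X / real b / real (p * d) \<le> real X / real b / mx * (2 / real d)"
      using mult_left_mono[OF inv Xb] by (simp add: field_simps)
    obtain q where q: "q \<in> Qs b D d" using False by auto
    then have "q \<le> X div b" by (simp add: Qs_def)
    then have "b * q \<le> b * (X div b)" by (rule mult_le_mono2)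
    also have "\<dots> \<le> X" by (rule times_div_less_eq_dividend)
    finally have "real (b * q) \<le> real X" by (rule of_nat_mono)
    then have bq: "real b * real q \<le> real X" by (simp only: of_nat_mult)
    let ?R = "real X / real b / mx * (2 / real d + (if real d \<le> W then 1 else 0))"
    have one: "1 \<le> ?R"
    proof (cases "real d \<le> W \<and> p < q")
      case True
      have "D \<le> d * D" using d by simp
      then have "D \<le> q" "y \<le> real q" using p True by linarith+
      then have "mx \<le> real q" by (simp add: mx_def)
      then have "mx * real b \<le> real q * real b" by (intro mult_right_mono) auto
      then have "mx * real b \<le> real X" using bq mult.commute[of "real b" "real q"] by linarith
      then have "1 \<le> real X / real b / mx"
        using b mx by (simp add: field_simps)
      moreover have "real X / real b / mx * 1 \<le> ?R"
        using True mx by (intro mult_left_mono) auto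
      ultimately show ?thesis by linarith
    next
      case False
      then have "p * d \<le> q" using q unfolding Qalt by auto
      then have "real b * real (p * d) \<le> real b * real q"
        by (intro mult_left_mono of_nat_mono) auto
      then have "real b * real (p * d) \<le> real X" using bq by linarith
      then have "1 \<le> real X / real b / real (p * d)"
        using b p1 d by (simp add: field_simps)
      also have "\<dots> \<le> real X / real b / mx * (2 / real d)" by (rule main)
      also have "\<dots> \<le> ?R"
        using mx by (intro mult_left_mono) auto
      finally show ?thesis .
    qed
    have "real (card (Qs b D d)) \<le> real X / real b / mx * (2 / real d)
       + ?R"
      using cnt main one by linarith
    also have "\<dots> = real X / real b / mx * c d" by (subst distrib_left[symmetric]) (simp add: c_def)
    finally show ?thesis by (simp add: mx_def)
  next
    case True
    then show ?thesis using y W by (simp add: c_def)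
  qed
  \<comment> \<open>The inverse maximum is shared out: the power 1 - \<kappa> goes to y as the
    saving, the power \<kappa> to D to make the sum over divisors converge on average.\<close>
  have maxle: "1 / max (real D) y \<le> y powr (\<kappa> - 1) * real D powr - \<kappa>" if D: "D \<ge> 1" for D :: nat
  proof -
    define mx where "mx = max (real D) y"
    have mx: "mx > 0" "mx \<ge> y" "mx \<ge> real D" using y by (auto simp: mx_def)
    have "1 / mx = mx powr (\<kappa> - 1) * mx powr (- \<kappa>)"
      using mx powr_add[of mx "\<kappa> - 1" "-\<kappa>"] powr_minus_divide[of mx 1] by simp
    also have "\<dots> \<le> y powr (\<kappa> - 1) * real D powr - \<kappa>"
      using mx y D \<kappa> by (intro mult_mono powr_mono2') auto
    finally show ?thesis by (simp add: mx_def)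
  qed
  let ?w = "\<lambda>b D d. real X * y powr (\<kappa> - 1) * (1 / real b * real D powr - \<kappa> * c d)"
  let ?I = "SIGMA b:{1..X}. SIGMA D:{D. D dvd k * sigma b}. {1..X+1}"
  have finD: "finite {D. D dvd k * sigma b}" if "b \<in> {1..X}" for b
    using that k sigma_pos[of b] by (intro finite_divisors_nat) auto
  have finI: "finite ?I" using finD by (intro finite_SigmaI) auto
  have sub: "linked_pairs X k r s y W \<subseteq> (\<Union>(b, D, d)\<in>?I. Pair b ` Qs b D d)"
  proof clarify
    fix b q assume "(b, q) \<in> linked_pairs X k r s y W"
    then obtain p d D where H: "b \<ge> 1" "q \<ge> 1" "b * q \<le> X" "real p > y" "coprime b p"
      "d * D = p + 1" "d dvd q + 1" "D dvd k * sigma b" "[b * q + r = s] (mod p)"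
      "real d \<le> W \<and> p < q \<or> p * d \<le> q"
      unfolding linked_pairs_def by auto
    have "b \<le> b * q" "q \<le> b * q" using H by auto
    then have bX: "b \<le> X" "q \<le> X" using H(3) by linarith+
    have "d \<le> q + 1" using H(7) by (intro dvd_imp_le) auto
    then have dX: "d \<le> X + 1" using bX by linarith
    have "d \<noteq> 0" using H(6) by (intro notI) simp
    then have d1: "d \<ge> 1" by simp
    have "q \<le> X div b" using H by (simp add: less_eq_div_iff_mult_less_eq mult.commute)
    then have "q \<in> Qs b D d" unfolding Qs_def using H by auto
    moreover have "(b, D, d) \<in> ?I" using H bX dX d1 by auto
    ultimately show "(b, q) \<in> (\<Union>(b, D, d)\<in>?I. Pair b ` Qs b D d)" by force
  qed
  have finQ: "finite (Qs b D d)" for b D d unfolding Qs_def by simp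
  have "card (linked_pairs X k r s y W) \<le> card (\<Union>(b, D, d)\<in>?I. Pair b ` Qs b D d)"
    by (rule card_mono[OF _ sub]) (use finI finQ in auto)
  also have "\<dots> \<le> (\<Sum>x\<in>?I. card (case x of (b, D, d) \<Rightarrow> Pair b ` Qs b D d))"
    by (rule card_UN_le[OF finI])
  also have "\<dots> = (\<Sum>(b, D, d)\<in>?I. card (Qs b D d))"
    by (intro sum.cong) (auto simp: card_image inj_on_def)
  finally have "real (card (linked_pairs X k r s y W)) \<le> real (\<Sum>(b, D, d)\<in>?I. card (Qs b D d))"
    by (rule of_nat_mono)
  also have "\<dots> = (\<Sum>(b, D, d)\<in>?I. real (card (Qs b D d)))"
    by (simp add: case_prod_unfold)
  also have "\<dots> \<le> (\<Sum>(b, D, d)\<in>?I. ?w b D d)"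
  proof (rule sum_mono, clarify)
    fix b D d assume I: "b \<in> {1..X}" "D dvd k * sigma b" "d \<in> {1..X+1}"
    have "D \<noteq> 0" using I(2) k sigma_pos[of b] I(1) by (intro notI) auto
    then have D1: "D \<ge> 1" by simp
    have c0: "c d \<ge> 0" by (simp add: c_def)
    have "real (card (Qs b D d)) \<le> real X / real b * c d * (1 / max (real D) y)"
      using cardQ[of b d D] I by simp
    also have "\<dots> \<le> real X / real b * c d * (y powr (\<kappa> - 1) * real D powr - \<kappa>)"
      using c0 by (intro mult_left_mono maxle D1) auto
    finally show "real (card (Qs b D d)) \<le> ?w b D d"
      by (simp add: mult_ac)
  qed
  also have "\<dots> = real X * y powr (\<kappa> - 1) * (\<Sum>b=1..X. 1 / real b * (neg_sigma \<kappa> (k * sigma b) * (\<Sum>d=1..X+1. c d)))"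
  proof -
    have "(\<Sum>(b, D, d)\<in>?I. ?w b D d)
      = (\<Sum>b=1..X. \<Sum>(D, d)\<in>(SIGMA D:{D. D dvd k * sigma b}. {1..X+1}). ?w b D d)"
      by (rule sum.Sigma[symmetric]) (use finD in auto)
    also have "\<dots> = (\<Sum>b=1..X. \<Sum>D | D dvd k * sigma b. \<Sum>d=1..X+1. ?w b D d)"
      by (intro sum.cong refl sum.Sigma[symmetric]) (use finD in auto)
    also have "\<dots> = real X * y powr (\<kappa> - 1) * (\<Sum>b=1..X. 1 / real b * (neg_sigma \<kappa> (k * sigma b) * (\<Sum>d=1..X+1. c d)))"
      unfolding neg_sigma_def sum_product unfolding sum_distrib_left by (simp only: mult.assoc)
    finally show ?thesis .
  qed
  also have "\<dots> \<le> real X * y powr (\<kappa> - 1) * (\<Sum>b=1..X. 1 / real b * ((neg_sigma \<kappa> k * neg_sigma \<kappa> (sigma b)) * (4 * (1 + ln (real X + 1)) + W)))"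
  proof (intro mult_left_mono sum_mono mult_mono)
    fix b assume b: "b \<in> {1..X}"
    show "neg_sigma \<kappa> (k * sigma b) \<le> neg_sigma \<kappa> k * neg_sigma \<kappa> (sigma b)"
      using k b sigma_pos[of b] by (intro neg_sigma_mult_le) auto
    have "(\<Sum>d=1..X+1. c d) = 4 * (\<Sum>d=1..X+1. 1 / real d) + (\<Sum>d=1..X+1. if real d \<le> W then 1 else 0)"
      by (simp add: c_def sum.distrib sum_distrib_left)
    also have "(\<Sum>d=1..X+1. if real d \<le> W then 1 else 0) = real (card {d \<in> {1..X+1}. real d \<le> W})"
      by (subst sum.inter_filter[symmetric]) (simp_all del: atLeastAtMost_iff)
    also have "card {d \<in> {1..X+1}. real d \<le> W} \<le> card {1..nat \<lfloor>W\<rfloor>}"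
      by (intro card_mono) (auto simp: le_nat_floor)
    also have "real (card {1..nat \<lfloor>W\<rfloor>}) \<le> W" using W by simp
    also have "(\<Sum>d=1..X+1. 1 / real d) \<le> 1 + ln (real (X + 1))" by (rule harmonic_le) simp
    finally show "(\<Sum>d=1..X+1. c d) \<le> 4 * (1 + ln (real X + 1)) + W" by (simp add: add.commute)
  qed (auto simp: cnn neg_sigma_nonneg simp del: sum.cl_ivl_Suc intro!: sum_nonneg mult_nonneg_nonneg)
  also have "\<dots> = real X * y powr (\<kappa> - 1) * (4 * (1 + ln (real X + 1)) + W) * neg_sigma \<kappa> k
      * (\<Sum>b=1..X. neg_sigma \<kappa> (sigma b) / real b)"
    unfolding sum_distrib_left by (intro sum.cong refl) (simp add: mult_ac)
  finally show ?thesis .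
qed

text \<open>p + 1 = d j gives 1 / p <= 2 / (d j), and j runs through a harmonic sum; p is any
  integer here.\<close>

lemma sum_inverse_progression_le:
  assumes d: "d \<ge> 1"
  shows "(\<Sum>p | p \<in> {1..X} \<and> d dvd p + 1. 1 / real p) \<le> 2 / real d * (1 + ln (real X + 1))"
proof -
  let ?A = "{p. p \<in> {1..X} \<and> d dvd p + 1}"
  let ?g = "\<lambda>p. (p + 1) div d"
  have inj: "inj_on ?g ?A"
  proof (rule inj_onI)
    fix p q assume "p \<in> ?A" "q \<in> ?A" "?g p = ?g q"
    then show "p = q" by (metis (no_types, lifting) add_right_imp_eq dvd_div_mult_self mem_Collect_eq)
  qed
  have img: "?g ` ?A \<subseteq> {1..X+1}"
  proof
    fix j assume "j \<in> ?g ` ?A"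
    then obtain p where p: "p \<in> {1..X}" "d dvd p + 1" "j = ?g p" by auto
    then obtain e where e: "p + 1 = d * e" by auto
    then have "j = e" using p d by simp
    moreover have "e \<noteq> 0" using e by (intro notI) simp
    moreover have "e \<le> p + 1" unfolding e using d by simp
    moreover have "p + 1 \<le> X + 1" using p by simp
    ultimately have "1 \<le> j" "j \<le> X + 1" by linarith+
    then show "j \<in> {1..X+1}" by (simp only: atLeastAtMost_iff)
  qed
  have "(\<Sum>p\<in>?A. 1 / real p) \<le> (\<Sum>p\<in>?A. 2 / real d * (1 / real (?g p)))"
  proof (rule sum_mono)
    fix p assume p: "p \<in> ?A"
    then obtain e where e: "p + 1 = d * e" by auto
    have ge: "?g p = e" using e d by simp
    have "e \<noteq> 0" using e by (intro notI) simp
    have "real d * real e = real p + 1" using e by (metis of_nat_1 of_nat_add of_nat_mult)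
    also have "\<dots> \<le> 2 * real p" using p by simp
    finally show "1 / real p \<le> 2 / real d * (1 / real (?g p))"
      unfolding ge using p d \<open>e \<noteq> 0\<close> by (simp add: field_simps)
  qed
  also have "\<dots> = 2 / real d * (\<Sum>p\<in>?A. 1 / real (?g p))" by (simp only: sum_distrib_left)
  also have "(\<Sum>p\<in>?A. 1 / real (?g p)) = (\<Sum>j\<in>?g ` ?A. 1 / real j)"
    using inj by (simp only: sum.reindex o_def)
  also have "\<dots> \<le> (\<Sum>j=1..X+1. 1 / real j)" by (rule sum_mono2) (use img in auto)
  also have "\<dots> \<le> 1 + ln (real (X + 1))" by (rule harmonic_le) simp
  also have "real (X + 1) = real X + 1" by simp
  finally show ?thesis by (simp add: mult_left_mono divide_right_mono)
qed

text \<open>p dividing n and q dividing n + h fix n modulo p q; as p q <= Z, the +1 of the class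
  count is at most Z / (p q). For given d the sums over p and q give (log X)^2 / d^2. One of the two
  factors 1 / d is bounded by 1 / W and the other summed, hence the cube of the logarithm.\<close>

lemma card_common_factor_pairs_le:
  assumes W: "W > 0" and Z: "Z \<ge> 0" and X: "X = N + h"
  shows "real (card {n \<in> {1..N}. \<exists>p q d. prime p \<and> prime q \<and> p \<noteq> q \<and> real d > W \<and> d dvd p + 1 \<and> d dvd q + 1 \<and>
      p dvd n \<and> q dvd n + h \<and> real (p * q) \<le> Z})
    \<le> 4 * (real X + Z) * (1 + ln (real X + 1)) ^ 3 / W"
proof -
  let ?L = "1 + ln (real X + 1)"
  let ?P = "\<lambda>d. {p. p \<in> {1..X} \<and> d dvd p + 1}"
  let ?H = "\<lambda>d. (\<Sum>p\<in>?P d. 1 / real p) * (\<Sum>q\<in>?P d. 1 / real q)"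
  define D where "D = {d \<in> {1..X+1}. real d > W}"
  define T where "T = (\<lambda>p q. {n \<in> {1..N}. prime p \<and> prime q \<and> p \<noteq> q \<and> p dvd n \<and> q dvd n + h \<and> real (p * q) \<le> Z})"
  let ?I = "SIGMA d:D. ?P d \<times> ?P d"
  let ?S = "{n \<in> {1..N}. \<exists>p q d. prime p \<and> prime q \<and> p \<noteq> q \<and> real d > W \<and> d dvd p + 1 \<and> d dvd q + 1 \<and>
      p dvd n \<and> q dvd n + h \<and> real (p * q) \<le> Z}"
  have square: "(2 / x * l) * (2 / x * l) = 4 * l\<^sup>2 * (1 / x * (1 / x))" for x l :: real
    by (simp add: power2_eq_square)
  have regroup: "x * (4 * l\<^sup>2 * (1 / w * (1 / u))) = (4 * x * l\<^sup>2 / w) * (1 / u)" for x l w u :: real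
    by simp
  have finI: "finite ?I" unfolding D_def by (intro finite_SigmaI) auto
  have cardT: "real (card (T p q)) \<le> (real X + Z) * (1 / real p * (1 / real q))"
    if "p \<ge> 1" "q \<ge> 1" for p q
  proof (cases "T p q = {}")
    case True
    then show ?thesis using Z by simp
  next
    case False
    then have pq: "prime p" "prime q" "p \<noteq> q" "real (p * q) \<le> Z" by (auto simp: T_def)
    then have cop: "coprime p q" by (intro primes_coprime)
    have "real (card (T p q)) \<le> real N / real (p * q) + 1"
    proof (rule card_pairwise_cong_le)
      fix s t assume st: "s \<in> T p q" "t \<in> T p q"
      then have "[s = t] (mod p)" by (auto simp: T_def cong_def mod_eq_0_iff_dvd)
      moreover have "q dvd s + h" "q dvd t + h" using st by (auto simp: T_def)
      then have "[s + h = t + h] (mod q)" by (simp add: cong_def mod_eq_0_iff_dvd)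
      then have "[s = t] (mod q)" by (simp only: cong_add_rcancel_nat)
      ultimately show "[s = t] (mod p * q)" using cop by (intro coprime_cong_mult_nat)
    qed (use that in \<open>auto simp: T_def\<close>)
    also have "\<dots> \<le> (real X + Z) / real (p * q)"
    proof -
      have "real N + real (p * q) \<le> real X + Z" using pq X by simp
      then have "(real N + real (p * q)) / real (p * q) \<le> (real X + Z) / real (p * q)"
        by (intro divide_right_mono) auto
      then show ?thesis using that by (simp add: add_divide_distrib)
    qed
    finally show ?thesis by simp
  qed
  have sub: "?S \<subseteq> (\<Union>(d, p, q)\<in>?I. T p q)"
  proof
    fix n assume "n \<in> ?S"
    then obtain p q d where H: "n \<in> {1..N}" "prime p" "prime q" "p \<noteq> q" "real d > W" "d dvd p + 1" "d dvd q + 1"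
      "p dvd n" "q dvd n + h" "real (p * q) \<le> Z" by blast
    have "p \<le> n" "q \<le> n + h" using H by (auto intro!: dvd_imp_le)
    then have "p \<le> X" "q \<le> X" using H X by auto
    moreover have "p \<ge> 1" "q \<ge> 1" using H prime_gt_0_nat[of p] prime_gt_0_nat[of q] by auto
    moreover have "d \<le> p + 1" using H by (intro dvd_imp_le) auto
    moreover have "d \<ge> 1" using H W by (cases d) auto
    ultimately have "(d, p, q) \<in> ?I" using H by (auto simp: D_def)
    moreover have "n \<in> T p q" using H by (auto simp: T_def)
    ultimately show "n \<in> (\<Union>(d, p, q)\<in>?I. T p q)" by blast
  qed
  have finT: "finite (T p q)" for p q unfolding T_def by simp
  have "card ?S \<le> card (\<Union>(d, p, q)\<in>?I. T p q)"
    by (rule card_mono[OF _ sub]) (use finI finT in auto)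
  also have "\<dots> \<le> (\<Sum>x\<in>?I. card (case x of (d, p, q) \<Rightarrow> T p q))" by (rule card_UN_le[OF finI])
  finally have "real (card ?S) \<le> real (\<Sum>x\<in>?I. card (case x of (d, p, q) \<Rightarrow> T p q))" by (rule of_nat_mono)
  also have "\<dots> = (\<Sum>(d, p, q)\<in>?I. real (card (T p q)))" by (simp add: case_prod_unfold)
  also have "\<dots> \<le> (\<Sum>(d, p, q)\<in>?I. (real X + Z) * (1 / real p * (1 / real q)))"
    by (intro sum_mono) (auto intro!: cardT simp del: of_nat_mult mult_1 times_divide_eq_left times_divide_eq_right)
  also have "\<dots> = (\<Sum>d\<in>D. (real X + Z) * (?H d))"
  proof -
    have "(\<Sum>(d, p, q)\<in>?I. (real X + Z) * (1 / real p * (1 / real q)))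
      = (\<Sum>d\<in>D. \<Sum>(p, q)\<in>?P d \<times> ?P d. (real X + Z) * (1 / real p * (1 / real q)))"
      by (rule sum.Sigma[symmetric]) (auto simp: D_def)
    also have "\<dots> = (\<Sum>d\<in>D. \<Sum>p\<in>?P d. \<Sum>q\<in>?P d. (real X + Z) * (1 / real p * (1 / real q)))"
      by (simp only: sum.cartesian_product)
    also have "\<dots> = (\<Sum>d\<in>D. (real X + Z) * (?H d))"
      unfolding sum_product by (simp only: sum_distrib_left)
    finally show ?thesis .
  qed
  also have "\<dots> \<le> (\<Sum>d\<in>D. (4 * (real X + Z) * ?L\<^sup>2 / W) * (1 / real d))"
  proof (rule sum_mono)
    fix d assume d: "d \<in> D"
    then have d1: "d \<ge> 1" "real d > W" by (auto simp: D_def)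
    have "?H d \<le> (2 / real d * ?L) * (2 / real d * ?L)"
      using sum_inverse_progression_le[OF d1(1), of X] by (intro mult_mono) (auto intro!: sum_nonneg)
    also have "\<dots> = 4 * ?L\<^sup>2 * (1 / real d * (1 / real d))"
      by (rule square)
    also have "\<dots> \<le> 4 * ?L\<^sup>2 * (1 / W * (1 / real d))"
      using d1 W by (intro mult_left_mono mult_right_mono frac_le) auto
    finally have "(real X + Z) * (?H d)
        \<le> (real X + Z) * (4 * ?L\<^sup>2 * (1 / W * (1 / real d)))"
      using Z by (intro mult_left_mono) auto
    also have "(real X + Z) * (4 * ?L\<^sup>2 * (1 / W * (1 / real d))) = (4 * (real X + Z) * ?L\<^sup>2 / W) * (1 / real d)"
      by (rule regroup)
    finally show "(real X + Z) * (?H d)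
      \<le> (4 * (real X + Z) * ?L\<^sup>2 / W) * (1 / real d)" .
  qed
  also have "\<dots> = (4 * (real X + Z) * ?L\<^sup>2 / W) * (\<Sum>d\<in>D. 1 / real d)" by (simp only: sum_distrib_left)
  also have "\<dots> \<le> (4 * (real X + Z) * ?L\<^sup>2 / W) * ?L"
  proof (rule mult_left_mono)
    have "(\<Sum>d\<in>D. 1 / real d) \<le> (\<Sum>d=1..X+1. 1 / real d)" by (rule sum_mono2) (auto simp: D_def)
    also have "\<dots> \<le> 1 + ln (real (X + 1))" by (rule harmonic_le) simp
    finally show "(\<Sum>d\<in>D. 1 / real d) \<le> ?L" by (simp add: add.commute)
  qed (use W Z in auto)
  also have "\<dots> = 4 * (real X + Z) * ?L ^ 3 / W"
    by (simp add: power2_eq_square power3_eq_cube)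
  finally show ?thesis .
qed

text \<open>A triple (a, b, m) determines (p, q) by a nonsingular linear system, so it accounts for
  at most one n. Few triples occur, since (a b) (p q) = n (n + h) <= X^2 forces a b <= X^2 /
  Z.\<close>

lemma card_small_cofactors_le:
  assumes h: "h \<ge> 1" and Z: "Z > 0" and X: "X = N + h"
  shows "real (card {n \<in> {1..N}. \<exists>a b p q m. n = a * p \<and> n + h = b * q \<and> m \<in> {1..K} \<and>
      (q + 1) * sigma b = m * ((p + 1) * sigma a) \<and> a \<noteq> b + h \<and> real (p * q) > Z})
    \<le> real K * (real X ^ 2 / Z * (1 + ln (real X + 1)))"
proof -
  define T where "T = (\<lambda>a b m. {n \<in> {1..N}. \<exists>p q. n = a * p \<and> n + h = b * q \<and>
      (q + 1) * sigma b = m * ((p + 1) * sigma a) \<and> a \<noteq> b + h})"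
  define R where "R = (\<lambda>a. {b \<in> {1..X}. real a * real b \<le> real X ^ 2 / Z})"
  let ?I = "SIGMA a:{1..X}. R a \<times> {1..K}"
  let ?S = "{n \<in> {1..N}. \<exists>a b p q m. n = a * p \<and> n + h = b * q \<and> m \<in> {1..K} \<and>
      (q + 1) * sigma b = m * ((p + 1) * sigma a) \<and> a \<noteq> b + h \<and> real (p * q) > Z}"
  have finI: "finite ?I" unfolding R_def by (intro finite_SigmaI) auto
  have cardT: "card (T a b m) \<le> 1" if "b \<ge> 1" for a b m
  proof -
    have "s = t" if st: "s \<in> T a b m" "t \<in> T a b m" for s t
    proof (rule ccontr)
      assume ne: "s \<noteq> t"
      obtain p q where s: "s = a * p" "s + h = b * q" "(q + 1) * sigma b = m * ((p + 1) * sigma a)" "a \<noteq> b + h"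
        using st by (auto simp: T_def)
      obtain p' q' where t: "t = a * p'" "t + h = b * q'" "(q' + 1) * sigma b = m * ((p' + 1) * sigma a)"
        using st by (auto simp: T_def)
      have key: "sigma b * (a * p + h + b) = m * b * sigma a * (p + 1)"
        if "a * p + h = b * q" "(q + 1) * sigma b = m * ((p + 1) * sigma a)" for p q
      proof -
        have "sigma b * (a * p + h + b) = b * ((q + 1) * sigma b)" using that(1) by (simp add: algebra_simps)
        also have "\<dots> = m * b * sigma a * (p + 1)" unfolding that(2) by (simp add: algebra_simps)
        finally show ?thesis .
      qed
      \<comment> \<open>Eliminating q leaves p \<Delta> = \<Gamma>. As \<Delta> + \<Gamma> =
        \<sigma>(b) (a - b - h), both can vanish only if a = b + h.\<close>
      define \<Delta> where "\<Delta> = int (sigma b) * int a - int m * int b * int (sigma a)"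
      define \<Gamma> where "\<Gamma> = int m * int b * int (sigma a) - int (sigma b) * (int h + int b)"
      have lin: "int p * \<Delta> = \<Gamma>" if "a * p + h = b * q" "(q + 1) * sigma b = m * ((p + 1) * sigma a)" for p q
      proof -
        have "int (sigma b * (a * p + h + b)) = int (m * b * sigma a * (p + 1))"
          using key[OF that] by simp
        then show ?thesis unfolding \<Delta>_def \<Gamma>_def by (simp add: algebra_simps)
      qed
      have "int p * \<Delta> = \<Gamma>" "int p' * \<Delta> = \<Gamma>" using lin[of p q] lin[of p' q'] s t by simp_all
      then have "(int p - int p') * \<Delta> = 0" by (simp add: algebra_simps)
      moreover have "p \<noteq> p'" using ne s t by auto
      ultimately have "\<Delta> = 0" by simp
      with \<open>int p * \<Delta> = \<Gamma>\<close> have "\<Gamma> = 0" by simp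
      with \<open>\<Delta> = 0\<close> have "int (sigma b) * int a = int (sigma b) * (int h + int b)"
        unfolding \<Delta>_def \<Gamma>_def by simp
      then have "int a = int h + int b" using sigma_pos[of b] \<open>b \<ge> 1\<close> by simp
      with s(4) show False by simp
    qed
    moreover have "finite (T a b m)" unfolding T_def by simp
    ultimately show ?thesis by (auto simp: card_le_Suc0_iff_eq)
  qed
  have sub: "?S \<subseteq> (\<Union>(a, b, m)\<in>?I. T a b m)"
  proof
    fix n assume "n \<in> ?S"
    then obtain a b p q m where H: "n \<in> {1..N}" "n = a * p" "n + h = b * q" "m \<in> {1..K}"
      "(q + 1) * sigma b = m * ((p + 1) * sigma a)" "a \<noteq> b + h" "real (p * q) > Z" by blast
    have pos: "a > 0" "p > 0" "b > 0" "q > 0"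
      using H h by (auto intro!: Nat.gr0I)
    have "a \<le> n" unfolding H(2) using pos by simp
    moreover have "b \<le> n + h" unfolding H(3) using pos by simp
    moreover have "n \<le> N" using H(1) by simp
    ultimately have "1 \<le> a" "a \<le> X" "1 \<le> b" "b \<le> X" using X pos by linarith+
    then have ab: "a \<in> {1..X}" "b \<in> {1..X}" by simp_all
    have nX: "real n \<le> real X" "real (n + h) \<le> real X" using H(1) X by auto
    have "real a * real b * Z \<le> real a * real b * real (p * q)"
      using H by (intro mult_left_mono) auto
    also have "\<dots> = real n * real (n + h)" unfolding H(3) by (simp add: H(2))
    also have "\<dots> \<le> real X * real X" using nX by (intro mult_mono) auto
    finally have "real a * real b \<le> real X ^ 2 / Z" using Z by (simp add: pos_le_divide_eq power2_eq_square)
    then have "(a, b, m) \<in> ?I" using ab H by (auto simp: R_def)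
    moreover have "n \<in> T a b m" using H unfolding T_def by blast
    ultimately show "n \<in> (\<Union>(a, b, m)\<in>?I. T a b m)" by blast
  qed
  have finT: "finite (T a b m)" for a b m unfolding T_def by simp
  have "card ?S \<le> card (\<Union>(a, b, m)\<in>?I. T a b m)"
    by (rule card_mono[OF _ sub]) (use finI finT in auto)
  also have "\<dots> \<le> (\<Sum>x\<in>?I. card (case x of (a, b, m) \<Rightarrow> T a b m))" by (rule card_UN_le[OF finI])
  also have "\<dots> \<le> (\<Sum>x\<in>?I. 1)" by (intro sum_mono) (use cardT in \<open>auto simp: R_def\<close>)
  also have "\<dots> = (\<Sum>a=1..X. card (R a) * K)"
    using finI by (simp add: R_def card_SigmaI card_cartesian_product)
  finally have "real (card ?S) \<le> real (\<Sum>a=1..X. card (R a) * K)" by (rule of_nat_mono)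
  also have "\<dots> = (\<Sum>a=1..X. real (card (R a)) * real K)" by simp
  also have "\<dots> \<le> (\<Sum>a=1..X. (real X ^ 2 / Z * (1 / real a)) * real K)"
  proof (intro sum_mono mult_right_mono)
    fix a assume a: "a \<in> {1..X}"
    define c where "c = (real X ^ 2 / Z) / real a"
    have c0: "c \<ge> 0" using Z by (simp add: c_def)
    have "R a \<subseteq> {1..nat \<lfloor>c\<rfloor>}"
    proof
      fix b assume b: "b \<in> R a"
      then have "real b * real a \<le> real X ^ 2 / Z" by (simp add: R_def mult.commute)
      then have "real b \<le> c" unfolding c_def using a by (subst pos_le_divide_eq) auto
      then show "b \<in> {1..nat \<lfloor>c\<rfloor>}" using b by (simp add: R_def le_nat_floor)
    qed
    then have "card (R a) \<le> card {1..nat \<lfloor>c\<rfloor>}" by (intro card_mono) auto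
    then have "card (R a) \<le> nat \<lfloor>c\<rfloor>" by simp
    then have "real (card (R a)) \<le> c" using c0 by linarith
    then show "real (card (R a)) \<le> real X ^ 2 / Z * (1 / real a)" by (simp add: c_def)
  qed auto
  also have "\<dots> = real K * (real X ^ 2 / Z * (\<Sum>a=1..X. 1 / real a))"
    unfolding sum_distrib_left by (intro sum.cong refl) (simp add: mult_ac)
  also have "\<dots> \<le> real K * (real X ^ 2 / Z * (1 + ln (real X + 1)))"
  proof (intro mult_left_mono)
    have "(\<Sum>a=1..X. 1 / real a) \<le> 1 + ln (real X)" using h X by (intro harmonic_le) auto
    also have "\<dots> \<le> 1 + ln (real X + 1)" using h X by simp
    finally show "(\<Sum>a=1..X. 1 / real a) \<le> 1 + ln (real X + 1)" .
  qed (use Z in auto)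
  finally show ?thesis .
qed

text \<open>Every p that occurs satisfies p^2 <= X, so the +1 of the class count is at most X / p^2.
  The sum of 1 / p^2 over integers p > y is at most 1 / y times a harmonic sum.\<close>

lemma card_large_square_factor_le:
  assumes y: "y > 0" and N: "N \<ge> 1"
  shows "real (card {n \<in> {1..N}. \<exists>p. real p > y \<and> p ^ 2 dvd n + c})
    \<le> 2 * real (N + c) * (1 + ln (real (N + c) + 1)) / y"
proof -
  define X where "X = N + c"
  define P where "P = {p \<in> {1..X}. real p > y}"
  define T where "T = (\<lambda>p. {n \<in> {1..N}. p ^ 2 dvd n + c})"
  let ?S = "{n \<in> {1..N}. \<exists>p. real p > y \<and> p ^ 2 dvd n + c}"
  have sub: "?S \<subseteq> (\<Union>p\<in>P. T p)"
  proof
    fix n assume "n \<in> ?S"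
    then obtain p where p: "n \<in> {1..N}" "real p > y" "p ^ 2 dvd n + c" by blast
    have "p \<noteq> 0" using p y by (intro notI) simp
    have "p \<le> p ^ 2" by (simp add: power2_eq_square)
    moreover have "p ^ 2 \<le> n + c" using p by (intro dvd_imp_le) auto
    moreover have "n \<le> N" using p by simp
    ultimately have "p \<le> X" unfolding X_def by linarith
    then have "p \<in> P" "n \<in> T p" using p \<open>p \<noteq> 0\<close> by (auto simp: P_def T_def)
    then show "n \<in> (\<Union>p\<in>P. T p)" by blast
  qed
  have cardT: "real (card (T p)) \<le> 2 * real X / y * (1 / real p)" if p: "p \<in> P" for p
  proof (cases "T p = {}")
    case True
    then show ?thesis using y by simp
  next
    case False
    then obtain n where "n \<in> {1..N}" "p ^ 2 dvd n + c" by (auto simp: T_def)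
    moreover from this have "p ^ 2 \<le> n + c" by (intro dvd_imp_le) auto
    ultimately have "p ^ 2 \<le> X" by (simp add: X_def)
    then have le: "real (p ^ 2) \<le> real X" by (rule of_nat_mono)
    have p0: "real p > 0" using p by (simp add: P_def)
    have "real (card (T p)) \<le> real N / real (p ^ 2) + 1"
    proof (rule card_pairwise_cong_le)
      fix s t assume "s \<in> T p" "t \<in> T p"
      then have "[s + c = t + c] (mod p ^ 2)" by (simp add: T_def cong_def mod_eq_0_iff_dvd)
      then show "[s = t] (mod p ^ 2)" by (simp only: cong_add_rcancel_nat)
    qed (use p0 in \<open>auto simp: T_def\<close>)
    also have "\<dots> \<le> real X / real (p ^ 2) + real X / real (p ^ 2)"
      using le p0 by (intro add_mono divide_right_mono) (auto simp: X_def)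
    also have "\<dots> = 2 * real X * (1 / real p * (1 / real p))" by (simp add: power2_eq_square)
    also have "\<dots> \<le> 2 * real X * (1 / y * (1 / real p))"
      using p y by (intro mult_left_mono mult_right_mono frac_le) (auto simp: P_def)
    finally show ?thesis by simp
  qed
  have "card ?S \<le> card (\<Union>p\<in>P. T p)"
    by (rule card_mono[OF _ sub]) (auto simp: P_def T_def)
  also have "\<dots> \<le> (\<Sum>p\<in>P. card (T p))" by (rule card_UN_le) (simp add: P_def)
  finally have "real (card ?S) \<le> real (\<Sum>p\<in>P. card (T p))" by (rule of_nat_mono)
  also have "\<dots> = (\<Sum>p\<in>P. real (card (T p)))" by simp
  also have "\<dots> \<le> (\<Sum>p\<in>P. 2 * real X / y * (1 / real p))" by (intro sum_mono cardT)
  also have "\<dots> = 2 * real X / y * (\<Sum>p\<in>P. 1 / real p)" by (simp only: sum_distrib_left)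
  also have "\<dots> \<le> 2 * real X / y * (1 + ln (real X + 1))"
  proof (rule mult_left_mono)
    have "(\<Sum>p\<in>P. 1 / real p) \<le> (\<Sum>p=1..X. 1 / real p)" by (rule sum_mono2) (auto simp: P_def)
    also have "\<dots> \<le> 1 + ln (real X)" using N by (intro harmonic_le) (simp add: X_def)
    also have "\<dots> \<le> 1 + ln (real X + 1)" using N by (simp add: X_def)
    finally show "(\<Sum>p\<in>P. 1 / real p) \<le> 1 + ln (real X + 1)" .
  qed (use y in auto)
  finally show ?thesis by (simp add: X_def)
qed

text \<open>The singular case with b = v and a = v + h. The last two conditions make sigma
  multiplicative on both products. The divisibility of the sigma values is left out, so that
  counting these n becomes a pure question about pairs of primes.\<close>

definition degenerate :: "nat \<Rightarrow> real \<Rightarrow> nat \<Rightarrow> bool" where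
  "degenerate h y n \<longleftrightarrow> (\<exists>p q v. prime p \<and> prime q \<and> real p > y \<and> real q > y \<and> v \<ge> 1 \<and>
     n = (v + h) * p \<and> n + h = v * q \<and> \<not> p dvd v + h \<and> \<not> q dvd v)"

lemma finite_linked_pairs: "finite (linked_pairs X k r s y W)"
proof (rule finite_subset)
  show "linked_pairs X k r s y W \<subseteq> {1..X} \<times> {1..X}"
  proof clarify
    fix b q assume "(b, q) \<in> linked_pairs X k r s y W"
    then have H: "b \<ge> 1" "q \<ge> 1" "b * q \<le> X" by (auto simp: linked_pairs_def)
    have "b \<le> b * q" "q \<le> b * q" using H by auto
    then have "b \<le> X" "q \<le> X" using H(3) by linarith+
    then show "b \<in> {1..X} \<and> q \<in> {1..X}" using H by simp
  qed
qed simp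

text \<open>The quotient m is at most of order log X, so that a union over its values costs only
  powers of log X.\<close>

lemma sigma_ratio_le:
  assumes "n \<ge> 1" "h \<ge> 1" "sigma (n + h) = m * sigma n" "n + h \<le> X"
  shows "real m \<le> (1 + real h) * (1 + ln (real X))"
proof -
  have "real m * real n \<le> real m * real (sigma n)"
    using sigma_ge[of n] assms(1) by (intro mult_left_mono) auto
  also have "\<dots> = real (sigma (n + h))" using assms(3) by simp
  also have "\<dots> \<le> real (n + h) * (1 + ln (real (n + h)))" using assms(1) by (intro sigma_le) simp
  also have "\<dots> \<le> (real n * (1 + real h)) * (1 + ln (real X))"
  proof (intro mult_mono add_left_mono)
    have "real h \<le> real n * real h" using mult_right_mono[of 1 "real n" "real h"] assms(1) by simp
    then show "real (n + h) \<le> real n * (1 + real h)" by (simp add: distrib_left)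
    show "ln (real (n + h)) \<le> ln (real X)" using assms by (subst ln_le_cancel_iff) auto
    show "0 \<le> 1 + ln (real (n + h))" using assms by (intro add_nonneg_nonneg ln_ge_zero) auto
  qed auto
  finally have "real n * real m \<le> real n * ((1 + real h) * (1 + ln (real X)))" by (simp add: mult_ac)
  then show ?thesis using assms(1) by simp
qed

text \<open>With \<open>d = gcd (p + 1) (q + 1)\<close>: when \<open>p q > X\<close> and neither prime is at least \<open>d\<close> times
  the other, both exceed \<open>sqrt (X / d)\<close>; this is the second threshold \<open>Y\<close>.\<close>

lemma solution_cases:
  fixes h n N X :: nat and y W V Z :: real
  assumes h: "h \<ge> 1" and y: "real h < y" and n: "n \<in> {1..N}" and X: "X = N + h"
    and dvd: "sigma n dvd sigma (n + h)" and nd: "\<not> degenerate h y n" and V: "V \<ge> 1"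
  defines "Y \<equiv> sqrt (real X / V)"
  defines "K \<equiv> nat \<lfloor>(1 + real h) * (1 + ln (real X))\<rfloor>"
  shows "(\<forall>p\<in>prime_factors n. real p \<le> y) \<or> (\<forall>p\<in>prime_factors (n + h). real p \<le> y) \<or>
     (\<exists>p. real p > y \<and> p ^ 2 dvd n + 0) \<or> (\<exists>p. real p > y \<and> p ^ 2 dvd n + h) \<or>
     (\<exists>b q. (b, q) \<in> linked_pairs X 1 0 h y W \<union> linked_pairs X 1 0 h Y V \<and> n + h = b * q) \<or>
     (\<exists>m\<in>{1..K}. \<exists>a p. (a, p) \<in> linked_pairs X m h 0 y W \<union> linked_pairs X m h 0 Y V \<and> n = a * p) \<or>
     (\<exists>p q d. prime p \<and> prime q \<and> p \<noteq> q \<and> real d > W \<and> d dvd p + 1 \<and> d dvd q + 1 \<and>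
        p dvd n \<and> q dvd n + h \<and> real (p * q) \<le> real X) \<or>
     (\<exists>p q d. prime p \<and> prime q \<and> p \<noteq> q \<and> real d > V \<and> d dvd p + 1 \<and> d dvd q + 1 \<and>
        p dvd n \<and> q dvd n + h \<and> real (p * q) \<le> Z) \<or>
     (\<exists>a b p q m. n = a * p \<and> n + h = b * q \<and> m \<in> {1..K} \<and>
        (q + 1) * sigma b = m * ((p + 1) * sigma a) \<and> a \<noteq> b + h \<and> real (p * q) > Z)"
proof (rule ccontr)
  assume neg: "\<not> ?thesis"
  obtain p where p: "prime p" "p dvd n" "real p > y"
    using neg by (auto simp: in_prime_factors_iff not_le)
  obtain q where q: "prime q" "q dvd n + h" "real q > y"
    using neg by (auto simp: in_prime_factors_iff not_le)
  obtain a where a: "n = a * p" using p(2) by (metis dvd_div_mult_self)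
  obtain b where b: "n + h = b * q" using q(2) by (metis dvd_div_mult_self)
  \<comment> \<open>Primes above h cannot divide h = (n + h) - n. Hence p and q are distinct and
    neither divides the cofactor of the other.\<close>
  have ph: "p > h" "q > h" using p q y by linarith+
  have pa: "\<not> p dvd a"
  proof
    assume "p dvd a"
    then have "p ^ 2 dvd n + 0" by (simp add: a power2_eq_square)
    then show False using neg p by blast
  qed
  have qb: "\<not> q dvd b"
  proof
    assume "q dvd b"
    then have "q ^ 2 dvd n + h" by (simp add: b power2_eq_square)
    then show False using neg q by blast
  qed
  have pnh: "\<not> p dvd h" "\<not> q dvd h" using ph h by (auto dest: dvd_imp_le)
  have pb: "\<not> p dvd b"
  proof
    assume "p dvd b"
    then have "p dvd n + h" by (simp add: b)
    then show False using p pnh by (simp add: dvd_add_right_iff)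
  qed
  have qa: "\<not> q dvd a"
  proof
    assume "q dvd a"
    then have "q dvd n" by (simp add: a)
    then show False using q pnh by (simp add: dvd_add_right_iff)
  qed
  have pq: "p \<noteq> q" using p q pnh by (auto simp: dvd_add_right_iff)
  have ab0: "a > 0" "b > 0" using pa qb by (auto intro!: Nat.gr0I)
  have cop: "coprime b p" "coprime a q" "coprime a p" "coprime b q"
    using prime_imp_coprime[OF p(1) pa] prime_imp_coprime[OF p(1) pb]
      prime_imp_coprime[OF q(1) qa] prime_imp_coprime[OF q(1) qb]
    by (simp_all only: coprime_commute)
  have sn: "sigma n = (p + 1) * sigma a" "sigma (n + h) = (q + 1) * sigma b"
    unfolding b using cop ab0 p q prime_gt_0_nat
    by (simp_all add: a sigma_mult_coprime sigma_prime mult.commute)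
  obtain m where m: "sigma (n + h) = m * sigma n" using dvd by (metis dvd_div_mult_self)
  have rel: "(q + 1) * sigma b = m * ((p + 1) * sigma a)" using m sn by simp
  have "sigma (n + h) > 0" using n by (intro sigma_pos) simp
  then have "m \<noteq> 0" using m by (intro notI) simp
  moreover have "real m \<le> (1 + real h) * (1 + ln (real X))"
    using n X by (intro sigma_ratio_le[OF _ h m]) auto
  ultimately have mK: "m \<in> {1..K}" by (simp add: K_def le_nat_floor)
  have abh: "a \<noteq> b + h"
  proof
    assume "a = b + h"
    then have "degenerate h y n" unfolding degenerate_def
      using p q a b pa qb ab0 by (intro exI[of _ p] exI[of _ q] exI[of _ b]) auto
    with nd show False by blast
  qed
  define d where "d = gcd (p + 1) (q + 1)"
  have d0: "d > 0" by (simp add: d_def)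
  obtain D where D: "d * D = p + 1" using gcd_dvd1[of "p + 1" "q + 1"] unfolding d_def
    by (metis dvd_mult_div_cancel)
  obtain E where E: "d * E = q + 1" using gcd_dvd2[of "p + 1" "q + 1"] unfolding d_def
    by (metis dvd_mult_div_cancel)
  have DE: "coprime D E"
  proof -
    have "d = gcd (d * D) (d * E)" unfolding D E by (simp add: d_def)
    also have "\<dots> = d * gcd D E" by (simp only: gcd_mult_distrib_nat)
    finally have "d * 1 = d * gcd D E" by (simp only: mult_1_right)
    then have "1 = gcd D E" using d0 by (simp only: nat_mult_eq_cancel1)
    then show ?thesis unfolding coprime_iff_gcd_eq_1 by (rule sym)
  qed
  have rel': "E * sigma b = m * (D * sigma a)"
  proof -
    have "d * (E * sigma b) = d * (m * (D * sigma a))"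
      using rel unfolding D[symmetric] E[symmetric] by (simp add: mult_ac)
    then show ?thesis using d0 by simp
  qed
  have Dd: "D dvd 1 * sigma b"
  proof -
    have "D dvd E * sigma b" unfolding rel' by simp
    then show ?thesis using DE by (simp add: coprime_dvd_mult_right_iff)
  qed
  have Ed: "E dvd m * sigma a"
  proof -
    have "E dvd D * (m * sigma a)" using rel' by (metis dvd_triv_left mult.left_commute)
    then show ?thesis using DE by (simp add: coprime_dvd_mult_right_iff coprime_commute)
  qed
  have dpq: "d dvd p + 1" "d dvd q + 1" by (simp_all add: d_def)
  have bX: "b * q \<le> X" "a * p \<le> X" using a b n X by auto
  have pq1: "p \<ge> 1" "q \<ge> 1" using p q prime_gt_0_nat by (auto simp: Suc_le_eq)
  have c1: "[b * q + 0 = h] (mod p)" using b p(2) by (metis add.right_neutral cong_add_lcancel_0_nat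
        cong_0_iff add.commute)
  have c2: "[a * p + h = 0] (mod q)" using a q(2) by (simp add: cong_0_iff)
  \<comment> \<open>\<open>L1\<close> fixes b and reads everything modulo p; \<open>L2\<close> is
    its mirror image, where E divides only m \<sigma>(a), so that m enters. Thresholds are left free
    because both (y, W) and (Y, V) are used.\<close>
  have L1: "(b, q) \<in> linked_pairs X 1 0 h y' W'" if "real p > y'" "real d \<le> W' \<and> p < q \<or> p * d \<le> q" for y' W'
    unfolding linked_pairs_def using that ab0 pq1 bX cop D dpq Dd c1 by auto
  have L2: "(a, p) \<in> linked_pairs X m h 0 y' W'" if "real q > y'" "real d \<le> W' \<and> q < p \<or> q * d \<le> p" for y' W'
    unfolding linked_pairs_def using that ab0 pq1 bX cop E dpq Ed c2 by auto
  have nL1: "(b, q) \<notin> linked_pairs X 1 0 h y W" "(b, q) \<notin> linked_pairs X 1 0 h Y V"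
    using neg b by blast+
  have nL2: "(a, p) \<notin> linked_pairs X m h 0 y W" "(a, p) \<notin> linked_pairs X m h 0 Y V"
    using neg a mK by blast+
  have "\<not> (real d \<le> W \<and> p < q \<or> p * d \<le> q)" using nL1(1) L1[of y W] p(3) by blast
  then have n1: "\<not> (real d \<le> W \<and> p < q)" "q < p * d" by auto
  have "\<not> (real d \<le> W \<and> q < p \<or> q * d \<le> p)" using nL2(1) L2[of y W] q(3) by blast
  then have n2: "\<not> (real d \<le> W \<and> q < p)" "p < q * d" by auto
  \<comment> \<open>One of p < q and q < p holds, and \<open>n1\<close> or \<open>n2\<close> then
    excludes d <= W.\<close>
  have dW: "real d > W" using n1 n2 pq by linarith
  have "\<not> real (p * q) \<le> real X" using neg dW dpq p q pq by blast
  then have pqX: "real X < real p * real q" by simp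
  have dV: "real d > V"
  proof (rule ccontr)
    assume "\<not> real d > V"
    then have dV: "real d \<le> V" by simp
    have big: "s > Y" if "s \<ge> 0" "t < s * real d" "real X < s * t" for s t
    proof -
      have s0: "s > 0"
      proof (rule ccontr)
        assume "\<not> s > 0"
        then have "s = 0" using that by simp
        with that(3) show False by simp
      qed
      have "real X < s * (s * real d)" using that(3) mult_strict_left_mono[OF that(2) s0] by linarith
      also have "\<dots> \<le> s * (s * V)" using dV s0 by (intro mult_left_mono) auto
      finally have "real X / V < s ^ 2" using V by (simp add: pos_divide_less_eq power2_eq_square mult_ac)
      then show ?thesis unfolding Y_def using s0 by (simp add: real_less_lsqrt)
    qed
    have "real q < real p * real d" "real p < real q * real d"
      using n1(2) n2(2) by (metis of_nat_less_iff of_nat_mult)+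
    then have "real p > Y" "real q > Y"
      using big[of "real p" "real q"] big[of "real q" "real p"] pqX by (simp_all add: mult.commute)
    then have "\<not> p < q" "\<not> q < p" using nL1(2) nL2(2) L1[of Y V] L2[of Y V] dV by blast+
    then show False using pq by simp
  qed
  have "real (p * q) > Z"
  proof (rule ccontr)
    assume "\<not> real (p * q) > Z"
    then have "real (p * q) \<le> Z" by simp
    then show False using neg dV dpq p q pq by blast
  qed
  then show False using neg a b mK rel abh by blast
qed

text \<open>A union bound over the alternatives of \<open>solution_cases\<close>. The smooth and
  square terms are doubled because n and n + h both occur; 8 is 4 (X + X) / X from Z = X. The factor
  1 + 2 K^2 collects the case (1, 0, h) and the cases m <= K, where
  \<open>neg_sigma \<kappa> m\<close> is at most 2 sqrt m <= 2 K.\<close>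

lemma nondegenerate_count_le:
  fixes h N X :: nat and y W V Z \<kappa> :: real
  assumes h: "h \<ge> 1" and N: "N \<ge> 1" and y: "real h < y" and X: "X = N + h" and V: "V \<ge> 1" "V \<le> real X"
    and W: "W > 0" and Z: "Z > 0" and \<kappa>: "0 < \<kappa>" "\<kappa> < 1"
  defines "Y \<equiv> sqrt (real X / V)"
  defines "K \<equiv> nat \<lfloor>(1 + real h) * (1 + ln (real X))\<rfloor>"
  defines "L \<equiv> 1 + ln (real X + 1)"
  defines "S \<equiv> (\<Sum>b=1..X. neg_sigma \<kappa> (sigma b) / real b)"
  shows "real (card {n \<in> {1..N}. sigma n dvd sigma (n + h) \<and> \<not> degenerate h y n}) \<le>
     2 * real (card {n \<in> {1..X}. \<forall>p\<in>prime_factors n. real p \<le> y}) + 4 * real X * L / y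
     + (1 + 2 * real K ^ 2) * (real X * S * (y powr (\<kappa> - 1) * (4 * L + W) + Y powr (\<kappa> - 1) * (4 * L + V)))
     + 8 * real X * L ^ 3 / W + 4 * (real X + Z) * L ^ 3 / V + real K * (real X ^ 2 / Z * L)"
proof -
  define G where "G = {n \<in> {1..N}. sigma n dvd sigma (n + h) \<and> \<not> degenerate h y n}"
  define A where "A = (\<lambda>y W. real X * y powr (\<kappa> - 1) * (4 * L + W) * S)"
  define S1 where "S1 = {n \<in> {1..X}. \<forall>p\<in>prime_factors n. real p \<le> y}"
  define S2 where "S2 = (\<lambda>k. k - h) ` S1"
  define Q where "Q = (\<lambda>c. {n \<in> {1..N}. \<exists>p. real p > y \<and> p ^ 2 dvd n + c})"
  define L1 where "L1 = (\<lambda>y W. (\<lambda>(b, q). b * q - h) ` linked_pairs X 1 0 h y W)"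
  define L2 where "L2 = (\<lambda>m y W. (\<lambda>(a, p). a * p) ` linked_pairs X m h 0 y W)"
  define C where "C = (\<lambda>W Z. {n \<in> {1..N}. \<exists>p q d. prime p \<and> prime q \<and> p \<noteq> q \<and> real d > W \<and> d dvd p + 1 \<and> d dvd q + 1 \<and>
      p dvd n \<and> q dvd n + h \<and> real (p * q) \<le> Z})"
  define T where "T = {n \<in> {1..N}. \<exists>a b p q m. n = a * p \<and> n + h = b * q \<and> m \<in> {1..K} \<and>
      (q + 1) * sigma b = m * ((p + 1) * sigma a) \<and> a \<noteq> b + h \<and> real (p * q) > Z}"
  let ?cover = "S1 \<union> (S2 \<union> (Q 0 \<union> (Q h \<union> (L1 y W \<union> (L1 Y V \<union> ((\<Union>m\<in>{1..K}. L2 m y W) \<union>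
      ((\<Union>m\<in>{1..K}. L2 m Y V) \<union> (C W X \<union> (C V Z \<union> T)))))))))"
  have sub: "G \<subseteq> ?cover"
  proof
    fix n assume "n \<in> G"
    then have n: "n \<in> {1..N}" "sigma n dvd sigma (n + h)" "\<not> degenerate h y n" by (auto simp: G_def)
    have nX: "n \<in> {1..X}" "n + h \<in> {1..X}" using n(1) X by auto
    have S2: "n \<in> S2" if "\<forall>p\<in>prime_factors (n + h). real p \<le> y"
    proof -
      have "n + h \<in> S1" using that nX by (simp add: S1_def)
      then have "n + h - h \<in> S2" unfolding S2_def by (rule imageI)
      then show ?thesis by simp
    qed
    have S1: "n \<in> S1" if "\<forall>p\<in>prime_factors n. real p \<le> y" using that nX by (simp add: S1_def)
    have L1: "n \<in> L1 y' W'" if "(b, q) \<in> linked_pairs X 1 0 h y' W'" "n + h = b * q" for b q y' W'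
    proof -
      have "(\<lambda>(b, q). b * q - h) (b, q) \<in> L1 y' W'" unfolding L1_def by (rule imageI[OF that(1)])
      then show ?thesis by (simp only: case_prod_conv that(2)[symmetric] diff_add_inverse2)
    qed
    have L2: "n \<in> L2 m y' W'" if "(a, p) \<in> linked_pairs X m h 0 y' W'" "n = a * p" for a p m y' W'
    proof -
      have "(\<lambda>(a, p). a * p) (a, p) \<in> L2 m y' W'" unfolding L2_def by (rule imageI[OF that(1)])
      then show ?thesis by (simp only: case_prod_conv that(2)[symmetric] diff_add_inverse2)
    qed
    from solution_cases[OF h y n(1) X n(2,3) V(1), of W Z]
    show "n \<in> ?cover"
      unfolding Y_def[symmetric] K_def[symmetric]
      apply (elim disjE)
      subgoal using S1 by blast
      subgoal using S2 by blast
      subgoal using n(1) unfolding Q_def by blast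
      subgoal using n(1) unfolding Q_def by blast
      subgoal using L1 by blast
      subgoal premises H
      proof -
        from H obtain m a p where m: "m \<in> {1..K}" and n: "n = a * p"
          and ap: "(a, p) \<in> linked_pairs X m h 0 y W \<union> linked_pairs X m h 0 Y V" by (elim bexE exE conjE)
        from ap have "n \<in> L2 m y W \<or> n \<in> L2 m Y V"
          using L2[OF _ n, of m y W] L2[OF _ n, of m Y V] by (elim UnE) simp_all
        with m have "n \<in> (\<Union>m\<in>{1..K}. L2 m y W) \<or> n \<in> (\<Union>m\<in>{1..K}. L2 m Y V)"
          by (meson UN_I)
        then show ?thesis by (simp only: Un_iff) (elim disjE; simp)
      qed
      subgoal using n(1) unfolding C_def by blast
      subgoal using n(1) unfolding C_def by blast
      subgoal using n(1) unfolding T_def by blast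
      done
  qed
  have fin: "finite S1" "finite S2" "finite (Q c)" "finite (L1 y' W')" "finite (L2 m y' W')" "finite (C y' W')"
    "finite T" for c y' W' m
    unfolding S1_def S2_def Q_def L1_def L2_def C_def T_def by (auto intro!: finite_imageI finite_linked_pairs)
  have union: "real (card (U \<union> U')) \<le> real (card U) + real (card U')" for U U' :: "nat set"
    using card_Un_le[of U U'] by (metis of_nat_add of_nat_mono)
  let ?total = "real (card S1) + (real (card S2) + (real (card (Q 0)) + (real (card (Q h)) + (real (card (L1 y W)) +
      (real (card (L1 Y V)) + (real (card (\<Union>m\<in>{1..K}. L2 m y W)) + (real (card (\<Union>m\<in>{1..K}. L2 m Y V)) +
      (real (card (C W X)) + (real (card (C V Z)) + real (card T))))))))))"
  have "real (card G) \<le> real (card ?cover)"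
    by (intro of_nat_mono card_mono sub) (simp add: fin)
  also have "\<dots> \<le> ?total"
    by (intro order_trans[OF union] add_left_mono union)
  finally have total: "real (card G) \<le> ?total" .
  have y1: "y \<ge> 1" using y h by linarith
  have Y1: "Y \<ge> 1" using V by (simp add: Y_def)
  have X1: "real X \<ge> 1" using X N by simp
  have L0: "L \<ge> 0" using X1 by (simp add: L_def)
  have S0: "S \<ge> 0" unfolding S_def by (intro sum_nonneg) (simp add: neg_sigma_nonneg)
  have A0: "A y' W' \<ge> 0" if "W' \<ge> 0" for y' W'
    unfolding A_def using that S0 L0 by (intro mult_nonneg_nonneg) auto
  have linked: "real (card (linked_pairs X k r s y' W')) \<le> A y' W' * neg_sigma \<kappa> k"
    if "y' \<ge> 1" "W' \<ge> 0" "k \<ge> 1" for k r s y' W'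
    using card_linked_pairs_le[OF that(1) \<kappa> that(2,3), of X r s] by (simp add: A_def L_def S_def mult_ac)
  have bL1: "real (card (L1 y' W')) \<le> A y' W'" if "y' \<ge> 1" "W' \<ge> 0" for y' W'
  proof -
    have "card (L1 y' W') \<le> card (linked_pairs X 1 0 h y' W')"
      unfolding L1_def by (intro card_image_le finite_linked_pairs)
    then have "real (card (L1 y' W')) \<le> real (card (linked_pairs X 1 0 h y' W'))" by (rule of_nat_mono)
    then show ?thesis using linked[OF that, of 1 0 h] by simp
  qed
  have bL2: "real (card (\<Union>m\<in>{1..K}. L2 m y' W')) \<le> A y' W' * (2 * real K ^ 2)" if "y' \<ge> 1" "W' \<ge> 0" for y' W'
  proof -
    have "card (\<Union>m\<in>{1..K}. L2 m y' W') \<le> (\<Sum>m=1..K. card (L2 m y' W'))" by (rule card_UN_le) simp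
    then have "real (card (\<Union>m\<in>{1..K}. L2 m y' W')) \<le> real (\<Sum>m=1..K. card (L2 m y' W'))" by (rule of_nat_mono)
    also have "\<dots> = (\<Sum>m=1..K. real (card (L2 m y' W')))" by simp
    also have "\<dots> \<le> (\<Sum>m=1..K. A y' W' * (2 * real K))"
    proof (rule sum_mono)
      fix m assume m: "m \<in> {1..K}"
      have "card (L2 m y' W') \<le> card (linked_pairs X m h 0 y' W')"
        unfolding L2_def by (intro card_image_le finite_linked_pairs)
      then have "real (card (L2 m y' W')) \<le> real (card (linked_pairs X m h 0 y' W'))" by (rule of_nat_mono)
      also have "\<dots> \<le> A y' W' * neg_sigma \<kappa> m" using m by (intro linked that) auto
      also have "\<dots> \<le> A y' W' * (2 * real K)"
      proof (intro mult_left_mono A0 that)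
        have "neg_sigma \<kappa> m \<le> 2 * sqrt (real m)" using m \<kappa> by (intro neg_sigma_le) auto
        also have "sqrt (real m) \<le> real m" using m by (intro real_le_lsqrt) (auto simp: power2_eq_square)
        also have "real m \<le> real K" using m by simp
        finally show "neg_sigma \<kappa> m \<le> 2 * real K" by simp
      qed
      finally show "real (card (L2 m y' W')) \<le> A y' W' * (2 * real K)" .
    qed
    also have "\<dots> = A y' W' * (2 * real K ^ 2)" by (simp add: power2_eq_square)
    finally show ?thesis .
  qed
  have bS2: "real (card S2) \<le> real (card S1)" unfolding S2_def by (intro of_nat_mono card_image_le fin)
  have bQ: "real (card (Q c)) \<le> 2 * real X * L / y" if "c \<le> h" for c
  proof -
    have "real (card (Q c)) \<le> 2 * real (N + c) * (1 + ln (real (N + c) + 1)) / y"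
      unfolding Q_def using y1 N by (intro card_large_square_factor_le) auto
    also have "\<dots> \<le> 2 * real X * L / y"
      using that X y1 N unfolding L_def by (intro divide_right_mono mult_mono) auto
    finally show ?thesis .
  qed
  have bC1: "real (card (C W X)) \<le> 8 * real X * L ^ 3 / W"
    using card_common_factor_pairs_le[OF W _ X, of "real X"] by (simp add: C_def L_def)
  have bC2: "real (card (C V Z)) \<le> 4 * (real X + Z) * L ^ 3 / V"
    using card_common_factor_pairs_le[OF _ _ X, of V Z] Z V by (simp add: C_def L_def)
  have bT: "real (card T) \<le> real K * (real X ^ 2 / Z * L)"
    unfolding T_def L_def by (rule card_small_cofactors_le[OF h Z X])
  have "real (card G) \<le> 2 * real (card S1) + 2 * (2 * real X * L / y)
     + (A y W + A Y V + A y W * (2 * real K ^ 2) + A Y V * (2 * real K ^ 2))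
     + 8 * real X * L ^ 3 / W + 4 * (real X + Z) * L ^ 3 / V + real K * (real X ^ 2 / Z * L)"
    using total bS2 bQ[of 0] bQ[of h] bL1[OF y1, of W] bL1[OF Y1, of V] bL2[OF y1, of W] bL2[OF Y1, of V]
      W V bC1 bC2 bT by simp
  also have "A y W + A Y V + A y W * (2 * real K ^ 2) + A Y V * (2 * real K ^ 2) = (1 + 2 * real K ^ 2) * (A y W + A Y V)"
    by (simp add: algebra_simps)
  also have "A y W + A Y V = real X * S * (y powr (\<kappa> - 1) * (4 * L + W) + Y powr (\<kappa> - 1) * (4 * L + V))"
    by (simp add: A_def algebra_simps)
  finally show ?thesis by (simp add: G_def S1_def)
qed

section \<open>Asymptotics of the nondegenerate count\<close>

definition lexp :: "real \<Rightarrow> real" where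
  "lexp t = sqrt (ln t * ln (ln t))"

text \<open>There are six error terms, and each is allowed a sixth of the target. The exponent 21/50
  is a value between 1 / sqrt 6 = 0.408... and 9/20, the saving in the smooth and linked
  terms.\<close>

lemma asymp_smooth:
  "\<forall>\<^sub>F t::real in at_top. 2 * (exp (- 9 / 20 * lexp t) * exp (4 * ln t powr (9 / 20) * (5 + 2 * ln (lexp t)))) \<le> exp (- 21 / 50 * lexp t) / 6"
  unfolding lexp_def by real_asymp

lemma asymp_square:
  "\<forall>\<^sub>F t::real in at_top. 4 * (1 + ln (t + 1)) * exp (- lexp t) \<le> exp (- 21 / 50 * lexp t) / 6"
  unfolding lexp_def by real_asymp

text \<open>The exponent 96 + 97 sqrt (ln t) bounds the divisor average for \<kappa> = 1/20 and
  \<delta> = 1 / sqrt (ln t); it is of lower order than \<open>lexp t\<close>, which has a further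
  factor sqrt (ln (ln t)). The main loss is exp (-19/20 l) exp (l/2) = exp (-9/20 l), and
  t^(-171/400) is Y^(\<kappa> - 1) with Y = t^(9/20).\<close>

lemma asymp_linked:
  "\<forall>\<^sub>F t::real in at_top. (1 + 2 * (ln t) ^ 4) * (exp (96 + 97 * sqrt (ln t)) *
      (exp (- 19 / 20 * lexp t) * (4 * (1 + ln (t + 1)) + exp (lexp t / 2)) +
       t powr (- 171 / 400) * (4 * (1 + ln (t + 1)) + t powr (1 / 10)))) \<le> exp (- 21 / 50 * lexp t) / 6"
  unfolding lexp_def by real_asymp

lemma asymp_pairs1:
  "\<forall>\<^sub>F t::real in at_top. 8 * (1 + ln (t + 1)) ^ 3 / exp (lexp t / 2) \<le> exp (- 21 / 50 * lexp t) / 6"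
  unfolding lexp_def by real_asymp

lemma asymp_pairs2:
  "\<forall>\<^sub>F t::real in at_top. 4 * (1 + t powr (1 / 20)) * (1 + ln (t + 1)) ^ 3 / t powr (1 / 10) \<le> exp (- 21 / 50 * lexp t) / 6"
  unfolding lexp_def by real_asymp

lemma asymp_cofactors:
  "\<forall>\<^sub>F t::real in at_top. (ln t) ^ 2 * (t powr (- 1 / 20) * (1 + ln (t + 1))) \<le> exp (- 21 / 50 * lexp t) / 6"
  unfolding lexp_def by real_asymp


text \<open>The parameters are fixed here: y = exp l, W = exp (l/2), V = t^(1/10), Z = t^(21/20),
  \<kappa> = 1/20. The exponents of V and Z are flexible; what matters is a power saving in Z / (t
  V), in t / Z and in V Y^(\<kappa> - 1).\<close>

lemma nondegenerate_count_eventually_le: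
  assumes h: "h \<ge> 1"
  shows "\<forall>\<^sub>F t in at_top. \<forall>N X. X = N + h \<longrightarrow> real X = t \<longrightarrow>
    real (card {n \<in> {1..N}. sigma n dvd sigma (n + h) \<and> \<not> degenerate h (exp (lexp t)) n})
      \<le> t * exp (- 21 / 50 * lexp t)"
proof -
  have e1: "\<forall>\<^sub>F t in at_top. exp 1 \<le> exp (lexp t)" unfolding lexp_def by real_asymp
  have e2: "\<forall>\<^sub>F t in at_top. 9 / 20 * sqrt (ln (ln t) / ln t) \<le> 1 / 2" by real_asymp
  have e3: "\<forall>\<^sub>F t in at_top. (1 + real h) * (1 + ln t) \<le> (ln t) ^ 2" by real_asymp
  have e4: "\<forall>\<^sub>F t in at_top. real h < exp (lexp t)" unfolding lexp_def by real_asymp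
  have e5: "\<forall>\<^sub>F t::real in at_top. t > exp (exp 1)" by real_asymp
  have e6: "\<forall>\<^sub>F t::real in at_top. t > real h + 1" by real_asymp
  from asymp_smooth asymp_square asymp_linked asymp_pairs1 asymp_pairs2 asymp_cofactors e1 e2 e3 e4 e5 e6
  show ?thesis
  proof eventually_elim
    case (elim t)
    show ?case
    proof (intro allI impI)
      fix N X :: nat assume X: "X = N + h" and t: "real X = t"
      define l where "l = lexp t"
      define y where "y = exp l"
      define L where "L = 1 + ln (t + 1)"
      define K where "K = nat \<lfloor>(1 + real h) * (1 + ln t)\<rfloor>"
      define S where "S = (\<Sum>b=1..X. neg_sigma (1 / 20) (sigma b) / real b)"
      \<comment> \<open>Rankin's exponent will be 1 - \<eta>. This \<eta> makes t^(-\<eta>) = exp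
        (-9/20 l) and y^\<eta> = (ln t)^(9/20); a constant below 1/2 keeps the second
        harmless.\<close>
      define \<eta> where "\<eta> = 9 / 20 * sqrt (ln (ln t) / ln t)"
      note elim' = elim[folded l_def, folded L_def]
      have "1 < exp (exp (1::real))" by simp
      then have t1: "t > 1" using elim(11) by linarith
      have "exp (exp 1) < t" using elim(11) .
      then have lt: "ln t > exp 1" using t1 by (metis exp_gt_zero ln_exp ln_less_cancel_iff less_trans zero_less_one)
      then have llt: "ln (ln t) > 1" by (metis exp_gt_zero ln_exp ln_less_cancel_iff less_trans)
      have lt1: "ln t > 1" using lt exp_ge_add_one_self[of 1] by simp
      have N: "N \<ge> 1" using elim(12) X t by simp
      have L0: "L \<ge> 0" using t1 by (simp add: L_def)
      have l0: "l \<ge> 0" using lt1 llt by (simp add: l_def lexp_def)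
      have \<eta>0: "\<eta> \<ge> 0" "\<eta> \<le> 1 / 2" using elim(8) lt1 llt by (simp_all add: \<eta>_def)
      have prod1: "sqrt (ln (ln t) / ln t) * ln t = l"
        unfolding l_def lexp_def using lt1 llt real_sqrt_mult[of "ln (ln t) / ln t" "(ln t)\<^sup>2"]
        by (simp add: power2_eq_square real_sqrt_mult_self mult.commute)
      have prod2: "sqrt (ln (ln t) / ln t) * l = ln (ln t)"
        unfolding l_def lexp_def using lt1 llt by (simp add: power2_eq_square flip: real_sqrt_mult)
      have lny: "ln y = l" by (simp add: y_def)
      let ?\<Psi> = "{n \<in> {1..X}. \<forall>p\<in>prime_factors n. real p \<le> y}"
      have \<Psi>: "real (card ?\<Psi>)
        \<le> t * (exp (- 9 / 20 * l) * exp (4 * ln t powr (9 / 20) * (5 + 2 * ln l)))"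
      proof -
        have "real (card ?\<Psi>)
          \<le> real X powr (1 - \<eta>) * exp (4 * y powr (1 - (1 - \<eta>)) * (5 + 2 * ln (ln y)))"
          using elim'(7) \<eta>0 by (intro card_smooth_le) (auto simp: y_def)
        also have "real X powr (1 - \<eta>) = t * exp (- 9 / 20 * l)"
        proof -
          have "\<eta> * ln t = 9 / 20 * l" using prod1 by (simp add: \<eta>_def)
          then show ?thesis using t t1 by (simp add: powr_def left_diff_distrib exp_diff exp_minus field_simps)
        qed
        also have "y powr (1 - (1 - \<eta>)) = ln t powr (9 / 20)"
        proof -
          have "\<eta> * l = 9 / 20 * ln (ln t)" using prod2 by (simp add: \<eta>_def)
          then show ?thesis using lt1 by (simp add: powr_def y_def)
        qed
        finally show ?thesis by (simp add: lny mult_ac)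
      qed
      have S: "0 \<le> S" "S \<le> exp (96 + 97 * sqrt (ln t))"
      proof -
        show "0 \<le> S" unfolding S_def by (intro sum_nonneg) (simp add: neg_sigma_nonneg)
        \<comment> \<open>This balances X^\<delta> against the factor exp (O (1 /
          \<delta>)).\<close>
        define \<delta> where "\<delta> = 1 / sqrt (ln t)"
        have \<delta>: "\<delta> > 0" "\<delta> \<le> 1" using lt1 by (simp_all add: \<delta>_def)
        have "S \<le> real X powr \<delta> * exp ((16 + 4 / (1 / 20)) * (1 + 1 / \<delta>))"
          unfolding S_def by (intro sum_neg_sigma_sigma_le \<delta>) simp
        also have "real X powr \<delta> = exp (sqrt (ln t))"
          using t t1 lt1 by (simp add: powr_def \<delta>_def real_div_sqrt)
        also have "exp (sqrt (ln t)) * exp ((16 + 4 / (1 / 20)) * (1 + 1 / \<delta>)) = exp (96 + 97 * sqrt (ln t))"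
          by (simp add: \<delta>_def flip: exp_add)
        finally show "S \<le> exp (96 + 97 * sqrt (ln t))" .
      qed
      have K0: "(1 + real h) * (1 + ln t) \<ge> 0" using lt1 by simp
      have K: "real K \<le> (ln t) ^ 2" using elim(9) K0 unfolding K_def by linarith
      then have K2: "(real K)\<^sup>2 \<le> (ln t) ^ 4"
        using power_mono[OF K, of 2] by simp
      have V: "1 \<le> t powr (1 / 10)" "t powr (1 / 10) \<le> real X"
        using t1 t powr_mono[of "1/10" 1 t] by (simp_all add: ge_one_powr_ge_zero)
      let ?N = "{n \<in> {1..N}. sigma n dvd sigma (n + h) \<and> \<not> degenerate h y n}"
      have main: "real (card ?N) \<le>
         2 * real (card ?\<Psi>) + 4 * t * L / y
         + (1 + 2 * real K ^ 2) * (t * S * (y powr (1 / 20 - 1) * (4 * L + exp (l / 2))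
            + sqrt (t / t powr (1 / 10)) powr (1 / 20 - 1) * (4 * L + t powr (1 / 10))))
         + 8 * t * L ^ 3 / exp (l / 2) + 4 * (t + t powr (21 / 20)) * L ^ 3 / t powr (1 / 10)
         + real K * (t ^ 2 / t powr (21 / 20) * L)"
        using nondegenerate_count_le[OF h N _ X V, of y "exp (l / 2)" "t powr (21 / 20)" "1 / 20"] elim'(10) t1
        unfolding t L_def[symmetric] K_def[symmetric] S_def[symmetric] by (simp add: y_def)
      let ?b = "t * (exp (- 21 / 50 * l) / 6)"
      have T1: "2 * real (card ?\<Psi>) \<le> ?b"
        using order_trans[OF \<Psi> mult_left_mono[of _ "exp (- 21 / 50 * l) / 12" t]] elim'(1) t1
        by (simp add: mult.assoc)
      have T2: "4 * t * L / y \<le> ?b"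
        using mult_left_mono[OF elim'(2), of t] t1 by (simp add: y_def exp_minus field_simps)
      have y1: "y powr (1 / 20 - 1) = exp (- 19 / 20 * l)" by (simp add: y_def powr_def)
      have y2: "sqrt (t / t powr (1 / 10)) powr (1 / 20 - 1) = t powr (- 171 / 400)"
      proof -
        have "t / t powr (1 / 10) = t powr (9 / 10)" using t1 powr_diff[of t 1 "1/10"] by simp
        then have "sqrt (t / t powr (1 / 10)) = t powr (9 / 20)"
          by (simp add: powr_powr flip: powr_half_sqrt)
        then show ?thesis by (simp add: powr_powr)
      qed
      define B where "B = exp (- 19 / 20 * l) * (4 * L + exp (l / 2)) + t powr (- 171 / 400) * (4 * L + t powr (1 / 10))"
      have B0: "B \<ge> 0" using L0 by (simp add: B_def)
      have T3: "(1 + 2 * real K ^ 2) * (t * S * B) \<le> ?b"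
      proof -
        have "(1 + 2 * real K ^ 2) * (t * S * B) \<le> (1 + 2 * (ln t) ^ 4) * (t * exp (96 + 97 * sqrt (ln t)) * B)"
          using K2 S B0 t1 by (intro mult_mono mult_right_mono mult_left_mono) auto
        also have "\<dots> = t * ((1 + 2 * (ln t) ^ 4) * (exp (96 + 97 * sqrt (ln t)) * B))" by (simp only: mult_ac)
        also have "\<dots> \<le> ?b"
          unfolding B_def by (rule mult_left_mono[OF elim'(3)]) (use t1 in simp)
        finally show ?thesis .
      qed
      have T4: "8 * t * L ^ 3 / exp (l / 2) \<le> ?b"
        using mult_left_mono[OF elim'(4), of t] t1 by (simp add: mult_ac)
      have T5: "4 * (t + t powr (21 / 20)) * L ^ 3 / t powr (1 / 10) \<le> ?b"
      proof -
        have "t powr (21 / 20) = t * t powr (1 / 20)" using t1 powr_add[of t 1 "1/20"] by simp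
        then have fac: "t + t powr (21 / 20) = t * (1 + t powr (1 / 20))" by (simp only: distrib_left mult_1_right)
        have regroup: "4 * (t * c) * x / v = t * (4 * c * x / v)" for c x v :: real by simp
        show ?thesis unfolding fac regroup by (rule mult_left_mono[OF elim'(5)]) (use t1 in simp)
      qed
      have T6: "real K * (t ^ 2 / t powr (21 / 20) * L) \<le> ?b"
      proof -
        have "t ^ 2 / t powr (21 / 20) = t * t powr (- 1 / 20)"
        proof -
          have "t ^ 2 / t powr (21 / 20) = t powr (2 - 21 / 20)" using t1 powr_diff[of t 2 "21/20"] by simp
          also have "\<dots> = t powr (1 + (- 1 / 20))" by simp
          also have "\<dots> = t * t powr (- 1 / 20)" using t1 by (subst powr_add) simp
          finally show ?thesis .
        qed
        then have "real K * (t ^ 2 / t powr (21 / 20) * L) = t * (real K * (t powr (- 1 / 20) * L))"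
          by (simp only: mult_ac)
        also have "\<dots> \<le> t * ((ln t) ^ 2 * (t powr (- 1 / 20) * L))"
          using K L0 t1 by (intro mult_left_mono mult_right_mono) auto
        also have "\<dots> \<le> ?b" by (rule mult_left_mono[OF elim'(6)]) (use t1 in simp)
        finally show ?thesis .
      qed
      have "real (card ?N) \<le> t * exp (- 21 / 50 * l)"
      proof -
        have six: "t * exp (- 21 / 50 * l) = 6 * (?b)" by simp
        show ?thesis unfolding six
          using main T1 T2 T3 T4 T5 T6 unfolding y1 y2 B_def[symmetric] by linarith
      qed
      then show "real (card {n \<in> {1..N}. sigma n dvd sigma (n + h) \<and> \<not> degenerate h (exp (lexp t)) n})
        \<le> t * exp (- 21 / 50 * lexp t)" by (simp add: y_def l_def)
    qed
  qed
qed

section \<open>Passage from X to x, and the bound for empty V h\<close>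

lemma filterlim_floor_add: "filterlim (\<lambda>x::real. real (nat \<lfloor>x\<rfloor> + h)) at_top at_top"
proof (rule filterlim_at_top_mono[OF filterlim_tendsto_add_at_top[OF tendsto_const[of "-1"] filterlim_ident]])
  show "\<forall>\<^sub>F x in at_top. - 1 + x \<le> real (nat \<lfloor>x\<rfloor> + h)"
    using eventually_ge_at_top[of 0] by eventually_elim linarith
qed

text \<open>Replacing t = floor x + h by x costs a factor 1 + h. It is paid by lowering 21/50 to
  41/100, which still exceeds 1 / sqrt 6. The threshold for the primes keeps its definition through
  t.\<close>

lemma nondegenerate_count_eventually_le':
  assumes h: "h \<ge> 1"
  shows "\<forall>\<^sub>F x in at_top.
    real (card {n \<in> {1..nat \<lfloor>x\<rfloor>}. sigma n dvd sigma (n + h) \<and>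
        \<not> degenerate h (exp (lexp (real (nat \<lfloor>x\<rfloor> + h)))) n})
      \<le> x * exp (- (1 / sqrt 6) * lexp x)"
proof -
  have "\<forall>\<^sub>F x::real in at_top. \<forall>N X. X = N + h \<longrightarrow> real X = real (nat \<lfloor>x\<rfloor> + h) \<longrightarrow>
    real (card {n \<in> {1..N}. sigma n dvd sigma (n + h) \<and> \<not> degenerate h (exp (lexp (real (nat \<lfloor>x\<rfloor> + h)))) n})
      \<le> real (nat \<lfloor>x\<rfloor> + h) * exp (- 21 / 50 * lexp (real (nat \<lfloor>x\<rfloor> + h)))"
    by (rule eventually_compose_filterlim[OF nondegenerate_count_eventually_le[OF h] filterlim_floor_add])
  moreover have "\<forall>\<^sub>F x::real in at_top. (1 + real h) * exp (- 21 / 50 * sqrt (ln x * ln (ln x)))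
      \<le> exp (- 41 / 100 * sqrt (ln x * ln (ln x)))" by real_asymp
  moreover have "\<forall>\<^sub>F x::real in at_top. x \<ge> exp 1" by real_asymp
  ultimately show ?thesis
  proof eventually_elim
    case (elim x)
    define t where "t = real (nat \<lfloor>x\<rfloor> + h)"
    have "exp 1 \<ge> (1::real)" by simp
    then have x1: "x \<ge> 1" using elim(3) by linarith
    have xt: "x \<le> t" unfolding t_def using h x1 by linarith
    have "t \<le> x + real h" unfolding t_def using x1 by linarith
    also have "\<dots> \<le> (1 + real h) * x" using mult_left_mono[of 1 x "real h"] x1 by (simp add: algebra_simps)
    finally have tx: "t \<le> (1 + real h) * x" .
    have lx: "ln x \<ge> 1" using elim(3) x1 by (simp add: ln_ge_iff)
    have lxt: "ln x \<le> ln t" using xt x1 by simp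
    have l0: "lexp x \<ge> 0" using lx by (simp add: lexp_def)
    have ll: "lexp x \<le> lexp t" unfolding lexp_def
      using lx lxt by (intro real_sqrt_le_mono mult_mono) auto
    have s6: "1 / sqrt 6 \<le> 41 / 100"
    proof -
      have "100 / 41 \<le> sqrt 6" by (rule real_le_rsqrt) (simp add: power2_eq_square)
      then show ?thesis by (simp add: field_simps)
    qed
    have "real (card {n \<in> {1..nat \<lfloor>x\<rfloor>}. sigma n dvd sigma (n + h) \<and> \<not> degenerate h (exp (lexp t)) n})
      \<le> t * exp (- 21 / 50 * lexp t)" using elim(1) unfolding t_def by blast
    also have "\<dots> \<le> ((1 + real h) * x) * exp (- 21 / 50 * lexp x)"
      using tx ll x1 by (intro mult_mono) auto
    also have "\<dots> = x * ((1 + real h) * exp (- 21 / 50 * lexp x))" by simp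
    also have "\<dots> \<le> x * exp (- 41 / 100 * lexp x)"
      using elim(2) x1 unfolding lexp_def by (intro mult_left_mono) auto
    also have "\<dots> \<le> x * exp (- (1 / sqrt 6) * lexp x)"
      using x1 mult_right_mono[OF s6 l0] by (intro mult_left_mono) auto
    finally show ?case unfolding t_def .
  qed
qed

text \<open>Adding v to n + h gives (v + h) (p + 1) = v (q + 1). Inserted into \<sigma>(v) (q + 1) =
  m \<sigma>(v + h) (p + 1), this removes the primes and leaves I(v) = m I(v + h).\<close>

lemma degenerate_imp_in_V:
  assumes h: "h \<ge> 1" and "degenerate h y n" and dvd: "sigma n dvd sigma (n + h)"
  shows "V h \<noteq> {}"
proof -
  obtain p q v where H: "prime p" "prime q" "v \<ge> 1" "n = (v + h) * p" "n + h = v * q"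
    "\<not> p dvd v + h" "\<not> q dvd v"
    using assms(2) unfolding degenerate_def by blast
  have cop: "coprime (v + h) p" "coprime v q"
    using prime_imp_coprime[OF H(1,6)] prime_imp_coprime[OF H(2,7)] by (simp_all only: coprime_commute)
  have pos: "p > 0" "q > 0" using H prime_gt_0_nat by auto
  have sn: "sigma n = sigma (v + h) * (p + 1)"
    unfolding H(4) using sigma_mult_coprime[OF cop(1)] H pos by (simp add: sigma_prime)
  have snh: "sigma (n + h) = sigma v * (q + 1)"
    unfolding H(5) using sigma_mult_coprime[OF cop(2)] H pos by (simp add: sigma_prime)
  obtain m where m: "sigma (n + h) = m * sigma n" using dvd by (metis dvd_div_mult_self)
  have lin: "(v + h) * (p + 1) = v * (q + 1)" using H(4,5) by simp
  have "(p + 1) * (sigma v * (v + h)) = sigma v * (v * (q + 1))" unfolding lin[symmetric] by (simp only: mult_ac)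
  also have "\<dots> = v * sigma (n + h)" unfolding snh by (simp only: mult_ac)
  also have "\<dots> = (p + 1) * (m * (v * sigma (v + h)))" unfolding m sn by (simp only: mult_ac)
  finally have key: "sigma v * (v + h) = m * (v * sigma (v + h))"
    by (subst (asm) nat_mult_eq_cancel1) simp_all
  \<comment> \<open>v = 1 would mean 1 + h = m \<sigma>(1 + h), but \<sigma>(1 + h) > 1 + h.\<close>
  have v2: "v \<ge> 2"
  proof (rule ccontr)
    assume "\<not> v \<ge> 2"
    then have "v = 1" using H by simp
    then have "1 + h = m * sigma (1 + h)" using key by (simp add: sigma_def)
    moreover have "sigma (1 + h) \<ge> 1 + h + 1" using h by (intro sigma_ge_Suc) simp
    moreover have "m \<noteq> 0" using calculation(1) by (intro notI) simp
    then have "sigma (1 + h) \<le> m * sigma (1 + h)" by simp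
    ultimately show False by linarith
  qed
  have s0: "sigma v > 0" "sigma (v + h) > 0" using v2 by (auto intro: sigma_pos)
  have "m \<noteq> 0" using key s0 v2 by (intro notI) simp
  have "real (sigma v) * real (v + h) = real m * (real v * real (sigma (v + h)))"
    using key by (metis of_nat_mult)
  then have ratio: "abundancy v / abundancy (v + h) = real m"
    unfolding abundancy_def using s0 v2 by (simp add: field_simps)
  have "real m \<in> \<nat> - {0}" using \<open>m \<noteq> 0\<close> by simp
  then have "v \<in> V h" unfolding V_def mem_Collect_eq ratio using v2 by blast
  then show ?thesis by blast
qed

lemma B_eq_card: "B h x = card {n \<in> {1..nat \<lfloor>x\<rfloor>}. sigma n dvd sigma (n + h)}"
proof -
  have "{n. 1 \<le> n \<and> real n \<le> x \<and> sigma n dvd sigma (n + h)} = {n \<in> {1..nat \<lfloor>x\<rfloor>}. sigma n dvd sigma (n + h)}"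
    by (auto simp: le_nat_floor) linarith
  then show ?thesis by (simp add: B_def)
qed

lemma B_upper_of_V_empty:
  assumes h: "h \<ge> 1" and V: "V h = {}"
  shows "\<forall>\<^sub>F x in at_top. real (B h x) \<le> x * exp (- (1 / sqrt 6) * lexp x)"
  using nondegenerate_count_eventually_le'[OF h]
proof eventually_elim
  case (elim x)
  have "{n \<in> {1..nat \<lfloor>x\<rfloor>}. sigma n dvd sigma (n + h) \<and>
      \<not> degenerate h (exp (lexp (real (nat \<lfloor>x\<rfloor> + h)))) n} = {n \<in> {1..nat \<lfloor>x\<rfloor>}. sigma n dvd sigma (n + h)}"
    using degenerate_imp_in_V[OF h] V by blast
  then show ?case using elim by (simp only: B_eq_card)
qed

section \<open>An upper bound sieve for pairs of linear forms\<close>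

lemma card_residue_class_bounds:
  fixes M T x :: nat
  assumes M: "M > 0"
  shows "\<bar>real (card {t \<in> {1..T}. [t = x] (mod M)}) - real T / real M\<bar> \<le> 1"
proof -
  let ?A = "{t \<in> {1..T}. [t = x] (mod M)}"
  have up: "real (card ?A) \<le> real T / real M + 1"
    by (rule card_pairwise_cong_le[OF _ M]) (auto intro: cong_trans cong_sym)
  \<comment> \<open>The representative in {1..M}, since the interval starts at 1.\<close>
  define x0 where "x0 = (if x mod M = 0 then M else x mod M)"
  have x0: "1 \<le> x0" "x0 \<le> M" "[x0 = x] (mod M)"
    using M by (auto simp: x0_def cong_def less_imp_le)
  have sub: "(\<lambda>k. x0 + k * M) ` {..<T div M} \<subseteq> ?A"
  proof clarify
    fix k assume "k < T div M"
    then have "Suc k * M \<le> T div M * M" by (intro mult_right_mono) auto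
    also have "\<dots> \<le> T" by simp
    finally have "x0 + k * M \<le> T" using x0(2) by simp
    moreover have "[x0 + k * M = x] (mod M)" using x0(3) by (simp add: cong_def)
    ultimately show "x0 + k * M \<in> {1..T} \<and> [x0 + k * M = x] (mod M)" using x0(1) by simp
  qed
  have "card ((\<lambda>k. x0 + k * M) ` {..<T div M}) = T div M"
    using M by (subst card_image) (auto simp: inj_on_def)
  then have "T div M \<le> card ?A" using card_mono[OF _ sub] by simp
  then have "real (T div M) \<le> real (card ?A)" by (rule of_nat_mono)
  moreover have "real T / real M \<le> real (T div M) + 1"
  proof -
    have "T < M * (T div M + 1)" using M by (metis add.commute dividend_less_times_div mult.commute mult_Suc_right plus_1_eq_Suc)
    then have "real T \<le> real (M * (T div M + 1))" by (intro of_nat_mono) simp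
    then show ?thesis using M by (simp add: pos_divide_le_eq algebra_simps)
  qed
  ultimately show ?thesis using up by linarith
qed

text \<open>Choosing the set C of primes at which t is in the first class fixes t modulo the product
  of A, by the Chinese remainder theorem. The 2^|A| choices are disjoint because the two classes
  differ at each p, and each has error at most 1.\<close>

lemma card_two_classes_bounds:
  fixes A :: "nat set" and r1 r2 :: "nat \<Rightarrow> nat"
  assumes fin: "finite A" and pr: "\<And>p. p \<in> A \<Longrightarrow> prime p"
    and ne: "\<And>p. p \<in> A \<Longrightarrow> \<not> [r1 p = r2 p] (mod p)"
  shows "\<bar>real (card {t \<in> {1..T}. \<forall>p\<in>A. [t = r1 p] (mod p) \<or> [t = r2 p] (mod p)})
     - real T * (\<Prod>p\<in>A. 2 / real p)\<bar> \<le> 2 ^ card A"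
proof -
  let ?W = "{t \<in> {1..T}. \<forall>p\<in>A. [t = r1 p] (mod p) \<or> [t = r2 p] (mod p)}"
  define u where "u = (\<lambda>C p. if p \<in> C then r1 p else r2 p)"
  define N where "N = (\<lambda>C. {t \<in> {1..T}. \<forall>p\<in>A. [t = u C p] (mod p)})"
  define M where "M = \<Prod>A"
  have M0: "M > 0" unfolding M_def using pr prime_gt_0_nat by (intro prod_pos) auto
  have cop: "coprime p q" if "p \<in> A" "q \<in> A" "p \<noteq> q" for p q using that pr by (intro primes_coprime) auto
  have bN: "\<bar>real (card (N C)) - real T / real M\<bar> \<le> 1" for C
  proof -
    obtain x where x: "\<forall>p\<in>A. [x = u C p] (mod p)"
      using chinese_remainder_nat[OF fin, of "\<lambda>p. p" "u C"] cop by blast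
    have "(\<forall>p\<in>A. [t = u C p] (mod p)) \<longleftrightarrow> [t = x] (mod M)" for t
    proof
      assume "\<forall>p\<in>A. [t = u C p] (mod p)"
      then have "[t = x] (mod p)" if "p \<in> A" for p using x that by (meson cong_sym cong_trans)
      then show "[t = x] (mod M)" unfolding M_def using cop by (intro coprime_cong_prod_nat) auto
    next
      assume tx: "[t = x] (mod M)"
      show "\<forall>p\<in>A. [t = u C p] (mod p)"
      proof
        fix p assume p: "p \<in> A"
        then have "p dvd M" unfolding M_def using fin by (intro dvd_prodI) 
        then have "[t = x] (mod p)" using tx by (rule cong_dvd_modulus_nat[rotated])
        then show "[t = u C p] (mod p)" using x p by (meson cong_trans)
      qed
    qed
    then have "N C = {t \<in> {1..T}. [t = x] (mod M)}" unfolding N_def by simp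
    then show ?thesis using card_residue_class_bounds[OF M0, of T x] by simp
  qed
  have eq: "?W = (\<Union>C\<in>Pow A. N C)"
  proof (intro equalityI subsetI)
    fix t assume t: "t \<in> ?W"
    have "t \<in> N {p \<in> A. [t = r1 p] (mod p)}" unfolding N_def u_def using t by auto
    moreover have "{p \<in> A. [t = r1 p] (mod p)} \<in> Pow A" by auto
    ultimately show "t \<in> (\<Union>C\<in>Pow A. N C)" by (rule UN_I[rotated])
  next
    fix t assume "t \<in> (\<Union>C\<in>Pow A. N C)"
    then obtain C where "t \<in> N C" by blast
    then show "t \<in> ?W"
      unfolding N_def u_def by (auto split: if_splits)
  qed
  have disj: "N C \<inter> N C' = {}" if CC: "C \<in> Pow A" "C' \<in> Pow A" "C \<noteq> C'" for C C'
  proof (rule ccontr)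
    assume "N C \<inter> N C' \<noteq> {}"
    then obtain t where t: "t \<in> N C" "t \<in> N C'" by blast
    obtain p where p: "p \<in> A" "(p \<in> C) \<noteq> (p \<in> C')" using CC by blast
    have "[t = u C p] (mod p)" "[t = u C' p] (mod p)" using t p unfolding N_def by auto
    then have "[u C p = u C' p] (mod p)" by (meson cong_sym cong_trans)
    then have "[r1 p = r2 p] (mod p)" using p(2) unfolding u_def by (cases "p \<in> C") (auto intro: cong_sym)
    then show False using ne p by blast
  qed
  have "card (\<Union>C\<in>Pow A. N C) = (\<Sum>C\<in>Pow A. card (N C))"
  proof (rule card_UN_disjoint)
    show "finite (Pow A)" using fin by simp
    show "\<forall>C\<in>Pow A. finite (N C)" by (simp add: N_def)
    show "\<forall>C\<in>Pow A. \<forall>C'\<in>Pow A. C \<noteq> C' \<longrightarrow> N C \<inter> N C' = {}" using disj by blast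
  qed
  then have card: "real (card ?W) = (\<Sum>C\<in>Pow A. real (card (N C)))"
    unfolding eq by simp
  have "(\<Prod>p\<in>A. 2 / real p) = 2 ^ card A / real M"
    unfolding M_def by (simp add: prod_dividef)
  then have "real T * (\<Prod>p\<in>A. 2 / real p) = (\<Sum>C\<in>Pow A. real T / real M)"
    using fin by (simp add: card_Pow)
  then have "\<bar>real (card ?W) - real T * (\<Prod>p\<in>A. 2 / real p)\<bar>
     = \<bar>\<Sum>C\<in>Pow A. real (card (N C)) - real T / real M\<bar>" unfolding card by (simp only: sum_subtractf)
  also have "\<dots> \<le> (\<Sum>C\<in>Pow A. \<bar>real (card (N C)) - real T / real M\<bar>)" by (rule sum_abs)
  also have "\<dots> \<le> (\<Sum>C\<in>Pow A. 1)" by (intro sum_mono bN)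
  also have "\<dots> = 2 ^ card A" using fin by (simp add: card_Pow)
  finally show ?thesis .
qed

text \<open>Moebius inversion on the subset lattice: up to sign the sum expands (1 - 1)^|E -
  K|.\<close>

lemma sum_neg_one_interval:
  assumes "finite E" "K \<subseteq> E"
  shows "(\<Sum>A | K \<subseteq> A \<and> A \<subseteq> E. (- 1 :: real) ^ card A) = (if K = E then (- 1) ^ card K else 0)"
proof -
  have finK: "finite K" using assms finite_subset by blast
  have "(\<Sum>A | K \<subseteq> A \<and> A \<subseteq> E. (- 1 :: real) ^ card A) = (\<Sum>X\<in>Pow (E - K). (- 1) ^ card K * (- 1) ^ card X)"
  proof (rule sum.reindex_bij_witness[of _ "\<lambda>X. K \<union> X" "\<lambda>A. A - K"])
    fix A assume A: "A \<in> {A. K \<subseteq> A \<and> A \<subseteq> E}"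
    then have "finite A" using assms finite_subset by blast
    then have "card A = card K + card (A - K)"
      using A finK by (simp add: card_Diff_subset card_mono)
    then show "(- 1 :: real) ^ card K * (- 1) ^ card (A - K) = (- 1) ^ card A" by (simp add: power_add)
  qed (use assms in auto)
  also have "\<dots> = (- 1) ^ card K * (\<Sum>X\<in>Pow (E - K). (\<Prod>x\<in>X. (- 1 :: real)) * (\<Prod>x\<in>(E - K) - X. 1))"
    by (simp add: sum_distrib_left)
  also have "(\<Sum>X\<in>Pow (E - K). (\<Prod>x\<in>X. (- 1 :: real)) * (\<Prod>x\<in>(E - K) - X. 1)) = (\<Prod>x\<in>E - K. - 1 + 1)"
    using assms by (subst prod_add) auto
  also have "(- 1) ^ card K * \<dots> = (if K = E then (- 1) ^ card K else (0::real))"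
  proof (cases "K = E")
    case False
    then have "card (E - K) \<noteq> 0" using assms by auto
    then show ?thesis using False by simp
  qed simp
  finally show ?thesis .
qed

text \<open>Squarefree moduli are represented by the sets of their prime factors.\<close>

lemma selberg_two_classes:
  fixes P :: "nat set" and r1 r2 :: "nat \<Rightarrow> nat" and T z :: nat
  assumes finP: "finite P" and pr: "\<And>p. p \<in> P \<Longrightarrow> prime p" and p3: "\<And>p. p \<in> P \<Longrightarrow> p \<ge> 3"
    and ne: "\<And>p. p \<in> P \<Longrightarrow> \<not> [r1 p = r2 p] (mod p)" and z: "z \<ge> 1"
  defines "\<D> \<equiv> {A. A \<subseteq> P \<and> \<Prod>A \<le> z}"
  defines "G \<equiv> (\<Sum>A\<in>\<D>. \<Prod>p\<in>A. 2 / (real p - 2))"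
  shows "real (card {t \<in> {1..T}. \<forall>p\<in>P. \<not> [t = r1 p] (mod p) \<and> \<not> [t = r2 p] (mod p)}) \<le> real T / G + real z ^ 4"
proof -
  \<comment> \<open>\<open>g\<close> is the density of the t that lie in a forbidden class for every
    p in A. \<open>H\<close> is its companion in Selberg's method, with g / (1 - g) at each prime:
    (2/p) / (1 - 2/p) = 2 / (p - 2).\<close>
  define g where "g = (\<lambda>A::nat set. \<Prod>p\<in>A. 2 / real p)"
  define H where "H = (\<lambda>A::nat set. \<Prod>p\<in>A. 2 / (real p - 2))"
  define \<mu> where "\<mu> = (\<lambda>A::nat set. (- 1 :: real) ^ card A)"
  \<comment> \<open>Selberg's weights, the minimizer of the quadratic form in \<open>quad\<close>
    under \<open>lam {} = 1\<close>.\<close>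
  define lam where "lam = (\<lambda>A. \<mu> A / g A * ((\<Sum>E | E \<in> \<D> \<and> A \<subseteq> E. H E) / G))"
  have finD: "finite \<D>" unfolding \<D>_def using finP by auto
  have finA: "finite A" if "A \<in> \<D>" for A using that finP finite_subset unfolding \<D>_def by blast
  have DP: "A \<subseteq> P" if "A \<in> \<D>" for A using that unfolding \<D>_def by blast
  have empty: "{} \<in> \<D>" using z by (simp add: \<D>_def)
  have g0: "g A > 0" if "A \<subseteq> P" for A unfolding g_def using that p3 by (intro prod_pos) (force intro: divide_pos_pos)
  have H0: "H A > 0" if "A \<subseteq> P" for A
  proof -
    have "2 / (real p - 2) > 0" if "p \<in> A" for p using p3[of p] that \<open>A \<subseteq> P\<close> by auto
    then show ?thesis unfolding H_def by (intro prod_pos) auto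
  qed
  have HD: "H A > 0" "g A > 0" if "A \<in> \<D>" for A using that H0 g0 DP by auto
  have GH: "G = (\<Sum>A\<in>\<D>. H A)" unfolding G_def H_def ..
  have G1: "G \<ge> 1"
  proof -
    have "H {} \<le> G" unfolding GH using HD finD empty by (intro member_le_sum) (auto intro: less_imp_le)
    then show ?thesis by (simp add: H_def)
  qed
  have down: "A \<in> \<D>" if "A \<subseteq> B" "B \<in> \<D>" for A B
  proof -
    have "\<Prod>A dvd \<Prod>B" using that finA by (intro prod_dvd_prod_subset) auto
    moreover have "\<Prod>B > 0" using that DP[of B] p3 by (intro prod_pos) force
    ultimately have "\<Prod>A \<le> \<Prod>B" by (intro dvd_imp_le)
    then show ?thesis using that unfolding \<D>_def by auto
  qed
  have lambda_empty: "lam {} = 1"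
    using G1 by (simp add: lam_def \<mu>_def g_def GH)
  let ?s = "\<lambda>A. \<Sum>E | E \<in> \<D> \<and> A \<subseteq> E. H E"
  \<comment> \<open>The sum over E is at most G, so the weight is at most 1 / g A. Its 2^(-|A|)
    later cancels the 2^|A| residue classes in the error term.\<close>
  have lambda_bound: "\<bar>lam A\<bar> \<le> real (\<Prod>A) / 2 ^ card A" if A: "A \<in> \<D>" for A
  proof -
    have s: "0 \<le> ?s A" "?s A \<le> G"
      unfolding GH using HD finD by (auto intro!: sum_nonneg sum_mono2 intro: less_imp_le)
    have "\<bar>lam A\<bar> = 1 / g A * (?s A / G)"
      using s G1 HD[OF A] by (simp add: lam_def \<mu>_def abs_mult)
    also have "\<dots> \<le> 1 / g A * 1"
      using s G1 HD[OF A] by (intro mult_left_mono) auto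
    also have "1 / g A = real (\<Prod>A) / 2 ^ card A" by (simp add: g_def prod_dividef)
    finally show ?thesis by simp
  qed
  \<comment> \<open>Preparation for diagonalizing: g (A \<union> B) = g A g B / g (A \<inter> B),
    and 1 / g is the sum of 1 / H over subsets because (p - 2) / 2 + 1 = p / 2.\<close>
  have g_union: "g (A \<union> B) = g A * g B * (\<Sum>K | K \<subseteq> A \<and> K \<subseteq> B. 1 / H K)" if AB: "A \<in> \<D>" "B \<in> \<D>" for A B
  proof -
    have f: "finite A" "finite B" using finA AB by auto
    have "g (A \<union> B) * g (A \<inter> B) = g A * g B" unfolding g_def using f by (rule prod.union_inter)
    moreover have "g (A \<inter> B) * (\<Sum>K | K \<subseteq> A \<and> K \<subseteq> B. 1 / H K) = 1"
    proof -
      have "(\<Sum>K | K \<subseteq> A \<and> K \<subseteq> B. 1 / H K) = (\<Sum>K\<in>Pow (A \<inter> B). (\<Prod>p\<in>K. (real p - 2) / 2) * (\<Prod>p\<in>(A \<inter> B) - K. 1))"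
        by (intro sum.cong) (auto simp: H_def prod_dividef)
      also have "\<dots> = (\<Prod>p\<in>A \<inter> B. (real p - 2) / 2 + 1)" using f by (subst prod_add) auto
      also have "\<dots> = (\<Prod>p\<in>A \<inter> B. real p / 2)" by (intro prod.cong) (auto simp: field_simps)
      finally have "g (A \<inter> B) * (\<Sum>K | K \<subseteq> A \<and> K \<subseteq> B. 1 / H K) = (\<Prod>p\<in>A \<inter> B. 2 / real p * (real p / 2))"
        unfolding g_def by (simp only: prod.distrib)
      also have "\<dots> = (\<Prod>p\<in>A \<inter> B. 1)"
      proof (intro prod.cong refl)
        fix p assume "p \<in> A \<inter> B"
        then have "p \<ge> 3" using DP AB p3 by blast
        then show "2 / real p * (real p / 2) = 1" by simp
      qed
      finally show ?thesis by simp
    qed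
    ultimately show ?thesis by (metis (no_types, lifting) mult.assoc mult.right_neutral)
  qed
  \<comment> \<open>In the variables u_K, the sum of lam A g A over A \<supseteq> K, the form is the
    sum of u_K^2 / H K. Moebius inversion shows u_K = (-1)^|K| H K / G.\<close>
  have quad: "(\<Sum>A\<in>\<D>. \<Sum>B\<in>\<D>. lam A * lam B * g (A \<union> B)) = 1 / G"
  proof -
    let ?u = "\<lambda>K A. if K \<subseteq> A then lam A * g A else 0"
    have "(\<Sum>A\<in>\<D>. \<Sum>B\<in>\<D>. lam A * lam B * g (A \<union> B))
      = (\<Sum>A\<in>\<D>. \<Sum>B\<in>\<D>. \<Sum>K\<in>\<D>. 1 / H K * (?u K A * ?u K B))"
    proof (intro sum.cong refl)
      fix A B assume AB: "A \<in> \<D>" "B \<in> \<D>"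
      have "(\<Sum>K\<in>\<D>. 1 / H K * (?u K A * ?u K B))
        = (\<Sum>K\<in>\<D>. if K \<subseteq> A \<and> K \<subseteq> B then (lam A * g A * (lam B * g B)) * (1 / H K) else 0)"
        by (intro sum.cong refl) auto
      also have "\<dots> = (\<Sum>K | K \<in> \<D> \<and> (K \<subseteq> A \<and> K \<subseteq> B). (lam A * g A * (lam B * g B)) * (1 / H K))"
        by (rule sum.inter_filter[OF finD, symmetric])
      also have "{K. K \<in> \<D> \<and> (K \<subseteq> A \<and> K \<subseteq> B)} = {K. K \<subseteq> A \<and> K \<subseteq> B}" using down AB by blast
      also have "(\<Sum>K | K \<subseteq> A \<and> K \<subseteq> B. (lam A * g A * (lam B * g B)) * (1 / H K)) = (lam A * g A * (lam B * g B)) * (\<Sum>K | K \<subseteq> A \<and> K \<subseteq> B. 1 / H K)"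
        by (simp only: sum_distrib_left)
      also have "\<dots> = lam A * lam B * g (A \<union> B)" unfolding g_union[OF AB] by (simp only: mult_ac)
      finally show "lam A * lam B * g (A \<union> B) = (\<Sum>K\<in>\<D>. 1 / H K * (?u K A * ?u K B))" by simp
    qed
    also have "\<dots> = (\<Sum>A\<in>\<D>. \<Sum>K\<in>\<D>. \<Sum>B\<in>\<D>. 1 / H K * (?u K A * ?u K B))"
      by (intro sum.cong refl sum.swap)
    also have "\<dots> = (\<Sum>K\<in>\<D>. \<Sum>A\<in>\<D>. \<Sum>B\<in>\<D>. 1 / H K * (?u K A * ?u K B))"
      by (rule sum.swap)
    also have "\<dots> = (\<Sum>K\<in>\<D>. 1 / H K * ((\<Sum>A\<in>\<D>. ?u K A) * (\<Sum>B\<in>\<D>. ?u K B)))"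
      unfolding sum_product by (simp only: sum_distrib_left)
    also have "\<dots> = (\<Sum>K\<in>\<D>. H K / G\<^sup>2)"
    proof (intro sum.cong refl)
      fix K assume K: "K \<in> \<D>"
      let ?w = "\<lambda>A E. if K \<subseteq> A \<and> A \<subseteq> E then \<mu> A * (H E / G) else 0"
      have "(\<Sum>A\<in>\<D>. ?u K A) = (\<Sum>A\<in>\<D>. \<Sum>E\<in>\<D>. ?w A E)"
      proof (intro sum.cong refl)
        fix A assume A: "A \<in> \<D>"
        have "lam A * g A = \<mu> A * ((\<Sum>E | E \<in> \<D> \<and> A \<subseteq> E. H E) / G)"
          using HD[OF A] by (simp add: lam_def)
        also have "\<dots> = (\<Sum>E | E \<in> \<D> \<and> A \<subseteq> E. \<mu> A * (H E / G))"
          by (simp only: sum_distrib_left sum_divide_distrib)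
        also have "\<dots> = (\<Sum>E\<in>\<D>. if A \<subseteq> E then \<mu> A * (H E / G) else 0)"
          by (rule sum.inter_filter[OF finD])
        finally show "?u K A = (\<Sum>E\<in>\<D>. ?w A E)"
          by simp
      qed
      also have "\<dots> = (\<Sum>E\<in>\<D>. \<Sum>A\<in>\<D>. ?w A E)" by (rule sum.swap)
      also have "\<dots> = (\<Sum>E\<in>\<D>. if K = E then \<mu> K * (H K / G) else 0)"
      proof (intro sum.cong refl)
        fix E assume E: "E \<in> \<D>"
        have "(\<Sum>A\<in>\<D>. ?w A E) = (\<Sum>A | A \<in> \<D> \<and> (K \<subseteq> A \<and> A \<subseteq> E). \<mu> A * (H E / G))"
          by (rule sum.inter_filter[OF finD, symmetric])
        also have "{A. A \<in> \<D> \<and> (K \<subseteq> A \<and> A \<subseteq> E)} = {A. K \<subseteq> A \<and> A \<subseteq> E}" using down E by blast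
        also have "(\<Sum>A | K \<subseteq> A \<and> A \<subseteq> E. \<mu> A * (H E / G)) = (\<Sum>A | K \<subseteq> A \<and> A \<subseteq> E. \<mu> A) * (H E / G)"
          by (simp only: sum_distrib_right)
        also have "\<dots> = (if K = E then \<mu> K * (H K / G) else 0)"
        proof (cases "K \<subseteq> E")
          case True
          then show ?thesis using sum_neg_one_interval[OF finA[OF E] True] by (simp add: \<mu>_def)
        next
          case False
          then have none: "{A. K \<subseteq> A \<and> A \<subseteq> E} = {}" by blast
          show ?thesis unfolding none using False by auto
        qed
        finally show "(\<Sum>A\<in>\<D>. ?w A E) = (if K = E then \<mu> K * (H K / G) else 0)" .
      qed
      also have "\<dots> = \<mu> K * (H K / G)" using finD K by simp
      finally have "(\<Sum>A\<in>\<D>. ?u K A) = \<mu> K * (H K / G)" .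
      moreover have "\<mu> K * \<mu> K = 1" by (simp add: \<mu>_def flip: power_add mult_2)
      ultimately show "1 / H K * ((\<Sum>A\<in>\<D>. ?u K A) * (\<Sum>B\<in>\<D>. ?u K B)) = H K / G\<^sup>2"
        using HD[OF K] by (simp add: power2_eq_square field_simps)
    qed
    also have "\<dots> = G / G\<^sup>2" by (simp only: GH sum_divide_distrib)
    also have "\<dots> = 1 / G" using G1 by (simp add: power2_eq_square)
    finally show ?thesis .
  qed
  define h where "h = (\<lambda>t. {p \<in> P. [t = r1 p] (mod p) \<or> [t = r2 p] (mod p)})"
  define N where "N = (\<lambda>A. {t \<in> {1..T}. A \<subseteq> h t})"
  let ?S = "{t \<in> {1..T}. \<forall>p\<in>P. \<not> [t = r1 p] (mod p) \<and> \<not> [t = r2 p] (mod p)}"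
  have bN: "\<bar>real (card (N A)) - real T * g A\<bar> \<le> 2 ^ card A" if A: "A \<subseteq> P" for A
  proof -
    have "N A = {t \<in> {1..T}. \<forall>p\<in>A. [t = r1 p] (mod p) \<or> [t = r2 p] (mod p)}"
      using A unfolding N_def h_def by blast
    moreover have "finite A" using A finP finite_subset by blast
    ultimately show ?thesis using card_two_classes_bounds[of A r1 r2 T] A pr ne unfolding g_def by auto
  qed
  have "real (card ?S) = (\<Sum>t=1..T. if t \<in> ?S then 1 else 0)"
  proof -
    have "{t \<in> {1..T}. t \<in> ?S} = ?S" by blast
    then show ?thesis by (subst sum.inter_filter[symmetric]) simp_all
  qed
  \<comment> \<open>The square is nonnegative, and for t in the sifted set only A = {} contributes,
    with \<open>lam {} = 1\<close>.\<close>
  also have "\<dots> \<le> (\<Sum>t=1..T. (\<Sum>A\<in>\<D>. if A \<subseteq> h t then lam A else 0)\<^sup>2)"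
  proof (rule sum_mono)
    fix t assume "t \<in> {1..T}"
    show "(if t \<in> ?S then 1 else 0) \<le> (\<Sum>A\<in>\<D>. if A \<subseteq> h t then lam A else 0)\<^sup>2"
    proof (cases "t \<in> ?S")
      case True
      then have "h t = {}" by (auto simp: h_def)
      then have "(\<Sum>A\<in>\<D>. if A \<subseteq> h t then lam A else 0) = (\<Sum>A\<in>\<D>. if A = {} then lam {} else 0)"
        by (intro sum.cong) auto
      also have "\<dots> = 1" using finD empty lambda_empty by simp
      finally show ?thesis using True by simp
    next
      case False
      then show ?thesis by (simp only: if_False zero_le_power2)
    qed
  qed
  also have "\<dots> = (\<Sum>t=1..T. \<Sum>A\<in>\<D>. \<Sum>B\<in>\<D>. lam A * lam B * (if A \<union> B \<subseteq> h t then 1 else 0))"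
    unfolding power2_eq_square sum_product by (intro sum.cong refl) auto
  also have "\<dots> = (\<Sum>A\<in>\<D>. \<Sum>t=1..T. \<Sum>B\<in>\<D>. lam A * lam B * (if A \<union> B \<subseteq> h t then 1 else 0))"
    by (rule sum.swap)
  also have "\<dots> = (\<Sum>A\<in>\<D>. \<Sum>B\<in>\<D>. \<Sum>t=1..T. lam A * lam B * (if A \<union> B \<subseteq> h t then 1 else 0))"
    by (intro sum.cong refl sum.swap)
  also have "\<dots> = (\<Sum>A\<in>\<D>. \<Sum>B\<in>\<D>. lam A * lam B * real (card (N (A \<union> B))))"
  proof (intro sum.cong refl)
    fix A B
    have "(\<Sum>t=1..T. if A \<union> B \<subseteq> h t then 1 else 0) = real (card (N (A \<union> B)))"
      unfolding N_def by (subst sum.inter_filter[symmetric]) simp_all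
    then show "(\<Sum>t=1..T. lam A * lam B * (if A \<union> B \<subseteq> h t then 1 else 0)) = lam A * lam B * real (card (N (A \<union> B)))"
      by (simp only: sum_distrib_left[symmetric])
  qed
  also have "\<dots> \<le> (\<Sum>A\<in>\<D>. \<Sum>B\<in>\<D>. real T * (lam A * lam B * g (A \<union> B)) + real (\<Prod>A) * real (\<Prod>B))"
  proof (intro sum_mono)
    fix A B assume AB: "A \<in> \<D>" "B \<in> \<D>"
    have "lam A * lam B * (real (card (N (A \<union> B))) - real T * g (A \<union> B))
       \<le> \<bar>lam A\<bar> * \<bar>lam B\<bar> * \<bar>real (card (N (A \<union> B))) - real T * g (A \<union> B)\<bar>"
      by (simp only: abs_mult[symmetric] abs_ge_self)
    also have "\<dots> \<le> (real (\<Prod>A) / 2 ^ card A) * (real (\<Prod>B) / 2 ^ card B) * (2 ^ card A * 2 ^ card B)"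
    proof (intro mult_mono lambda_bound AB)
      have "\<bar>real (card (N (A \<union> B))) - real T * g (A \<union> B)\<bar> \<le> 2 ^ card (A \<union> B)"
        using DP AB by (intro bN) auto
      also have "\<dots> \<le> 2 ^ (card A + card B)" by (intro power_increasing card_Un_le) auto
      finally show "\<bar>real (card (N (A \<union> B))) - real T * g (A \<union> B)\<bar> \<le> 2 ^ card A * 2 ^ card B"
        by (simp add: power_add)
    qed (auto intro!: divide_nonneg_nonneg mult_nonneg_nonneg prod_nonneg)
    also have "\<dots> = real (\<Prod>A) * real (\<Prod>B)" by simp
    finally show "lam A * lam B * real (card (N (A \<union> B))) \<le> real T * (lam A * lam B * g (A \<union> B)) + real (\<Prod>A) * real (\<Prod>B)"
      by (simp add: algebra_simps)
  qed
  also have "\<dots> = real T * (\<Sum>A\<in>\<D>. \<Sum>B\<in>\<D>. lam A * lam B * g (A \<union> B)) + (\<Sum>A\<in>\<D>. real (\<Prod>A)) * (\<Sum>B\<in>\<D>. real (\<Prod>B))"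
    unfolding sum_product by (simp only: sum.distrib sum_distrib_left)
  also have "\<dots> = real T / G + (\<Sum>A\<in>\<D>. real (\<Prod>A))\<^sup>2" unfolding quad by (simp add: power2_eq_square)
  \<comment> \<open>A is recovered from its product, so \<D> has at most z members, and each product
    is at most z.\<close>
  also have "\<dots> \<le> real T / G + (real z ^ 2)\<^sup>2"
  proof (intro add_left_mono power_mono)
    have "inj_on (\<lambda>A. \<Prod>A) \<D>"
    proof (rule inj_onI)
      fix A B assume AB: "A \<in> \<D>" "B \<in> \<D>" "\<Prod>A = \<Prod>B"
      have mem: "p \<in> C \<longleftrightarrow> p \<in> P \<and> p dvd \<Prod>C" if C: "C \<in> \<D>" for p C
      proof
        assume p: "p \<in> P \<and> p dvd \<Prod>C"
        then have "prime p" using pr by blast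
        then obtain q where q: "q \<in> C" "p dvd q"
          using p prime_dvd_prod_iff[OF finA[OF C], of p "\<lambda>x. x"] by blast
        then have "prime q" using pr DP[OF C] by blast
        then show "p \<in> C" using q \<open>prime p\<close> primes_dvd_imp_eq by blast
      next
        assume "p \<in> C"
        then show "p \<in> P \<and> p dvd \<Prod>C" using DP[OF C] dvd_prodI[OF finA[OF C], of p "\<lambda>x. x"] by blast
      qed
      show "A = B"
      proof (rule Set.set_eqI)
        fix p
        show "p \<in> A \<longleftrightarrow> p \<in> B" unfolding mem[OF AB(1)] mem[OF AB(2)] AB(3) ..
      qed
    qed
    then have "card \<D> = card ((\<lambda>A. \<Prod>A) ` \<D>)" by (simp add: card_image)
    also have "\<dots> \<le> card {1..z}"
    proof (intro card_mono image_subsetI)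
      fix A assume A: "A \<in> \<D>"
      have "\<Prod>A > 0" using DP[OF A] p3 by (intro prod_pos) force
      then show "\<Prod>A \<in> {1..z}" using A by (simp add: \<D>_def Suc_le_eq)
    qed simp
    finally have cD: "real (card \<D>) \<le> real z" by simp
    have "(\<Sum>A\<in>\<D>. real (\<Prod>A)) \<le> (\<Sum>A\<in>\<D>. real z)" by (intro sum_mono of_nat_mono) (simp add: \<D>_def)
    also have "\<dots> = real (card \<D>) * real z" by simp
    also have "\<dots> \<le> real z * real z" using cD by (intro mult_right_mono) auto
    finally show "(\<Sum>A\<in>\<D>. real (\<Prod>A)) \<le> real z ^ 2" by (simp add: power2_eq_square)
  qed (auto intro!: sum_nonneg prod_nonneg)
  also have "(real z ^ 2)\<^sup>2 = real z ^ 4" by simp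
  finally show ?thesis .
qed

text \<open>One prime is removed at a time: the multiples of p in the current set are p times
  members of that set, so they carry at most the fraction 1 / p of the sum.\<close>

lemma sum_inverse_coprime_ge:
  assumes "finite Q" "\<And>p. p \<in> Q \<Longrightarrow> prime p"
  shows "(\<Sum>k | k \<in> {1..s} \<and> (\<forall>p\<in>Q. \<not> p dvd k). 1 / real k) \<ge> (\<Prod>p\<in>Q. 1 - 1 / real p) * ln (real s + 1)"
  using assms
proof (induction Q)
  case empty
  have "{k. k \<in> {1..s} \<and> (\<forall>p\<in>{}. \<not> p dvd k)} = {1..s}" by auto
  then show ?case using harmonic_ge[of s] by (simp only: prod.empty mult_1)
next
  case (insert p Q)
  let ?S = "\<lambda>Q. {k. k \<in> {1..s} \<and> (\<forall>p\<in>Q. \<not> p dvd k)}"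
  let ?H = "\<lambda>Q. \<Sum>k\<in>?S Q. 1 / real k"
  have p: "prime p" using insert.prems by simp
  then have p0: "p > 0" by (rule prime_gt_0_nat)
  define D where "D = {k \<in> ?S Q. p dvd k}"
  have split: "?S Q = ?S (insert p Q) \<union> D" "?S (insert p Q) \<inter> D = {}" by (auto simp: D_def)
  have "?H Q = ?H (insert p Q) + (\<Sum>k\<in>D. 1 / real k)"
    using sum.union_disjoint[OF _ _ split(2), of "\<lambda>k. 1 / real k"] unfolding split(1)[symmetric] by (simp add: D_def)
  moreover have "(\<Sum>k\<in>D. 1 / real k) \<le> 1 / real p * ?H Q"
  proof -
    have "D \<subseteq> (\<lambda>k. p * k) ` ?S Q"
    proof
      fix k assume k: "k \<in> D"
      then obtain j where j: "k = p * j" by (auto simp: D_def)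
      have "j \<noteq> 0" using j k by (intro notI) (simp add: D_def)
      moreover have "j \<le> k" using j p0 by simp
      moreover have "k \<le> s" using k by (simp add: D_def)
      moreover have "\<forall>q\<in>Q. \<not> q dvd j" using k j by (auto simp: D_def)
      ultimately have "j \<in> ?S Q" by simp
      then show "k \<in> (\<lambda>k. p * k) ` ?S Q" using j by blast
    qed
    then have "(\<Sum>k\<in>D. 1 / real k) \<le> (\<Sum>k\<in>(\<lambda>k. p * k) ` ?S Q. 1 / real k)"
      by (intro sum_mono2) auto
    also have "\<dots> = (\<Sum>k\<in>?S Q. 1 / real (p * k))"
      using p0 by (subst sum.reindex) (auto simp: inj_on_def)
    also have "\<dots> = 1 / real p * ?H Q" by (simp add: sum_distrib_left)
    finally show ?thesis .
  qed
  ultimately have "?H (insert p Q) \<ge> (1 - 1 / real p) * ?H Q" by (simp add: algebra_simps)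
  moreover have "(1 - 1 / real p) * ?H Q \<ge> (1 - 1 / real p) * ((\<Prod>p\<in>Q. 1 - 1 / real p) * ln (real s + 1))"
    using insert p0 by (intro mult_left_mono insert.IH) auto
  ultimately show ?case using insert.hyps by (simp add: mult.assoc)
qed

text \<open>The i-th smallest member of Q is at least i + 1, and the product of the i / (i + 1)
  telescopes. Polynomial dependence on the number of primes is good enough for the later sum over
  v.\<close>

lemma prod_one_minus_inverse_ge:
  fixes Q :: "nat set"
  assumes "finite Q" "\<And>p. p \<in> Q \<Longrightarrow> p \<ge> 2"
  shows "(\<Prod>p\<in>Q. 1 - 1 / real p) \<ge> 1 / (real (card Q) + 1)"
  using assms
proof (induction Q rule: finite_linorder_max_induct)
  case (insert m Q)
  have notin: "m \<notin> Q" using insert by auto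
  have "insert m Q \<subseteq> {2..m}"
  proof
    fix x assume x: "x \<in> insert m Q"
    then have "x \<le> m" using insert(2) by (auto intro: less_imp_le)
    then show "x \<in> {2..m}" using insert.prems[OF x] by simp
  qed
  then have "card (insert m Q) \<le> card {2..m}" by (intro card_mono) auto
  then have c: "card Q + 2 \<le> m" using insert notin insert.prems[of m] by simp
  then have "1 / real m \<le> 1 / (real (card Q) + 2)" by (intro frac_le) auto
  then have "1 - 1 / real m \<ge> (real (card Q) + 1) / (real (card Q) + 2)" by (simp add: field_simps)
  then have "(1 - 1 / real m) * (\<Prod>p\<in>Q. 1 - 1 / real p) \<ge> (real (card Q) + 1) / (real (card Q) + 2) * (1 / (real (card Q) + 1))"
    using insert c by (intro mult_mono insert.IH) auto
  also have "(real (card Q) + 1) / (real (card Q) + 2) * (1 / (real (card Q) + 1)) = 1 / (real (card (insert m Q)) + 1)"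
    using insert notin by (simp add: add.commute)
  finally show ?case using insert notin by simp
qed simp

text \<open>With 2^j in place of j + 1 divisors, the Euler factor of d(n) / n is bounded by a
  geometric series of ratio 2 / p, whose sum 2 / (p - 2) is exactly Selberg's weight.\<close>

lemma neg_sigma_0_prime_power_le:
  assumes "prime p"
  shows "neg_sigma 0 (p ^ j) \<le> 2 ^ j"
proof (induction j)
  case (Suc j)
  have p: "p > 1" using assms by (rule prime_gt_1_nat)
  have "d dvd p \<longleftrightarrow> d = 1 \<or> d = p" for d using assms unfolding prime_nat_iff by (metis dvd_refl one_dvd)
  then have "{d. d dvd p} = {1, p}" by blast
  then have "neg_sigma 0 p = 2" unfolding neg_sigma_def using p by simp
  then have "neg_sigma 0 (p * p ^ j) \<le> 2 * neg_sigma 0 (p ^ j)" using neg_sigma_mult_le[of p "p ^ j" 0] p by simp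
  then show ?case using Suc by simp
qed simp

text \<open>The square of the sum of 1 / k over k <= s coprime to M is at most the sum of d(n) / n
  over n <= z with prime factors in P. Grouped by the set A of prime factors of n, the latter is at
  most Selberg's sum. That M is even keeps p = 2 out of P.\<close>

lemma selberg_denominator_ge:
  fixes M s z :: nat
  assumes M: "M > 0" "even M" and sz: "s * s \<le> z"
  defines "P \<equiv> {p. prime p \<and> p \<le> z \<and> \<not> p dvd M}"
  shows "(\<Sum>A | A \<subseteq> P \<and> \<Prod>A \<le> z. \<Prod>p\<in>A. 2 / (real p - 2)) \<ge> (ln (real s + 1) / (real (card (prime_factors M)) + 1))\<^sup>2"
proof -
  let ?G = "(\<Sum>A | A \<subseteq> P \<and> \<Prod>A \<le> z. \<Prod>p\<in>A. 2 / (real p - 2))"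
  let ?Q = "prime_factors M"
  define f where "f = (\<lambda>n. neg_sigma 0 n / real n)"
  have f0: "f n \<ge> 0" for n by (simp add: f_def neg_sigma_nonneg)
  have finP: "finite P" unfolding P_def by (rule finite_subset[of _ "{..z}"]) auto
  have p3: "p \<ge> 3" if "p \<in> P" for p
  proof -
    have "p \<ge> 2" using that prime_ge_2_nat by (simp add: P_def)
    moreover have "p \<noteq> 2" using that M by (auto simp: P_def)
    ultimately show ?thesis by simp
  qed
  define S where "S = {k. k \<in> {1..s} \<and> (\<forall>p\<in>?Q. \<not> p dvd k)}"
  define U where "U = {n \<in> {1..z}. prime_factors n \<subseteq> P}"
  have l1: "ln (real s + 1) / (real (card ?Q) + 1) \<le> (\<Sum>k\<in>S. 1 / real k)"
  proof -
    have "1 / (real (card ?Q) + 1) * ln (real s + 1) \<le> (\<Prod>p\<in>?Q. 1 - 1 / real p) * ln (real s + 1)"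
      by (intro mult_right_mono prod_one_minus_inverse_ge) (auto simp: in_prime_factors_iff prime_ge_2_nat)
    also have "\<dots> \<le> (\<Sum>k\<in>S. 1 / real k)" unfolding S_def
      by (rule sum_inverse_coprime_ge) (auto simp: in_prime_factors_iff)
    finally show ?thesis by simp
  qed
  have mult_S: "k * l \<in> U" if kl: "k \<in> S" "l \<in> S" for k l
  proof -
    have "k * l \<le> s * s" using kl unfolding S_def by (intro mult_mono) auto
    then have z: "k * l \<le> z" using sz by simp
    have kl0: "k > 0" "l > 0" using kl by (auto simp: S_def)
    have "p \<in> P" if p: "p \<in> prime_factors (k * l)" for p
    proof -
      have pp: "prime p" "p dvd k * l" using p by (auto simp: in_prime_factors_iff)
      then have "p dvd k \<or> p dvd l" by (simp add: prime_dvd_mult_iff)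
      then have "p \<notin> ?Q" using kl unfolding S_def by blast
      then have "\<not> p dvd M" using pp M by (simp add: in_prime_factors_iff)
      moreover have "p \<le> k * l" using pp kl0 by (intro dvd_imp_le) auto
      ultimately show ?thesis using pp z by (simp add: P_def)
    qed
    then show ?thesis using z kl0 unfolding U_def by auto
  qed
  have "(\<Sum>k\<in>S. 1 / real k)\<^sup>2 = (\<Sum>(k, l)\<in>S \<times> S. 1 / real (k * l))"
    unfolding power2_eq_square sum_product by (simp add: sum.cartesian_product)
  \<comment> \<open>Recording k next to the product k l makes the map injective, so each n is hit at
    most once per divisor.\<close>
  also have "\<dots> = (\<Sum>(n, d)\<in>(\<lambda>(k, l). (k * l, k)) ` (S \<times> S). 1 / real n)"
    by (subst sum.reindex) (auto simp: inj_on_def S_def intro!: sum.cong)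
  also have "\<dots> \<le> (\<Sum>(n, d)\<in>(SIGMA n:U. {d. d dvd n}). 1 / real n)"
  proof (rule sum_mono2)
    show "finite (SIGMA n:U. {d. d dvd n})" by (rule finite_SigmaI) (auto simp: U_def)
    show "(\<lambda>(k, l). (k * l, k)) ` (S \<times> S) \<subseteq> (SIGMA n:U. {d. d dvd n})" using mult_S by auto
  qed auto
  also have "\<dots> = (\<Sum>n\<in>U. \<Sum>d | d dvd n. 1 / real n)"
    by (rule sum.Sigma[symmetric]) (auto simp: U_def)
  also have "\<dots> = (\<Sum>n\<in>U. f n)"
  proof (intro sum.cong refl)
    fix n assume n: "n \<in> U"
    have "neg_sigma 0 n = (\<Sum>d | d dvd n. 1)" unfolding neg_sigma_def
      by (intro sum.cong refl) (use n in \<open>auto simp: U_def\<close>)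
    then show "(\<Sum>d | d dvd n. 1 / real n) = f n" by (simp add: f_def)
  qed
  also have "\<dots> = (\<Sum>A | A \<subseteq> P \<and> \<Prod>A \<le> z. \<Sum>n\<in>{n\<in>U. prime_factors n = A}. f n)"
  proof (rule sum.group[symmetric])
    show "finite U" by (simp add: U_def)
    show "finite {A. A \<subseteq> P \<and> \<Prod>A \<le> z}" using finP by simp
    show "prime_factors ` U \<subseteq> {A. A \<subseteq> P \<and> \<Prod>A \<le> z}"
    proof clarify
      fix n assume n: "n \<in> U"
      then have n0: "n > 0" "n \<le> z" "prime_factors n \<subseteq> P" by (auto simp: U_def)
      have "\<Prod>(prime_factors n) dvd n" by (rule prod_primes_dvd) (auto simp: in_prime_factors_iff)
      then have "\<Prod>(prime_factors n) \<le> n" using n0 by (intro dvd_imp_le)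
      then show "prime_factors n \<subseteq> P \<and> \<Prod>(prime_factors n) \<le> z" using n0 by simp
    qed
  qed
  also have "\<dots> \<le> ?G"
  proof (rule sum_mono)
    fix A assume "A \<in> {A. A \<subseteq> P \<and> \<Prod>A \<le> z}"
    then have A: "A \<subseteq> P" by simp
    have "{n\<in>U. prime_factors n = A} = {n. n \<in> {1..z} \<and> prime_factors n = A}" using A by (auto simp: U_def)
    then have "(\<Sum>n\<in>{n\<in>U. prime_factors n = A}. f n) = (\<Sum>n | n \<in> {1..z} \<and> prime_factors n = A. f n)" by simp
    also have "\<dots> \<le> (\<Prod>p\<in>A. \<Sum>j=1..z. f (p ^ j))"
    proof (rule sum_exact_prime_factors_le)
      show "finite A" using A finP by (rule finite_subset)
      show "prime p" if "p \<in> A" for p using that A by (auto simp: P_def)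
      show "f (m * n) \<le> f m * f n" if "m > 0" "n > 0" for m n
        using neg_sigma_mult_le[OF that, of 0] that by (simp add: f_def divide_right_mono)
    qed (use f0 in \<open>auto simp: f_def\<close>)
    also have "\<dots> \<le> (\<Prod>p\<in>A. 2 / (real p - 2))"
    proof (intro prod_mono conjI sum_nonneg f0)
      fix p assume p: "p \<in> A"
      then have pp: "prime p" "p \<ge> 3" using A p3 by (auto simp: P_def)
      define r where "r = 2 / real p"
      have r: "0 < r" "r < 1" using pp by (auto simp: r_def)
      have "(\<Sum>j=1..z. f (p ^ j)) \<le> (\<Sum>j=1..z. r ^ j)"
      proof (rule sum_mono)
        fix j
        have "f (p ^ j) \<le> 2 ^ j / real (p ^ j)" unfolding f_def
          by (intro divide_right_mono neg_sigma_0_prime_power_le pp) auto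
        then show "f (p ^ j) \<le> r ^ j" by (simp add: r_def power_divide)
      qed
      also have "\<dots> = r * (\<Sum>j<z. r ^ j)" by (simp add: sum_distrib_left sum.atLeast1_atMost_eq)
      also have "\<dots> = r * ((1 - r ^ z) / (1 - r))" using r by (simp add: sum_gp_strict)
      also have "\<dots> \<le> r * (1 / (1 - r))" using r by (intro mult_left_mono divide_right_mono) auto
      also have "\<dots> = 2 / (real p - 2)" using pp by (simp add: r_def field_simps)
      finally show "(\<Sum>j=1..z. f (p ^ j)) \<le> 2 / (real p - 2)" .
    qed
    finally show "(\<Sum>n\<in>{n\<in>U. prime_factors n = A}. f n) \<le> (\<Prod>p\<in>A. 2 / (real p - 2))" .
  qed
  finally have "(\<Sum>k\<in>S. 1 / real k)\<^sup>2 \<le> ?G" .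
  moreover have "(ln (real s + 1) / (real (card ?Q) + 1))\<^sup>2 \<le> (\<Sum>k\<in>S. 1 / real k)\<^sup>2"
    using l1 by (intro power_mono) auto
  ultimately show ?thesis by linarith
qed

text \<open>Modulo p the forbidden classes are the inverses of a and b. They exist and differ when p
  divides none of a, b and b - a.\<close>

lemma card_prime_pairs_le:
  fixes a b s T :: nat
  assumes ab: "a \<ge> 1" "a < b" and s: "s \<ge> 1"
  shows "real (card {t \<in> {1..T}. prime (a * t - 1) \<and> prime (b * t - 1)})
    \<le> real T * ((real (card (prime_factors (2 * a * b * (b - a)))) + 1) / ln (real s + 1))\<^sup>2 + 3 * real s ^ 8"
proof -
  \<comment> \<open>The factor 2 removes the prime 2, where two forbidden classes would leave
    nothing and p - 2 = 0.\<close>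
  define M where "M = 2 * a * b * (b - a)"
  define z where "z = s * s"
  define P where "P = {p. prime p \<and> p \<le> z \<and> \<not> p dvd M}"
  define r where "r = (\<lambda>c p::nat. SOME x. [c * x = 1] (mod p))"
  have M0: "M > 0" "even M" using ab by (auto simp: M_def)
  have z1: "z \<ge> 1" using s by (simp add: z_def)
  have r: "[c * r c p = 1] (mod p)" if "prime p" "\<not> p dvd c" for c p
  proof -
    have "coprime c p" using prime_imp_coprime[OF that] by (simp add: coprime_commute)
    then have "\<exists>x. [c * x = 1] (mod p)" using cong_solve_coprime_nat[of c p] by auto
    then show ?thesis unfolding r_def by (rule someI_ex)
  qed
  have Pab: "prime p" "\<not> p dvd a" "\<not> p dvd b" "\<not> p dvd b - a" "\<not> p dvd 2" if "p \<in> P" for p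
    using that unfolding P_def M_def by (auto simp: dvd_mult dvd_mult2)
  have p3: "p \<ge> 3" if "p \<in> P" for p
  proof -
    have "p \<ge> 2" using prime_ge_2_nat Pab(1)[OF that] .
    moreover have "p \<noteq> 2" using Pab(5)[OF that] by auto
    ultimately show ?thesis by simp
  qed
  have ne: "\<not> [r a p = r b p] (mod p)" if p: "p \<in> P" for p
  proof
    assume "[r a p = r b p] (mod p)"
    then have "[b * r a p = b * r b p] (mod p)" by (rule cong_scalar_left)
    also have "[b * r b p = 1] (mod p)" using r Pab[OF p] by blast
    finally have 1: "[b * r a p = 1] (mod p)" .
    have 2: "[a * r a p = 1] (mod p)" using r Pab[OF p] by blast
    have "b * r a p = (b - a) * r a p + a * r a p" using ab by (simp add: algebra_simps flip: add_mult_distrib2)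
    then have "[(b - a) * r a p + a * r a p = 0 + a * r a p] (mod p)" using 1 2 by (metis add_0 cong_sym cong_trans)
    then have "[(b - a) * r a p = 0] (mod p)" by (simp only: cong_add_rcancel_nat)
    then have "p dvd (b - a) * r a p" by (simp add: cong_0_iff)
    then have "p dvd r a p" using Pab[OF p] by (simp add: prime_dvd_mult_iff)
    then have "p dvd a * r a p" by simp
    then have "[1 = 0] (mod p)" using 2 by (metis cong_0_iff cong_sym cong_trans)
    then have "p dvd 1" by (simp only: cong_0_iff)
    then show False using Pab(1)[OF p] by auto
  qed
  define G where "G = (\<Sum>A | A \<subseteq> P \<and> \<Prod>A \<le> z. \<Prod>p\<in>A. 2 / (real p - 2))"
  define E where "E = {t \<in> {1..T}. \<forall>p\<in>P. \<not> [t = r a p] (mod p) \<and> \<not> [t = r b p] (mod p)}"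
  let ?S = "{t \<in> {1..T}. prime (a * t - 1) \<and> prime (b * t - 1)}"
  have finP: "finite P" unfolding P_def by (rule finite_subset[of _ "{..z}"]) auto
  have E: "real (card E) \<le> real T / G + real z ^ 4"
    unfolding E_def G_def by (rule selberg_two_classes[OF finP Pab(1) p3 ne z1])
  \<comment> \<open>For t <= z + 1 the prime a t - 1 may itself be a sieving prime, so these t are
    counted separately.\<close>
  have sub: "?S \<subseteq> E \<union> {1..z + 1}"
  proof
    fix t assume t: "t \<in> ?S"
    show "t \<in> E \<union> {1..z + 1}"
    proof (cases "t \<le> z + 1")
      case False
      have big: "z < c * t - 1" if "c \<ge> 1" for c
      proof -
        have "t \<le> c * t" using that by simp
        then show ?thesis using False by linarith
      qed
      have no: "\<not> [t = r c p] (mod p)" if p: "p \<in> P" "\<not> p dvd c" "c \<ge> 1" "prime (c * t - 1)" for c p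
      proof
        assume "[t = r c p] (mod p)"
        then have "[c * t = c * r c p] (mod p)" by (rule cong_scalar_left)
        also have "[c * r c p = 1] (mod p)" using r Pab(1) p by blast
        finally have "[c * t = 1] (mod p)" .
        moreover have "1 \<le> c * t" using big[OF p(3)] by linarith
        ultimately have "p dvd c * t - 1" by (simp add: cong_altdef_nat)
        then have "p = c * t - 1" using p(4) Pab(1)[OF p(1)] primes_dvd_imp_eq by blast
        moreover have "p \<le> z" using p(1) by (simp add: P_def)
        ultimately show False using big[OF p(3)] by simp
      qed
      have "t \<in> E" unfolding E_def using t no Pab ab by auto
      then show ?thesis by simp
    qed (use t in auto)
  qed
  have "card ?S \<le> card (E \<union> {1..z + 1})" by (rule card_mono[OF _ sub]) (simp add: E_def)
  also have "\<dots> \<le> card E + (z + 1)" using card_Un_le[of E "{1..z + 1}"] by simp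
  finally have "real (card ?S) \<le> real (card E) + (real z + 1)" by linarith
  also have "\<dots> \<le> real T / G + real z ^ 4 + (real z + 1)" using E by simp
  also have "\<dots> \<le> real T / G + 3 * real z ^ 4"
  proof -
    have "1 \<le> real z ^ 4" "real z \<le> real z ^ 4" using z1 by (auto intro: one_le_power self_le_power)
    then show ?thesis by linarith
  qed
  also have "real z ^ 4 = real s ^ 8" by (simp add: z_def flip: power_add power2_eq_square)
  also have "real T / G \<le> real T * ((real (card (prime_factors M)) + 1) / ln (real s + 1))\<^sup>2"
  proof -
    define \<gamma> where "\<gamma> = (ln (real s + 1) / (real (card (prime_factors M)) + 1))\<^sup>2"
    have "\<gamma> \<le> G" unfolding \<gamma>_def G_def P_def by (rule selberg_denominator_ge[OF M0]) (simp add: z_def)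
    moreover have "\<gamma> > 0" unfolding \<gamma>_def using s by (intro zero_less_power divide_pos_pos) auto
    ultimately have "real T / G \<le> real T / \<gamma>" by (intro divide_left_mono) auto
    also have "\<dots> = real T * ((real (card (prime_factors M)) + 1) / ln (real s + 1))\<^sup>2"
      by (simp add: \<gamma>_def power_divide)
    finally show ?thesis .
  qed
  finally show ?thesis by (simp add: M_def)
qed

section \<open>Degenerate solutions\<close>

text \<open>2^\<omega> <= M gives \<omega> ln 2 <= ln M <= 8 u with u = M^(1/8), so \<omega> + 1 <=
  13 u. The power 1/4 is chosen for M of order v^2: the sieve then loses only v^(1/2) against the
  factor v^(-2) in the range of t.\<close>

lemma card_prime_factors_le:
  assumes "M > 0"
  shows "(real (card (prime_factors M)) + 1)\<^sup>2 \<le> 169 * real M powr (1 / 4)"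
proof -
  define w where "w = card (prime_factors M)"
  have "2 ^ w \<le> \<Prod>(prime_factors M)"
    using prod_mono[of "prime_factors M" "\<lambda>_. 2" "\<lambda>p. p"]
    by (simp add: w_def in_prime_factors_iff prime_ge_2_nat)
  also have "\<dots> dvd M" by (rule prod_primes_dvd) (auto simp: in_prime_factors_iff)
  then have "\<Prod>(prime_factors M) \<le> M" using assms by (intro dvd_imp_le)
  finally have "real (2 ^ w) \<le> real M" by (rule of_nat_mono)
  then have "ln (2 ^ w) \<le> ln (real M)" by (subst ln_le_cancel_iff) (use assms in auto)
  then have 1: "real w * ln 2 \<le> ln (real M)" by (simp add: ln_realpow)
  define u where "u = real M powr (1 / 8)"
  have u1: "u \<ge> 1" using assms by (simp add: u_def ge_one_powr_ge_zero)
  have "ln (real M) = 8 * ln u" using assms by (simp add: u_def ln_powr)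
  also have "\<dots> \<le> 8 * u" using ln_le_minus_one[of u] u1 by simp
  finally have "real w * ln 2 \<le> 8 * u" using 1 by linarith
  moreover have "real w * (2 / 3) \<le> real w * ln 2" using ln2_ge_two_thirds by (intro mult_left_mono) auto
  ultimately have "real w + 1 \<le> 13 * u" using u1 by linarith
  then have "(real w + 1)\<^sup>2 \<le> (13 * u)\<^sup>2" by (intro power_mono) auto
  also have "\<dots> = 169 * u ^ 2" by (simp add: power_mult_distrib)
  also have "u ^ 2 = real M powr (1 / 4)" using assms by (simp add: u_def power2_eq_square flip: powr_add)
  finally show ?thesis by (simp add: w_def)
qed

lemma cofactors_of_gcd:
  fixes v h :: nat
  assumes "v \<ge> 1" "h \<ge> 1"
  defines "g \<equiv> gcd v h"
  defines "a \<equiv> v div g" and "b \<equiv> (v + h) div g"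
  shows "g \<ge> 1" "g \<le> h" "v = g * a" "v + h = g * b" "coprime a b" "a \<ge> 1" "a < b" "b - a \<le> h" "a \<le> v" "b \<le> v + h"
proof -
  show g1: "g \<ge> 1" using assms by (simp add: g_def Suc_le_eq)
  show "g \<le> h" using assms by (auto simp: g_def intro: dvd_imp_le)
  show va: "v = g * a" by (simp add: a_def g_def)
  show vb: "v + h = g * b" unfolding b_def
    by (rule dvd_mult_div_cancel[symmetric]) (simp add: g_def)
  have "g = gcd v (v + h)" by (simp add: g_def gcd_add2)
  also have "\<dots> = gcd (g * a) (g * b)" using va vb by simp
  also have "\<dots> = g * gcd a b" by (simp only: gcd_mult_distrib_nat)
  finally have "g * 1 = g * gcd a b" by (simp only: mult_1_right)
  then have "1 = gcd a b" using g1 by (simp only: nat_mult_eq_cancel1)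
  then show "coprime a b" unfolding coprime_iff_gcd_eq_1 by (rule sym)
  have "a \<noteq> 0" using va assms(1) by (metis mult_0_right not_one_le_zero)
  then show "a \<ge> 1" by simp
  have "g * a < g * b" unfolding va[symmetric] vb[symmetric] using assms by simp
  then show "a < b" by simp
  have "h = g * b - g * a" unfolding va[symmetric] vb[symmetric] by simp
  also have "\<dots> = g * (b - a)" by (simp add: diff_mult_distrib2)
  finally have "h = g * (b - a)" .
  then show "b - a \<le> h" using g1 by simp
  show "a \<le> v" by (simp add: a_def)
  show "b \<le> v + h" by (simp add: b_def)
qed

text \<open>Dividing (v + h) (p + 1) = v (q + 1) by gcd v h leaves coprime coefficients a < b, which
  forces p + 1 = a t and q + 1 = b t. This is the pair of linear forms given to the sieve.\<close>

lemma degenerate_parametrization: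
  assumes h: "h \<ge> 1" and n: "n \<in> {1..N}" and deg: "degenerate h y n"
  shows "\<exists>v\<in>{1..N + h}. \<exists>t. t \<in> {1..2 * N * h div v ^ 2} \<and> prime (v div gcd v h * t - 1) \<and>
    prime ((v + h) div gcd v h * t - 1) \<and> n = (v + h) * (v div gcd v h * t - 1)"
proof -
  obtain p q v where H: "prime p" "prime q" "v \<ge> 1" "n = (v + h) * p" "n + h = v * q"
    using deg unfolding degenerate_def by blast
  define g a b where "g = gcd v h" and "a = v div g" and "b = (v + h) div g"
  note gab = cofactors_of_gcd[OF H(3) h, folded g_def, folded a_def b_def]
  have "(v + h) * (p + 1) = v * (q + 1)" using H(4,5) by simp
  then have "g * (b * (p + 1)) = g * (a * (q + 1))" using gab(3,4) by (metis mult.assoc)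
  then have lin: "b * (p + 1) = a * (q + 1)" using gab(1) by simp
  have "a dvd b * (p + 1)" unfolding lin by simp
  then have "a dvd p + 1" using gab(5) by (simp only: coprime_dvd_mult_right_iff)
  then obtain t where t: "p + 1 = a * t" by (elim dvdE)
  have "a * (q + 1) = a * (b * t)" unfolding lin[symmetric] t by (simp only: mult_ac)
  then have q: "q + 1 = b * t" using gab(6) by (simp only: nat_mult_eq_cancel1 Suc_le_eq One_nat_def)
  have pq: "p = a * t - 1" "q = b * t - 1" using t q by simp_all
  have t0: "t \<ge> 1" using t by (cases t) auto
  have p1: "p \<ge> 1" using H(1) prime_gt_0_nat by (simp add: Suc_le_eq)
  \<comment> \<open>v t = g (p + 1) <= 2 g p, so v^2 t <= 2 g n <= 2 h N.\<close>
  have "t * v ^ 2 \<le> (v + h) * (v * t)" by (simp add: power2_eq_square algebra_simps)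
  also have "\<dots> = g * ((v + h) * (p + 1))" unfolding t using gab(3) by (metis mult.assoc mult.left_commute)
  also have "\<dots> \<le> g * ((v + h) * (2 * p))" using p1 by (intro mult_left_mono) auto
  also have "\<dots> = g * (2 * n)" unfolding H(4) by simp
  also have "\<dots> \<le> h * (2 * N)" using gab(2) n by (intro mult_mono) auto
  finally have "t * v ^ 2 \<le> 2 * N * h" by (simp add: mult_ac)
  then have "t \<le> 2 * N * h div v ^ 2" using H(3) by (simp add: less_eq_div_iff_mult_less_eq)
  moreover have "v \<le> n + h" unfolding H(5) using prime_gt_0_nat[OF H(2)] by simp
  then have "v \<le> N + h" using n by simp
  ultimately show ?thesis using H t0 pq unfolding a_def b_def g_def
    by (intro bexI[of _ v] exI[of _ t]) auto
qed

text \<open>All v are summed, whether in \<open>V h\<close> or not. Up to U the sieve gives v^(-2)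
  v^(1/2) = v^(-3/2), whose sum is at most 3, plus an error 3 s^8 for each v. Beyond U the number of
  possible t, of order N / v^2, is bound enough.\<close>

lemma card_degenerate_le:
  fixes h N X s :: nat and y U :: real
  assumes h: "h \<ge> 1" and N: "N \<ge> 1" and s: "s \<ge> 1" and U: "U > 0" and X: "X = N + h"
  defines "D \<equiv> 169 * (2 * real h * (1 + real h)) powr (1 / 4)"
  shows "real (card {n \<in> {1..N}. degenerate h y n}) \<le>
    6 * real N * real h * D / (ln (real s + 1))\<^sup>2 + U * (3 * real s ^ 8) + 2 * real N * real h * (1 + ln (real X)) / U"
proof -
  define a where "a = (\<lambda>v. v div gcd v h)"
  define b where "b = (\<lambda>v. (v + h) div gcd v h)"
  define T where "T = (\<lambda>v. 2 * N * h div v ^ 2)"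
  define C where "C = (\<lambda>v. {t \<in> {1..T v}. prime (a v * t - 1) \<and> prime (b v * t - 1)})"
  have D0: "D \<ge> 0" by (simp add: D_def)
  have lns: "ln (real s + 1) > 0" using s by simp
  let ?S = "{n \<in> {1..N}. degenerate h y n}"
  let ?F = "\<lambda>v t. (v + h) * (a v * t - 1)"
  have sub: "?S \<subseteq> (\<Union>v\<in>{1..X}. ?F v ` C v)"
  proof
    fix n assume "n \<in> ?S"
    then obtain v t where "v \<in> {1..X}" "t \<in> C v" "n = (v + h) * (a v * t - 1)"
      using degenerate_parametrization[OF h, of n N y] unfolding C_def T_def a_def b_def X by blast
    then show "n \<in> (\<Union>v\<in>{1..X}. ?F v ` C v)" by blast
  qed
  have Tle: "real (T v) \<le> 2 * real N * real h / real v ^ 2" for v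
    using of_nat_div_le_of_nat[of "2 * N * h" "v ^ 2", where 'a = real] by (simp add: T_def)
  have finC: "finite (C v)" for v by (simp add: C_def)
  let ?c = "2 * real N * real h * D / (ln (real s + 1))\<^sup>2" and ?e = "2 * real N * real h / U"
  have cardC: "real (card (C v)) \<le> ?c * real v powr (- 1 - 1 / 2)
     + (if real v \<le> U then 3 * real s ^ 8 else 0) + ?e * (1 / real v)" if v: "v \<in> {1..X}" for v
  proof (cases "real v \<le> U")
    case True
    have v1: "v \<ge> 1" using v by simp
    have ab: "a v \<ge> 1" "a v < b v" "b v - a v \<le> h" "a v \<le> v" "b v \<le> v + h"
      unfolding a_def b_def by (rule cofactors_of_gcd[OF v1 h])+
    define M where "M = 2 * a v * b v * (b v - a v)"
    have M0: "M > 0" using ab by (simp add: M_def)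
    have "a v * b v * (b v - a v) \<le> v * (v + h) * h" using ab by (intro mult_mono) auto
    also have "\<dots> \<le> v * (v + v * h) * h" using v1 by (intro mult_mono) auto
    finally have "M \<le> 2 * h * (1 + h) * v ^ 2" by (simp add: M_def power2_eq_square algebra_simps)
    then have "real M \<le> real (2 * h * (1 + h) * v ^ 2)" by (rule of_nat_mono)
    then have "real M \<le> 2 * real h * (1 + real h) * real v ^ 2" by (simp add: algebra_simps)
    then have "real M powr (1 / 4) \<le> (2 * real h * (1 + real h) * real v ^ 2) powr (1 / 4)"
      by (intro powr_mono2) auto
    also have "\<dots> = (2 * real h * (1 + real h)) powr (1 / 4) * (real v ^ 2) powr (1 / 4)"
      by (rule powr_mult)
    also have "(real v ^ 2) powr (1 / 4) = real v powr (1 / 2)"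
      using v1 powr_powr[of "real v" 2 "1/4"] by simp
    finally have w0: "(real (card (prime_factors M)) + 1)\<^sup>2 \<le> D * real v powr (1 / 2)"
      using card_prime_factors_le[OF M0] unfolding D_def by linarith
    let ?w = "((real (card (prime_factors M)) + 1) / ln (real s + 1))\<^sup>2"
    from w0 have w: "?w \<le> D * real v powr (1 / 2) / (ln (real s + 1))\<^sup>2"
      by (simp add: power_divide divide_right_mono)
    have "real (card (C v)) \<le> real (T v) * ?w + 3 * real s ^ 8"
      unfolding C_def M_def by (rule card_prime_pairs_le[OF ab(1,2) s])
    also have "real (T v) * ?w
       \<le> (2 * real N * real h / real v ^ 2) * (D * real v powr (1 / 2) / (ln (real s + 1))\<^sup>2)"
      by (intro mult_mono Tle w) auto
    also have "\<dots> = ?c * (real v powr (1 / 2) / real v ^ 2)"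
      by (simp add: mult_ac)
    also have "real v powr (1 / 2) / real v ^ 2 = real v powr (- 1 - 1 / 2)"
      using v1 powr_diff[of "real v" "1/2" 2] by simp
    finally have "real (card (C v)) \<le> ?c * real v powr (- 1 - 1 / 2) + 3 * real s ^ 8"
      by simp
    moreover have "?e * (1 / real v) \<ge> 0" using U by simp
    ultimately show ?thesis unfolding if_P[OF True] by linarith
  next
    case False
    have "card (C v) \<le> card {1..T v}" unfolding C_def by (intro card_mono) auto
    then have "real (card (C v)) \<le> real (T v)" by simp
    also have "\<dots> \<le> 2 * real N * real h * (1 / real v * (1 / real v))" using Tle[of v] by (simp add: power2_eq_square)
    also have "\<dots> \<le> 2 * real N * real h * (1 / U * (1 / real v))"
      using False U by (intro mult_left_mono mult_right_mono frac_le) auto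
    finally have "real (card (C v)) \<le> ?e * (1 / real v)" by simp
    moreover have "?c * real v powr (- 1 - 1 / 2) \<ge> 0"
      using D0 by (intro mult_nonneg_nonneg divide_nonneg_nonneg) auto
    ultimately show ?thesis unfolding if_not_P[OF False] by linarith
  qed
  have "card ?S \<le> card (\<Union>v\<in>{1..X}. ?F v ` C v)"
    by (rule card_mono[OF _ sub]) (use finC in auto)
  also have "\<dots> \<le> (\<Sum>v=1..X. card (?F v ` C v))" by (rule card_UN_le) simp
  also have "\<dots> \<le> (\<Sum>v=1..X. card (C v))" by (intro sum_mono card_image_le finC)
  finally have "real (card ?S) \<le> real (\<Sum>v=1..X. card (C v))" by (rule of_nat_mono)
  also have "\<dots> = (\<Sum>v=1..X. real (card (C v)))" by simp
  also have "\<dots> \<le> (\<Sum>v=1..X. ?c * real v powr (- 1 - 1 / 2)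
     + (if real v \<le> U then 3 * real s ^ 8 else 0) + ?e * (1 / real v))"
    by (intro sum_mono cardC)
  also have "\<dots> = ?c * (\<Sum>v=1..X. real v powr (- 1 - 1 / 2))
     + (\<Sum>v=1..X. if real v \<le> U then 3 * real s ^ 8 else 0) + ?e * (\<Sum>v=1..X. 1 / real v)"
    by (simp only: sum.distrib sum_distrib_left)
  also have "\<dots> \<le> ?c * 3 + U * (3 * real s ^ 8)
     + ?e * (1 + ln (real X))"
  proof (intro add_mono mult_left_mono)
    show "(\<Sum>v=1..X. real v powr (- 1 - 1 / 2)) \<le> 3" using zeta_le[of "1/2" X] by simp
    show "(\<Sum>v=1..X. 1 / real v) \<le> 1 + ln (real X)" using N X by (intro harmonic_le) simp
    have "(\<Sum>v=1..X. if real v \<le> U then 3 * real s ^ 8 else 0) = (\<Sum>v | v \<in> {1..X} \<and> real v \<le> U. 3 * real s ^ 8)"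
      by (rule sum.inter_filter[symmetric]) simp
    also have "\<dots> = real (card {v. v \<in> {1..X} \<and> real v \<le> U}) * (3 * real s ^ 8)" by simp
    also have "\<dots> \<le> U * (3 * real s ^ 8)"
    proof (intro mult_right_mono)
      have "card {v. v \<in> {1..X} \<and> real v \<le> U} \<le> card {1..nat \<lfloor>U\<rfloor>}"
        by (intro card_mono) (auto simp: le_nat_floor)
      then have "card {v. v \<in> {1..X} \<and> real v \<le> U} \<le> nat \<lfloor>U\<rfloor>" by simp
      then show "real (card {v. v \<in> {1..X} \<and> real v \<le> U}) \<le> U" using U by linarith
    qed simp
    finally show "(\<Sum>v=1..X. if real v \<le> U then 3 * real s ^ 8 else 0) \<le> U * (3 * real s ^ 8)" .
  qed (use U D0 in auto)
  also have "\<dots> = 6 * real N * real h * D / (ln (real s + 1))\<^sup>2 + U * (3 * real s ^ 8) + 2 * real N * real h * (1 + ln (real X)) / U"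
    by simp
  finally show ?thesis .
qed

text \<open>U = t^(1/5) and s of size t^(1/40) bring the sieve errors to t^(2/5) and the tail to
  t^(4/5) log t. The constant 9600 is 6 * 40^2, because ln (s + 1) >= ln t / 40.\<close>

lemma card_degenerate_eventually_le:
  assumes h: "h \<ge> 1"
  shows "\<exists>C>0. \<forall>\<^sub>F t in at_top. \<forall>N X y. X = N + h \<longrightarrow> real X = t \<longrightarrow>
    real (card {n \<in> {1..N}. degenerate h y n}) \<le> C * (t / (ln t)\<^sup>2)"
proof -
  define D where "D = 169 * (2 * real h * (1 + real h)) powr (1 / 4)"
  define C where "C = 9600 * real h * D + 2"
  have D0: "D \<ge> 0" by (simp add: D_def)
  have hr: "real h > 0" using h by simp
  have C0: "C > 0" using D0 by (simp add: C_def add_nonneg_pos)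
  have e1: "\<forall>\<^sub>F t::real in at_top. t powr (1 / 5) * (3 * t powr (1 / 5)) \<le> t / (ln t)\<^sup>2" by real_asymp
  have e2: "\<forall>\<^sub>F t::real in at_top. 2 * t * real h * (1 + ln t) / t powr (1 / 5) \<le> t / (ln t)\<^sup>2"
    using hr by real_asymp
  have e3: "\<forall>\<^sub>F t::real in at_top. t > 1 + real h" by real_asymp
  have "\<forall>\<^sub>F t in at_top. \<forall>N X y. X = N + h \<longrightarrow> real X = t \<longrightarrow>
    real (card {n \<in> {1..N}. degenerate h y n}) \<le> C * (t / (ln t)\<^sup>2)"
    using e1 e2 e3
  proof eventually_elim
    case (elim t)
    show ?case
    proof (intro allI impI)
      fix N X :: nat and y :: real assume X: "X = N + h" and t: "real X = t"
      have N: "N \<ge> 1" using elim(3) X t by simp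
      have Nt: "real N \<le> t" using X t by simp
      have t1: "t > 1" using elim(3) hr by linarith
      define s where "s = nat \<lfloor>t powr (1 / 40)\<rfloor>"
      have p1: "t powr (1 / 40) \<ge> 1" using t1 by (simp add: ge_one_powr_ge_zero)
      have s1: "s \<ge> 1" using p1 by (simp add: s_def le_nat_floor)
      have s2: "real s \<le> t powr (1 / 40)" unfolding s_def using p1 by linarith
      have s3: "t powr (1 / 40) \<le> real s + 1" unfolding s_def using p1 by linarith
      have "ln (t powr (1 / 40)) \<le> ln (real s + 1)" using s3 p1 by (subst ln_le_cancel_iff) auto
      then have "ln t / 40 \<le> ln (real s + 1)" using t1 by (simp add: ln_powr)
      then have "(ln t / 40)\<^sup>2 \<le> (ln (real s + 1))\<^sup>2" using t1 by (intro power_mono) auto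
      then have l2: "(ln t)\<^sup>2 / 1600 \<le> (ln (real s + 1))\<^sup>2" by (simp add: power_divide)
      have l0: "(ln t)\<^sup>2 > 0" using t1 by simp
      have s8: "real s ^ 8 \<le> t powr (1 / 5)"
      proof -
        have "real s ^ 8 \<le> (t powr (1 / 40)) ^ 8" using s2 by (intro power_mono) auto
        also have "\<dots> = t powr (1 / 5)" using t1 p1 powr_powr[of t "1/40" 8] by simp
        finally show ?thesis .
      qed
      have "real (card {n \<in> {1..N}. degenerate h y n}) \<le>
        6 * real N * real h * D / (ln (real s + 1))\<^sup>2 + t powr (1 / 5) * (3 * real s ^ 8)
          + 2 * real N * real h * (1 + ln (real X)) / t powr (1 / 5)"
        unfolding D_def using t1 by (intro card_degenerate_le[OF h N s1 _ X]) simp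
      also have "6 * real N * real h * D / (ln (real s + 1))\<^sup>2 \<le> 6 * t * real h * D / ((ln t)\<^sup>2 / 1600)"
        using l2 l0 Nt D0 t1 by (intro frac_le mult_right_mono mult_left_mono mult_nonneg_nonneg) auto
      also have "6 * t * real h * D / ((ln t)\<^sup>2 / 1600) = 9600 * real h * D * (t / (ln t)\<^sup>2)" by simp
      also have "t powr (1 / 5) * (3 * real s ^ 8) \<le> t powr (1 / 5) * (3 * t powr (1 / 5))"
        using s8 by (intro mult_left_mono) auto
      also have "\<dots> \<le> t / (ln t)\<^sup>2" by (rule elim(1))
      also have "2 * real N * real h * (1 + ln (real X)) / t powr (1 / 5) \<le> 2 * t * real h * (1 + ln t) / t powr (1 / 5)"
        unfolding t using Nt t1 by (intro divide_right_mono mult_right_mono) auto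
      also have "\<dots> \<le> t / (ln t)\<^sup>2" by (rule elim(2))
      finally show "real (card {n \<in> {1..N}. degenerate h y n}) \<le> C * (t / (ln t)\<^sup>2)"
        by (simp add: C_def algebra_simps)
    qed
  qed
  then show ?thesis using C0 by blast
qed

section \<open>Upper bound of order x / (log x)^2\<close>

lemma B_upper:
  assumes h: "h \<ge> 1"
  shows "\<exists>C>0. \<forall>\<^sub>F x in at_top. real (B h x) \<le> C * (x / (ln x)\<^sup>2)"
proof -
  obtain C where C: "C > 0" and ev: "\<forall>\<^sub>F t in at_top. \<forall>N X y. X = N + h \<longrightarrow> real X = t \<longrightarrow>
    real (card {n \<in> {1..N}. degenerate h y n}) \<le> C * (t / (ln t)\<^sup>2)"
    using card_degenerate_eventually_le[OF h] by blast
  have "\<forall>\<^sub>F x::real in at_top. \<forall>N X y. X = N + h \<longrightarrow> real X = real (nat \<lfloor>x\<rfloor> + h) \<longrightarrow>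
    real (card {n \<in> {1..N}. degenerate h y n}) \<le> C * (real (nat \<lfloor>x\<rfloor> + h) / (ln (real (nat \<lfloor>x\<rfloor> + h)))\<^sup>2)"
    by (rule eventually_compose_filterlim[OF ev filterlim_floor_add])
  moreover have "\<forall>\<^sub>F x::real in at_top. x * exp (- (1 / sqrt 6) * sqrt (ln x * ln (ln x))) \<le> x / (ln x)\<^sup>2" by real_asymp
  moreover have "\<forall>\<^sub>F x::real in at_top. x > 1 + real h" by real_asymp
  ultimately have "\<forall>\<^sub>F x in at_top. real (B h x) \<le> (1 + 2 * C) * (x / (ln x)\<^sup>2)"
    using nondegenerate_count_eventually_le'[OF h]
  proof eventually_elim
    case (elim x)
    define t where "t = real (nat \<lfloor>x\<rfloor> + h)"
    define y where "y = exp (lexp t)"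
    have x1: "x > 1" using elim(3) by simp
    have xt: "x \<le> t" unfolding t_def using h x1 by linarith
    have tx: "t \<le> 2 * x" unfolding t_def using elim(3) by linarith
    have lxt: "ln x \<le> ln t" "ln x > 0" using xt x1 by simp_all
    have "t / (ln t)\<^sup>2 \<le> 2 * x / (ln x)\<^sup>2"
      using tx xt x1 lxt by (intro frac_le power_mono) auto
    then have deg: "C * (t / (ln t)\<^sup>2) \<le> C * (2 * x / (ln x)\<^sup>2)" using C by (intro mult_left_mono) auto
    let ?N = "{n \<in> {1..nat \<lfloor>x\<rfloor>}. sigma n dvd sigma (n + h) \<and> \<not> degenerate h y n}"
    let ?D = "{n \<in> {1..nat \<lfloor>x\<rfloor>}. degenerate h y n}"
    have "B h x \<le> card (?N \<union> ?D)" unfolding B_eq_card by (intro card_mono) auto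
    also have "\<dots> \<le> card ?N + card ?D" by (rule card_Un_le)
    finally have "real (B h x) \<le> real (card ?N) + real (card ?D)" by linarith
    also have "real (card ?N) \<le> x / (ln x)\<^sup>2"
      using order_trans[OF elim(4) elim(2)[folded lexp_def]] unfolding y_def t_def .
    also have "real (card ?D) \<le> C * (2 * x / (ln x)\<^sup>2)"
    proof -
      have "real (card ?D) \<le> C * (t / (ln t)\<^sup>2)" using elim(1) unfolding t_def by blast
      then show ?thesis using deg by (rule order_trans)
    qed
    finally show ?case by (simp add: algebra_simps add_divide_distrib)
  qed
  moreover have "1 + 2 * C > 0" using C by simp
  ultimately show ?thesis by blast
qed

section \<open>Lower bound from the Bateman--Horn conjecture\<close>

lemma inverse_ln_square_integral_ge:
  assumes "T \<ge> 2"
  shows "integral {2..T} (\<lambda>u::real. 1 / ln u ^ 2) \<ge> (T - 2) / (ln T)\<^sup>2"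
proof -
  have "integral {2..T} (\<lambda>u::real. 1 / (ln T)\<^sup>2) \<le> integral {2..T} (\<lambda>u. 1 / ln u ^ 2)"
  proof (rule integral_le)
    show "(\<lambda>u::real. 1 / ln u ^ 2) integrable_on {2..T}"
      by (intro integrable_continuous_real continuous_intros) auto
    show "1 / (ln T)\<^sup>2 \<le> 1 / ln u ^ 2" if "u \<in> {2..T}" for u
      using that by (intro frac_le power_mono) auto
  qed auto
  then show ?thesis using assms by simp
qed

lemma Bateman_Horn_linear_pair:
  fixes a b :: nat
  assumes BH: Bateman_Horn_conjecture and ab: "a \<ge> 1" "a < b"
  shows "\<exists>c>0. \<forall>\<^sub>F T in at_top.
    c * ((T - 2) / (ln T)\<^sup>2) \<le> real (card {t::nat. 1 \<le> t \<and> real t \<le> T \<and> prime (a * t - 1) \<and> prime (b * t - 1)})"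
proof -
  define f where "f = (\<lambda>c::nat. [:- 1, int c:])"
  define G where "G = {f a, f b}"
  have f_inj: "f a \<noteq> f b" using ab by (simp add: f_def)
  have cardG: "card G = 2" using f_inj by (simp add: G_def)
  have poly_f: "poly (f c) x = int c * x - 1" for c x by (simp add: f_def)
  have irr: "irreducible (f c)" if "c \<ge> 1" for c
    unfolding f_def using that by (intro irreducible_linear_poly) auto
  have roots: "root_count_mod G p < p" if p: "prime p" for p
  proof -
    \<comment> \<open>The local condition holds at every prime because t = 0 gives (-1) (-1) =
      1.\<close>
    have "poly (\<Prod>g\<in>G. g) 0 = 1" using f_inj by (simp add: G_def poly_f)
    then have "\<not> int p dvd poly (\<Prod>g\<in>G. g) 0" using prime_gt_1_nat[OF p] by simp
    then have "{x \<in> {0..<int p}. int p dvd poly (\<Prod>g\<in>G. g) x} \<subseteq> {1..<int p}"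
      by (auto simp: less_le) (metis int_one_le_iff_zero_less order_le_less)
    then have "card {x \<in> {0..<int p}. int p dvd poly (\<Prod>g\<in>G. g) x} \<le> card {1..<int p}"
      by (intro card_mono) auto
    then show ?thesis unfolding root_count_mod_def using prime_gt_1_nat[OF p] by simp
  qed
  have "finite G \<and> G \<noteq> {} \<and> (\<forall>g\<in>G. irreducible g \<and> lead_coeff g > 0) \<and> (\<forall>p. prime p \<longrightarrow> root_count_mod G p < p)"
    using irr ab roots by (auto simp: G_def) (auto simp: f_def)
  then obtain S where S: "S > 0" and asy:
     "(\<lambda>T::real. real (card {t::nat. 1 \<le> t \<and> real t \<le> T \<and> (\<forall>g\<in>G. prime (poly g (int t)))}))
        \<sim>[at_top] (\<lambda>T. S / real (\<Prod>g\<in>G. degree g) * integral {2..T} (\<lambda>u. 1 / ln u ^ card G))"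
    using BH unfolding Bateman_Horn_conjecture_def by blast
  define P where "P = (\<lambda>T::real. real (card {t::nat. 1 \<le> t \<and> real t \<le> T \<and> (\<forall>g\<in>G. prime (poly g (int t)))}))"
  define I where "I = (\<lambda>T::real. S * integral {2..T} (\<lambda>u::real. 1 / ln u ^ 2))"
  have deg: "(\<Prod>g\<in>G. degree g) = 1" using f_inj ab by (simp add: G_def) (simp add: f_def)
  have "P \<sim>[at_top] I" using asy unfolding P_def I_def cardG deg by simp
  \<comment> \<open>Asymptotic equivalence assigns the quotient 1 where both sides vanish;
    positivity of \<open>I\<close> for T > 2 excludes this value below.\<close>
  then have "((\<lambda>T. if P T = 0 \<and> I T = 0 then 1 else P T / I T) \<longlongrightarrow> 1) at_top" by (rule asymp_equivD)
  then have "\<forall>\<^sub>F T in at_top. (if P T = 0 \<and> I T = 0 then 1 else P T / I T) > 1 / 2"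
    by (rule order_tendstoD) simp
  moreover have "\<forall>\<^sub>F T::real in at_top. T > 2" by (rule eventually_gt_at_top)
  ultimately have "\<forall>\<^sub>F T in at_top. S / 2 * ((T - 2) / (ln T)\<^sup>2)
     \<le> real (card {t::nat. 1 \<le> t \<and> real t \<le> T \<and> prime (a * t - 1) \<and> prime (b * t - 1)})"
  proof eventually_elim
    case (elim T)
    have "(T - 2) / (ln T)\<^sup>2 > 0" using elim(2) by simp
    moreover have int: "integral {2..T} (\<lambda>u::real. 1 / ln u ^ 2) \<ge> (T - 2) / (ln T)\<^sup>2"
      using elim(2) by (intro inverse_ln_square_integral_ge) simp
    ultimately have I0: "I T > 0" unfolding I_def using S by (intro mult_pos_pos) linarith+
    then have "P T / I T > 1 / 2" using elim(1) by simp
    then have "I T / 2 < P T" using I0 by (simp add: field_simps)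
    moreover have "S * ((T - 2) / (ln T)\<^sup>2) \<le> I T" unfolding I_def using int S by (intro mult_left_mono) auto
    moreover have "S / 2 * Q \<le> P T" if "I T / 2 < P T" "S * Q \<le> I T" for Q
      using that by simp
    ultimately have "S / 2 * ((T - 2) / (ln T)\<^sup>2) \<le> P T" by blast
    moreover have "{t::nat. 1 \<le> t \<and> real t \<le> T \<and> (\<forall>g\<in>G. prime (poly g (int t)))}
      = {t. 1 \<le> t \<and> real t \<le> T \<and> prime (a * t - 1) \<and> prime (b * t - 1)}"
    proof -
      have "prime (poly (f c) (int t)) \<longleftrightarrow> prime (c * t - 1)" if "1 \<le> t" "c \<ge> 1" for c t
      proof -
        have "1 \<le> c * t" using that by simp
        then have "poly (f c) (int t) = int (c * t - 1)" by (simp add: poly_f of_nat_diff)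
        then show ?thesis by simp
      qed
      then show ?thesis using ab unfolding G_def by auto
    qed
    ultimately show ?case unfolding P_def by simp
  qed
  then show ?thesis using S by (intro exI[of _ "S / 2"]) simp
qed

lemma V_ratio:
  assumes "v \<in> V h" and h: "h \<ge> 1"
  shows "\<exists>m. sigma v * (v + h) = m * (v * sigma (v + h))"
proof -
  have v: "v \<ge> 2" "abundancy v / abundancy (v + h) \<in> \<nat>" using assms by (auto simp: V_def)
  then obtain m where m: "abundancy v / abundancy (v + h) = real m" by (auto elim: Nats_cases)
  have s0: "sigma v > 0" "sigma (v + h) > 0" using v by (auto intro: sigma_pos)
  have "real (sigma v) * real (v + h) = real m * (real v * real (sigma (v + h)))"
    using m s0 v unfolding abundancy_def by (simp add: field_simps)
  then have "real (sigma v * (v + h)) = real (m * (v * sigma (v + h)))" by (simp only: of_nat_mult)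
  then have "sigma v * (v + h) = m * (v * sigma (v + h))" by (simp only: of_nat_eq_iff)
  then show ?thesis by blast
qed

text \<open>The converse of the parametrization. (v + h) (p + 1) = g a b t = v (q + 1) gives (v + h)
  p + h = v q, and the relation defining \<open>V h\<close>, divided by g, carries sigma of one
  product to a multiple of sigma of the other. For t > v + h + 1 both primes exceed v + h, so they
  are coprime to the cofactors.\<close>

lemma sigma_dvd_of_prime_pair:
  fixes v h t :: nat
  assumes v: "v \<ge> 1" and h: "h \<ge> 1" and m: "sigma v * (v + h) = m * (v * sigma (v + h))" and t: "t > v + h + 1"
  defines "a \<equiv> v div gcd v h" and "b \<equiv> (v + h) div gcd v h"
  assumes pr: "prime (a * t - 1)" "prime (b * t - 1)"
  shows "sigma ((v + h) * (a * t - 1)) dvd sigma ((v + h) * (a * t - 1) + h)"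
proof -
  define g where "g = gcd v h"
  have ab: "g \<ge> 1" "v = g * a" "v + h = g * b" "a \<ge> 1" "a < b"
    unfolding g_def a_def b_def by (rule cofactors_of_gcd[OF v h])+
  define p q where "p = a * t - 1" and "q = b * t - 1"
  have "t \<le> a * t" "t \<le> b * t" using ab by simp_all
  then have pq: "p + 1 = a * t" "q + 1 = b * t" "p > v + h" "q > v + h"
    unfolding p_def q_def using t by linarith+
  have "\<not> p dvd v + h" "\<not> q dvd v" using pq v by (auto dest: dvd_imp_le)
  then have cop: "coprime (v + h) p" "coprime v q"
    using prime_imp_coprime[OF pr(1)] prime_imp_coprime[OF pr(2)] unfolding p_def q_def
    by (simp_all add: coprime_commute)
  have "(v + h) * p + h + v = (v + h) * (p + 1)" by simp
  also have "\<dots> = g * (b * (a * t))" unfolding pq ab(3) by (simp only: mult_ac)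
  also have "\<dots> = (g * a) * (q + 1)" unfolding pq by (simp only: mult_ac)
  also have "\<dots> = v * q + v" unfolding ab(2)[symmetric] by simp
  finally have eq: "(v + h) * p + h = v * q" by simp
  have pos: "p > 0" "q > 0" using pq by auto
  have "g * (sigma v * b) = g * (m * (a * sigma (v + h)))"
    using m unfolding ab(3) by (metis ab(2) mult.assoc mult.left_commute)
  then have vb: "sigma v * b = m * (a * sigma (v + h))" using ab(1) by simp
  have "sigma (v * q) = sigma v * (q + 1)"
    using sigma_mult_coprime[OF cop(2)] v pos pr(2) by (simp add: sigma_prime q_def)
  also have "\<dots> = (sigma v * b) * t" unfolding pq by (simp only: mult_ac)
  also have "\<dots> = m * (sigma (v + h) * (p + 1))" unfolding vb pq by (simp only: mult_ac)
  also have "sigma (v + h) * (p + 1) = sigma ((v + h) * p)"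
    using sigma_mult_coprime[OF cop(1)] v pos pr(1) by (simp add: sigma_prime p_def)
  finally have "sigma ((v + h) * p) dvd sigma (v * q)" by simp
  then have "sigma ((v + h) * p) dvd sigma ((v + h) * p + h)" unfolding eq .
  then show ?thesis unfolding p_def .
qed

lemma B_lower:
  assumes h: "h \<ge> 1" and "V h \<noteq> {}" and BH: Bateman_Horn_conjecture
  shows "\<exists>c>0. \<forall>\<^sub>F x in at_top. c * (x / (ln x)\<^sup>2) \<le> real (B h x)"
proof -
  obtain v where vV: "v \<in> V h" using assms by blast
  then have v: "v \<ge> 1" by (auto simp: V_def)
  obtain m where m: "sigma v * (v + h) = m * (v * sigma (v + h))" using V_ratio[OF vV h] by blast
  define a b where "a = v div gcd v h" and "b = (v + h) div gcd v h"
  have ab: "a \<ge> 1" "a < b" "a \<le> v" unfolding a_def b_def by (rule cofactors_of_gcd[OF v h])+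
  \<comment> \<open>n = (v + h) (a t - 1) <= (v + h) v t, so t <= x / k ensures n <= x.\<close>
  define k where "k = real ((v + h) * v)"
  have k: "k > 0" using v by (simp add: k_def)
  obtain c where c: "c > 0" and ev: "\<forall>\<^sub>F T in at_top. c * ((T - 2) / (ln T)\<^sup>2)
    \<le> real (card {t::nat. 1 \<le> t \<and> real t \<le> T \<and> prime (a * t - 1) \<and> prime (b * t - 1)})"
    using Bateman_Horn_linear_pair[OF BH ab(1,2)] by blast
  have lim: "filterlim (\<lambda>x::real. x / k) at_top at_top" using k by real_asymp
  then have ev': "\<forall>\<^sub>F x in at_top. c * ((x / k - 2) / (ln (x / k))\<^sup>2)
    \<le> real (card {t::nat. 1 \<le> t \<and> real t \<le> x / k \<and> prime (a * t - 1) \<and> prime (b * t - 1)})"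
    by (rule eventually_compose_filterlim[OF ev])
  have "\<forall>\<^sub>F x in at_top. c / (2 * k) * (x / (ln x)\<^sup>2) \<le> c * ((x / k - 2) / (ln (x / k))\<^sup>2) - (real v + real h + 1)"
  proof -
    have "\<forall>\<^sub>F y::real in at_top. 3 / 4 * (y / (ln y + ln k)\<^sup>2) \<le> (y - 2) / (ln y)\<^sup>2" by real_asymp
    then have "\<forall>\<^sub>F x in at_top. 3 / 4 * (x / k / (ln (x / k) + ln k)\<^sup>2) \<le> (x / k - 2) / (ln (x / k))\<^sup>2"
      by (rule eventually_compose_filterlim[OF _ lim])
    \<comment> \<open>One quarter of c / k was lost in passing from x / k - 2 and ln (x / k) to x /
      k and ln x; a second quarter pays for the finitely many t <= v + h + 1 that are
      discarded.\<close>
    moreover have "filterlim (\<lambda>x. c / (4 * k) * (x / (ln x)\<^sup>2)) at_top at_top" using c k by real_asymp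
    then have "\<forall>\<^sub>F x in at_top. real v + real h + 1 \<le> c / (4 * k) * (x / (ln x)\<^sup>2)"
      by (simp only: filterlim_at_top)
    moreover have "\<forall>\<^sub>F x::real in at_top. x > 0" by (rule eventually_gt_at_top)
    ultimately show ?thesis
    proof eventually_elim
      case (elim x)
      have "ln (x / k) + ln k = ln x" using elim(3) k by (simp add: ln_div)
      with elim(1) have "c * (3 / 4 * (x / k / (ln x)\<^sup>2)) \<le> c * ((x / k - 2) / (ln (x / k))\<^sup>2)"
        using c by (intro mult_left_mono) auto
      moreover have "c * (3 / 4 * (x / k / (ln x)\<^sup>2)) = c / (2 * k) * (x / (ln x)\<^sup>2) + c / (4 * k) * (x / (ln x)\<^sup>2)"
        using k by (simp add: field_simps)
      ultimately show ?case using elim(2) by linarith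
    qed
  qed
  with ev' have "\<forall>\<^sub>F x in at_top. c / (2 * k) * (x / (ln x)\<^sup>2) \<le> real (B h x)"
  proof eventually_elim
    case (elim x)
    define S where "S = {t::nat. 1 \<le> t \<and> real t \<le> x / k \<and> prime (a * t - 1) \<and> prime (b * t - 1)}"
    define F where "F = (\<lambda>t. (v + h) * (a * t - 1))"
    have finS: "finite S" unfolding S_def
      by (rule finite_subset[of _ "{..nat \<lfloor>x / k\<rfloor>}"]) (auto simp: le_nat_floor)
    have inj: "inj_on F (S - {..v + h + 1})"
    proof (rule inj_onI)
      fix t u assume tu: "t \<in> S - {..v + h + 1}" "u \<in> S - {..v + h + 1}" "F t = F u"
      have "1 \<le> a * t" "1 \<le> a * u" using tu(1,2) ab by (auto simp: S_def)
      moreover have "a * t - 1 = a * u - 1" using tu(3) v unfolding F_def by simp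
      ultimately have "a * t = a * u" by linarith
      then show "t = u" using ab by simp
    qed
    have img: "F ` (S - {..v + h + 1}) \<subseteq> {n \<in> {1..nat \<lfloor>x\<rfloor>}. sigma n dvd sigma (n + h)}"
    proof
      fix n assume "n \<in> F ` (S - {..v + h + 1})"
      then obtain t where "t \<in> S - {..v + h + 1}" and n: "n = F t" by blast
      then have t: "t \<in> S" "t > v + h + 1" by simp_all
      have tS: "1 \<le> t" "real t \<le> x / k" "prime (a * t - 1)" "prime (b * t - 1)" using t(1) by (auto simp: S_def)
      have "sigma n dvd sigma (n + h)" unfolding n F_def a_def
        by (rule sigma_dvd_of_prime_pair[OF v h m t(2)]) (use tS in \<open>simp_all add: a_def b_def\<close>)
      moreover have "n \<ge> 1" unfolding n F_def using v prime_gt_0_nat[OF tS(3)] by simp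
      moreover have "n \<le> nat \<lfloor>x\<rfloor>"
      proof -
        have "n \<le> (v + h) * (v * t)" unfolding n F_def using ab(3)
          by (intro mult_left_mono) (auto intro: order_trans[OF diff_le_self mult_right_mono])
        then have "real n \<le> real ((v + h) * (v * t))" by (rule of_nat_mono)
        also have "\<dots> = k * real t" by (simp add: k_def)
        also have "\<dots> \<le> x" using tS(2) k by (simp add: field_simps)
        finally show ?thesis by (simp add: le_nat_floor)
      qed
      ultimately show "n \<in> {n \<in> {1..nat \<lfloor>x\<rfloor>}. sigma n dvd sigma (n + h)}" by simp
    qed
    have "1 \<le> t" if "t \<in> S" for t using that by (simp add: S_def)
    then have "S \<subseteq> (S - {..v + h + 1}) \<union> {1..v + h + 1}" by auto
    then have "card S \<le> card ((S - {..v + h + 1}) \<union> {1..v + h + 1})" using finS by (intro card_mono) auto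
    also have "\<dots> \<le> card (S - {..v + h + 1}) + (v + h + 1)"
      using card_Un_le[of "S - {..v + h + 1}" "{1..v + h + 1}"] by simp
    also have "card (S - {..v + h + 1}) = card (F ` (S - {..v + h + 1}))" using inj by (simp add: card_image)
    also have "\<dots> \<le> B h x" unfolding B_eq_card by (rule card_mono[OF _ img]) simp
    finally have "real (card S) \<le> real (B h x) + (real v + real h + 1)" by linarith
    then show ?case using elim unfolding S_def by linarith
  qed
  moreover have "c / (2 * k) > 0" using c k by simp
  ultimately show ?thesis by blast
qed

theorem corollary3p10:
  fixes h :: nat
  assumes "h \<ge> 1"
  shows "(V h = {} \<longrightarrow>
            (\<exists>\<epsilon> :: real \<Rightarrow> real. (\<epsilon> \<longlongrightarrow> 0) at_top \<and>
               (\<forall>\<^sub>F x in at_top.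
                  real (B h x) \<le> x * exp (- (1 / sqrt 6 + \<epsilon> x) * sqrt (ln x * ln (ln x))))))
       \<and> (V h \<noteq> {} \<longrightarrow> Bateman_Horn_conjecture \<longrightarrow>
            (\<exists>c>0. \<exists>C>0. \<forall>\<^sub>F x in at_top.
               c * (x / (ln x)\<^sup>2) \<le> real (B h x) \<and> real (B h x) \<le> C * (x / (ln x)\<^sup>2)))"
proof (intro conjI impI)
  assume "V h = {}"
  then have "\<forall>\<^sub>F x in at_top. real (B h x) \<le> x * exp (- (1 / sqrt 6 + 0) * sqrt (ln x * ln (ln x)))"
    using B_upper_of_V_empty[OF assms] by (simp add: lexp_def)
  \<comment> \<open>The error function can be 0, since the proven saving has the larger constant
    41/100.\<close>
  then show "\<exists>\<epsilon> :: real \<Rightarrow> real. (\<epsilon> \<longlongrightarrow> 0) at_top \<and>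
      (\<forall>\<^sub>F x in at_top. real (B h x) \<le> x * exp (- (1 / sqrt 6 + \<epsilon> x) * sqrt (ln x * ln (ln x))))"
    by (intro exI[of _ "\<lambda>_. 0"] conjI tendsto_const)
next
  assume "V h \<noteq> {}" Bateman_Horn_conjecture
  then obtain c C where "c > 0" "C > 0" and
    ev: "\<forall>\<^sub>F x in at_top. c * (x / (ln x)\<^sup>2) \<le> real (B h x)" "\<forall>\<^sub>F x in at_top. real (B h x) \<le> C * (x / (ln x)\<^sup>2)"
    using B_lower[OF assms] B_upper[OF assms] by blast
  from eventually_conj[OF ev] \<open>c > 0\<close> \<open>C > 0\<close>
  show "\<exists>c>0. \<exists>C>0. \<forall>\<^sub>F x in at_top. c * (x / (ln x)\<^sup>2) \<le> real (B h x) \<and> real (B h x) \<le> C * (x / (ln x)\<^sup>2)"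
    by blast
qed

end
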